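(* Let $1\le p\le\infty$, let $\Omega\subset\mathbb{R}^n$ be a bounded open set, and let $Y\subset\mathbb{R}^n$ be an open bounded rectangle. For each $h\in\mathbb{N}=\{1,2,\dots\}$ let $u_h\in L^p_{\mathrm{loc}}(\mathbb{R}^n)$ be $Y$-periodic. Suppose that $u_h\to u$ weakly in $L^p(Y)$ (weak-$*$ if $p=\infty$) as $h\to\infty$. Define $w_h(x)=u_h(hx)$. Then, as $h\to\infty$, $$w_h\to \frac{1}{|Y|}\int_Y u(x)\,dx$$ weakly in $L^p(\Omega)$ (weak-$*$ if $p=\infty$), where the limit is regarded as a constant function on $\Omega$.
   Context: Functions are real-valued. $|Y|$ denotes the Lebesgue measure of $Y$. An open bounded rectangle is a product of $n$ bounded open intervals, with side lengths $\ell_1,\dots,\ell_n>0$. A function $u$ on $\mathbb{R}^n$ is $Y$-periodic if $u(x+\ell_j e_j)=u(x)$ for a.e. $x\in\mathbb{R}^n$ and each $j=1,\dots,n$, where $e_1,\dots,e_n$ is the standard basis of $\mathbb{R}^n$. *)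

theory Defs
  imports "HOL-Analysis.Analysis" "HOL-Probability.Essential_Supremum"
begin

text \<open>
  Elements of \<open>L\<^sup>p\<close> are represented by genuine functions rather than by classes
  modulo equality almost everywhere; accordingly \<open>Lp_norm\<close> is only a seminorm.
  The exponent is of type \<^typ>\<open>ennreal\<close>, so that \<open>p = \<infinity>\<close> is a value.
\<close>

definition Lp_space :: "ennreal \<Rightarrow> 'a measure \<Rightarrow> ('a \<Rightarrow> real) set" where
  "Lp_space p M = {f \<in> borel_measurable M.
     if p = \<infinity> then esssup M (\<lambda>x. ennreal \<bar>f x\<bar>) < \<infinity>
     else integrable M (\<lambda>x. \<bar>f x\<bar> powr enn2real p)}"

definition Lp_norm :: "ennreal \<Rightarrow> 'a measure \<Rightarrow> ('a \<Rightarrow> real) \<Rightarrow> real" where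
  "Lp_norm p M f =
     (if p = \<infinity> then enn2real (esssup M (\<lambda>x. ennreal \<bar>f x\<bar>))
      else (LINT x|M. \<bar>f x\<bar> powr enn2real p) powr (1 / enn2real p))"

definition Lp_loc :: "ennreal \<Rightarrow> ('a::euclidean_space \<Rightarrow> real) set" where
  "Lp_loc p = {f. \<forall>K. compact K \<longrightarrow> f \<in> Lp_space p (lebesgue_on K)}"

text \<open>
  The values of such an \<open>F\<close> outside \<open>Lp_space p M\<close> are irrelevant. The bound makes
  \<open>F\<close> constant on classes modulo equality almost everywhere, so these are
  exactly the continuous linear functionals on the Banach space \<open>L\<^sup>p\<close>.
\<close>

definition Lp_functional :: "ennreal \<Rightarrow> 'a measure \<Rightarrow> (('a \<Rightarrow> real) \<Rightarrow> real) \<Rightarrow> bool" where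
  "Lp_functional p M F \<longleftrightarrow>
     (\<forall>f\<in>Lp_space p M. \<forall>g\<in>Lp_space p M. F (\<lambda>x. f x + g x) = F f + F g) \<and>
     (\<forall>c. \<forall>f\<in>Lp_space p M. F (\<lambda>x. c * f x) = c * F f) \<and>
     (\<exists>C. \<forall>f\<in>Lp_space p M. \<bar>F f\<bar> \<le> C * Lp_norm p M f)"

text \<open>
  Weak convergence in \<open>L\<^sup>p\<close> for \<open>p < \<infinity>\<close>, and for \<open>p = \<infinity>\<close> weak-* convergence in \<open>L\<^sup>\<infinity>\<close>
  as the dual of \<open>L\<^sup>1\<close>. Sequences are indexed by the positive integers; the term
  with index \<open>0\<close> is disregarded.
\<close>

definition Lp_weak_LIMSEQ ::
    "ennreal \<Rightarrow> 'a measure \<Rightarrow> (nat \<Rightarrow> 'a \<Rightarrow> real) \<Rightarrow> ('a \<Rightarrow> real) \<Rightarrow> bool" where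
  "Lp_weak_LIMSEQ p M f g \<longleftrightarrow>
     (\<forall>h\<ge>1. f h \<in> Lp_space p M) \<and> g \<in> Lp_space p M \<and>
     (if p = \<infinity>
      then \<forall>\<phi>\<in>Lp_space 1 M. (\<lambda>h. LINT x|M. f h x * \<phi> x) \<longlonglongrightarrow> (LINT x|M. g x * \<phi> x)
      else \<forall>F. Lp_functional p M F \<longrightarrow> (\<lambda>h. F (f h)) \<longlonglongrightarrow> F g)"

text \<open>Periodicity with respect to a rectangle whose vector of side lengths is \<open>l\<close>.\<close>

definition ae_periodic :: "real ^ 'n \<Rightarrow> (real ^ 'n \<Rightarrow> real) \<Rightarrow> bool" where
  "ae_periodic l u \<longleftrightarrow> (\<forall>j. AE x in lebesgue. u (x + (l $ j) *\<^sub>R axis j 1) = u x)"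

end

theory Submission
  imports Defs
begin

text \<open>
  Sorting the points of \<open>h *\<^sub>R Q\<close> for a box \<open>Q\<close> into translates of \<open>Y\<close> amounts to counting lattice
  points in each coordinate, and gives \<open>\<integral>\<^sub>Q f (h *\<^sub>R x) dx = (|Q| / |Y| + o(1)) * \<integral>\<^sub>Y f\<close> with an error that
  depends only on \<open>Q\<close> and on the integral of \<open>\<bar>f\<bar>\<close> over \<open>Y\<close>. Hence norm bounds pass from \<open>u h\<close> to \<open>w h\<close>,
  and the integrals of \<open>w h\<close> over boxes converge. By a gliding hump argument the weakly convergent
  sequence \<open>u h\<close> is bounded in \<open>L\<^sup>p\<close> and uniformly integrable on \<open>Y\<close>; uniform integrability, which \<open>w h\<close>
  inherits, extends the convergence from boxes to measurable sets by a Dynkin argument, and thence to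
  bounded test functions. For \<open>p < \<infinity>\<close> a continuous functional \<open>F\<close> is integration against a density \<open>g\<close>
  on bounded functions, and the part of \<open>F\<close> living on \<open>{N < \<bar>g\<bar>}\<close> is uniformly small along \<open>w h\<close>: for
  \<open>p = 1\<close> by uniform integrability, for \<open>p > 1\<close> because \<open>F\<close> cannot be large on many disjointly supported
  functions. For \<open>p = \<infinity>\<close> test functions in \<open>L\<^sup>1\<close> are truncated directly.
\<close>

section \<open>Gliding hump arguments\<close>

text \<open>Three obstacles shape the proof. Both \<open>u h\<close> and the dilation factor vary
  with \<open>h\<close>, so averaging one fixed periodic function does not suffice; estimates on the
  dilates have to be uniform over functions with a common bound. Next, a functional in
  \<open>Lp_functional\<close> is an abstract bounded linear map, and the dual of L^p is never
  identified: \<open>F\<close> receives a density that is merely known to be integrable and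
  represents \<open>F\<close> only where it is bounded, and what remains is controlled by estimates
  on \<open>F\<close> itself. Finally, for \<open>p = 1\<close> a norm bound does not exclude
  concentration on small sets, so uniform integrability has to be extracted from weak convergence,
  in the manner of Vitali-Hahn-Saks and Dunford-Pettis. Both kinds of convergence imply convergence
  against bounded functions on \<open>Y\<close>; besides periodicity and an L^1 bound this is what
  the common core \<open>dilate_weak_limit_bounded_test\<close> builds on, and the exponent returns
  only when unbounded test objects are treated.\<close>

lemma (in finite_measure) tendsto_integral_tail:
  fixes f :: "'a \<Rightarrow> real"
  assumes f: "integrable M f" and [measurable]: "g \<in> borel_measurable M"
  shows "(\<lambda>N. LINT x|M. indicator {x \<in> space M. real N < \<bar>g x\<bar>} x * f x) \<longlonglongrightarrow> 0"
proof -
  have "(\<lambda>N. LINT x|M. indicator {x \<in> space M. real N < \<bar>g x\<bar>} x * f x) \<longlonglongrightarrow> (LINT x|M. 0)"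
  proof (rule integral_dominated_convergence[where w = "\<lambda>x. \<bar>f x\<bar>"])
    show "AE x in M. (\<lambda>N. indicator {x \<in> space M. real N < \<bar>g x\<bar>} x * f x) \<longlonglongrightarrow> 0"
    proof (intro AE_I2 tendsto_eventually)
      fix x
      obtain k :: nat where "\<bar>g x\<bar> \<le> real k" using real_arch_simple by blast
      then show "\<forall>\<^sub>F N in sequentially. indicator {x \<in> space M. real N < \<bar>g x\<bar>} x * f x = 0"
        by (intro eventually_sequentiallyI[of k]) (auto simp: indicator_def)
    qed
  qed (use f in \<open>auto simp: indicator_def\<close>)
  then show ?thesis by simp
qed

text \<open>Cut at a height \<open>N\<close> above which \<open>\<bar>f\<bar>\<close> has integral
  below \<open>e / 2\<close>; the part below \<open>N\<close> contributes at most \<open>N\<close>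
  times the measure of \<open>E\<close>.\<close>

lemma (in finite_measure) integral_absolutely_continuous:
  fixes f :: "'a \<Rightarrow> real"
  assumes f: "integrable M f" and "0 < e"
  shows "\<exists>d>0. \<forall>E\<in>sets M. measure M E < d \<longrightarrow> (LINT x|M. indicator E x * \<bar>f x\<bar>) < e"
proof -
  have [measurable]: "f \<in> borel_measurable M" using f by auto
  have "(\<lambda>N. LINT x|M. indicator {x \<in> space M. real N < \<bar>f x\<bar>} x * \<bar>f x\<bar>) \<longlonglongrightarrow> 0"
    using f by (intro tendsto_integral_tail) auto
  then have "eventually (\<lambda>N. (LINT x|M. indicator {x \<in> space M. real N < \<bar>f x\<bar>} x * \<bar>f x\<bar>) < e / 2) sequentially"
    using \<open>0 < e\<close> by (intro order_tendstoD(2)[where y = 0]) auto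
  then obtain N :: nat where N: "(LINT x|M. indicator {x \<in> space M. real N < \<bar>f x\<bar>} x * \<bar>f x\<bar>) < e / 2"
    by (auto simp: eventually_sequentially)
  \<comment> \<open>The \<open>+ 1\<close> keeps the quotient meaningful when
    \<open>N = 0\<close>.\<close>
  define d where "d = e / (2 * (real N + 1))"
  have "0 < d" using \<open>0 < e\<close> by (auto simp: d_def intro!: divide_pos_pos)
  moreover have "(LINT x|M. indicator E x * \<bar>f x\<bar>) < e"
    if [measurable]: "E \<in> sets M" and E: "measure M E < d" for E
  proof -
    have i0: "integrable M (\<lambda>x. indicator E x * \<bar>f x\<bar>)"
      by (rule Bochner_Integration.integrable_bound[OF f]) (auto simp: indicator_def)
    have i1: "integrable M (\<lambda>x. indicator {x \<in> space M. real N < \<bar>f x\<bar>} x * \<bar>f x\<bar>)"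
      by (rule Bochner_Integration.integrable_bound[OF f]) (auto simp: indicator_def)
    have i2: "integrable M (\<lambda>x. real N * indicator E x)"
      by (simp add: emeasure_eq_measure)
    have "(LINT x|M. indicator E x * \<bar>f x\<bar>)
        \<le> (LINT x|M. indicator {x \<in> space M. real N < \<bar>f x\<bar>} x * \<bar>f x\<bar> + real N * indicator E x)"
      by (intro integral_mono i0 Bochner_Integration.integrable_add i1 i2) (auto simp: indicator_def)
    also have "\<dots> = (LINT x|M. indicator {x \<in> space M. real N < \<bar>f x\<bar>} x * \<bar>f x\<bar>) + real N * measure M E"
      using i1 i2 by simp
    also have "real N * measure M E \<le> (real N + 1) * d"
      using E \<open>0 < d\<close> by (intro mult_mono) auto
    also have "(real N + 1) * d = e / 2"
      by (simp add: d_def field_simps)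
    finally show ?thesis using N by simp
  qed
  ultimately show ?thesis by blast
qed

text \<open>The core of Sokal's proof of the uniform boundedness principle: the signs \<open>s\<close> are chosen greedily,
  so that at \<open>r n\<close> the \<open>n\<close>-th partial sum is at least as large as its last summand, while the
  remaining geometric tail is at most two thirds of it.\<close>

lemma gliding_hump_real:
  fixes A :: "nat \<Rightarrow> nat \<Rightarrow> real" and c :: "nat \<Rightarrow> real"
  assumes le: "\<And>i h. \<bar>A i h\<bar> \<le> c h" and ge: "\<And>h. c h / 2 \<le> A h h"
    and bdd: "\<And>s r. (\<And>n. \<bar>s n\<bar> = (1::real)) \<Longrightarrow> \<exists>K. \<forall>h. \<bar>\<Sum>n. s n * (1/4)^n * A (r n) h\<bar> \<le> K"
  shows "\<exists>K. \<forall>h. c h \<le> K"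
proof (rule ccontr)
  assume "\<not> ?thesis"
  \<comment> \<open>The factor \<open>4 ^ n\<close> cancels the weight \<open>(1/4)^n\<close> of the
    n-th summand, so that at \<open>r n\<close> this summand still exceeds
    \<open>n / 2\<close>.\<close>
  then have "\<exists>h. real n * 4 ^ n < c h" for n :: nat
    by (meson not_le)
  then obtain r where r: "\<And>n. real n * 4 ^ n < c (r n)"
    by metis
  have c0: "0 \<le> c h" for h using le[of h h] by linarith
  define \<sigma> where "\<sigma> n P = (if 0 \<le> P then 1 else -1 :: real)" for n :: nat and P :: real
  \<comment> \<open>The recursion carries the partial sum as a function of \<open>h\<close>, since
    the next sign depends on its value at \<open>r n\<close>.\<close>
  define S where "S = rec_nat (\<lambda>h. 0 :: real)
     (\<lambda>n P h. P h + \<sigma> n (P (r n)) * (1/4)^n * A (r n) h)"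
  define s where "s n = \<sigma> n (S n (r n))" for n
  have S0: "S 0 h = 0" and SS: "S (Suc n) h = S n h + s n * (1/4)^n * A (r n) h" for n h
    by (simp_all add: S_def s_def)
  have s1: "\<bar>s n\<bar> = 1" for n by (simp add: s_def \<sigma>_def)
  have s_cases: "s n = 1 \<and> 0 \<le> S n (r n) \<or> s n = -1 \<and> S n (r n) < 0" for n
    by (auto simp: s_def \<sigma>_def)
  have S_sum: "S n h = (\<Sum>i<n. s i * (1/4)^i * A (r i) h)" for n h
    by (induction n) (simp_all add: S0 SS)
  obtain K where K: "\<And>h. \<bar>\<Sum>n. s n * (1/4)^n * A (r n) h\<bar> \<le> K"
    using bdd[of s r] s1 by blast
  have "real n \<le> 6 * K" for n
  proof -
    let ?h = "r n"
    let ?t = "\<lambda>i. s i * (1/4)^i * A (r i) ?h"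
    have tle: "\<bar>?t i\<bar> \<le> (1/4)^i * c ?h" for i
      using le[of "r i" ?h] s1[of i] by (simp add: abs_mult)
    have geo: "summable (\<lambda>i. (1/4::real)^i * c ?h)"
      by (intro summable_mult2 summable_geometric) auto
    have sm: "summable ?t"
      by (rule summable_comparison_test'[OF geo, of 0]) (use tle in auto)
    have tail: "\<bar>\<Sum>i. ?t (i + Suc n)\<bar> \<le> (1/4)^n * c ?h / 3"
    proof -
      have g2: "summable (\<lambda>i. (1/4::real)^(i + Suc n) * c ?h)"
        using summable_ignore_initial_segment[OF geo, of "Suc n"] .
      have "norm (\<Sum>i. ?t (i + Suc n)) \<le> (\<Sum>i. (1/4::real)^(i + Suc n) * c ?h)"
        by (rule norm_suminf_le[OF _ g2]) (simp only: real_norm_def tle)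
      also have "\<dots> = (\<Sum>i. (1/4::real)^i * ((1/4)^Suc n * c ?h))"
        by (simp add: power_add mult_ac)
      also have "\<dots> = (\<Sum>i. (1/4::real)^i) * ((1/4)^Suc n * c ?h)"
        by (rule suminf_mult2[symmetric]) (auto intro!: summable_geometric)
      also have "\<dots> = (1/4)^n * c ?h / 3"
        by (simp add: suminf_geometric)
      finally show ?thesis by simp
    qed
    have "S (Suc n) ?h = S n ?h + s n * ((1/4)^n * A ?h ?h)"
      by (simp add: SS)
    moreover have "0 \<le> (1/4)^n * A ?h ?h" "(1/4)^n * c ?h / 2 \<le> (1/4)^n * A ?h ?h"
      using mult_left_mono[OF ge[of ?h], of "(1/4)^n"] c0[of ?h] ge[of ?h] by auto
    ultimately have big: "(1/4)^n * c ?h / 2 \<le> \<bar>S (Suc n) ?h\<bar>"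
      using s_cases[of n] by (elim disjE conjE; simp only:; linarith)
    have "(\<Sum>i. ?t i) = (\<Sum>i. ?t (i + Suc n)) + S (Suc n) ?h"
      unfolding S_sum by (rule suminf_split_initial_segment[OF sm])
    \<comment> \<open>The margin is 1/2 - 1/3. With weights \<open>(1/3)^n\<close> the tail bound
      would also be 1/2 and, given only the factor 1/2 in \<open>ge\<close>, nothing would be
      left.\<close>
    then have "(1/4)^n * c ?h / 6 \<le> \<bar>\<Sum>i. ?t i\<bar>"
      using tail big by linarith
    also have "\<dots> \<le> K" by (rule K)
    finally have "(1/4)^n * c ?h \<le> 6 * K" by simp
    moreover have "real n \<le> (1/4)^n * c ?h"
      using r[of n] by (simp add: power_divide field_simps)
    ultimately show ?thesis by linarith
  qed
  then show False using reals_Archimedean2[of "6 * K"] by (meson not_le)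
qed


text \<open>Gliding hump: were the conclusion false, overriding signs on a sequence of rapidly shrinking
  sets would produce one bounded \<open>g\<close> along which the integrals stay away from \<open>0\<close>.\<close>

lemma (in finite_measure) Vitali_Hahn_Saks_uniform:
  fixes v :: "nat \<Rightarrow> 'a \<Rightarrow> real"
  assumes int: "\<And>n. integrable M (v n)"
    and lim: "\<And>g. g \<in> borel_measurable M \<Longrightarrow> (\<And>x. \<bar>g x\<bar> \<le> 1) \<Longrightarrow> (\<lambda>n. LINT x|M. v n x * g x) \<longlonglongrightarrow> 0"
    and "0 < e"
  shows "\<exists>d>0. \<forall>n. \<forall>E\<in>sets M. measure M E < d \<longrightarrow> (LINT x|M. indicator E x * \<bar>v n x\<bar>) < e"
proof (rule ccontr)
  assume "\<not> ?thesis"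
  then have no: "\<exists>n E. E \<in> sets M \<and> measure M E < d \<and> e \<le> (LINT x|M. indicator E x * \<bar>v n x\<bar>)" if "0 < d" for d
    using that by (meson not_le)
  have [measurable]: "v n \<in> borel_measurable M" for n using int[of n] by auto
  define J where "J E n = (LINT x|M. indicator E x * \<bar>v n x\<bar>)" for E n
  have int_vg: "integrable M (\<lambda>x. v n x * g x)"
    if "g \<in> borel_measurable M" "\<And>x. \<bar>g x\<bar> \<le> 1" for n g
    by (rule Bochner_Integration.integrable_bound[OF int[of n]])
      (use that in \<open>auto simp: abs_mult intro!: mult_left_le\<close>)
  \<comment> \<open>Each new set carries mass \<open>e\<close> for its own \<open>v n\<close> but
    geometrically little for the finitely many \<open>v i\<close> with \<open>i \<le> N\<close>. A
    single threshold \<open>D\<close> serves all of these, being a minimum of finitely many.\<close>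
  have step: "\<exists>n E. E \<in> sets M \<and> measure M E \<le> (1/2)^k \<and> (\<forall>i\<le>N. J E i \<le> e / 16 * (1/2)^k) \<and> e \<le> J E n" for N k :: nat
  proof -
    have "\<exists>d>0. \<forall>E\<in>sets M. measure M E < d \<longrightarrow> J E i < e / 16 * (1/2)^k" for i
    proof -
      have "0 < e / 16 * (1/2)^k" using \<open>0 < e\<close> by simp
      from integral_absolutely_continuous[OF int[of i] this] show ?thesis
        by (simp add: J_def)
    qed
    then obtain d where d: "\<And>i. 0 < d i"
        "\<And>i E. E \<in> sets M \<Longrightarrow> measure M E < d i \<Longrightarrow> J E i < e / 16 * (1/2)^k"
      by metis
    define D where "D = min ((1/2)^k) (Min (d ` {..N}))"
    have "0 < D" using d(1) by (auto simp: D_def)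
    from no[OF this] obtain n E where *: "E \<in> sets M" "measure M E < D" "e \<le> J E n"
      unfolding J_def by blast
    have "measure M E < d i" if "i \<le> N" for i
      using that *(2) by (auto simp: D_def)
    then show ?thesis using * d(2)[OF *(1)] by (intro exI[of _ n] exI[of _ E]) (force simp: D_def)
  qed
  obtain nE where nE: "\<And>k. snd (nE k) \<in> sets M \<and> measure M (snd (nE k)) \<le> (1/2)^k \<and> e \<le> J (snd (nE k)) (fst (nE k))"
     "\<And>k. \<forall>i\<le>fst (nE k). J (snd (nE (Suc k))) i \<le> e / 16 * (1/2)^(Suc k)"
  proof (atomize_elim, rule exE[OF dependent_nat_choice[where
        P = "\<lambda>k p. snd p \<in> sets M \<and> measure M (snd p) \<le> (1/2)^k \<and> e \<le> J (snd p) (fst p)" and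
        Q = "\<lambda>k p q. \<forall>i\<le>fst p. J (snd q) i \<le> e / 16 * (1/2)^(Suc k)"]], goal_cases)
    case 1
    then show ?case using step[of 0 0] by auto
  next
    case (2 x n)
    then show ?case using step[of "Suc n" "fst x"] by auto
  qed blast
  define n where "n k = fst (nE k)" for k
  define E where "E k = snd (nE k)" for k
  have E[measurable]: "E k \<in> sets M" and Em: "measure M (E k) \<le> (1/2)^k" and EJ: "e \<le> J (E k) (n k)" for k
    using nE(1)[of k] by (auto simp: n_def E_def)
  have ES: "J (E (Suc k)) i \<le> e / 16 * (1/2)^(Suc k)" if "i \<le> n k" for i k
    using nE(2)[of k] that by (auto simp: n_def E_def)
  \<comment> \<open>An index not exceeding \<open>n k\<close> would make \<open>E (Suc k)\<close>
    light for \<open>v (n (Suc k))\<close>, against \<open>EJ\<close>.\<close>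
  have "n k < n (Suc k)" for k
  proof (rule ccontr)
    assume "\<not> ?thesis"
    then have "e \<le> e / 16 * (1/2)^(Suc k)"
      using ES[of "n (Suc k)" k] EJ[of "Suc k"] by linarith
    also have "\<dots> \<le> e / 16 * 1"
      using \<open>0 < e\<close> by (intro mult_left_mono power_le_one) auto
    finally show False using \<open>0 < e\<close> by simp
  qed
  then have mono: "strict_mono n" by (simp add: strict_mono_Suc_iff)
  have EJ': "J (E j) (n k) \<le> e / 16 * (1/2)^j" if "k < j" for j k
  proof -
    obtain j' where "j = Suc j'" using less_imp_Suc_add[OF \<open>k < j\<close>] by blast
    then show ?thesis using that ES[of "n k" j'] mono by (simp add: strict_mono_less_eq del: power_Suc)
  qed
  \<comment> \<open>The sign makes the integral over \<open>E k\<close> reinforce the integral over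
    its complement, so the two cannot cancel.\<close>
  define \<tau> where "\<tau> k g = (if 0 \<le> (LINT x|M. v (n k) x * (if x \<in> E k then 0 else g x)) then 1 else -1 :: real)"
    for k and g :: "'a \<Rightarrow> real"
  \<comment> \<open>On overlaps the later set wins, which keeps the values between -1 and 1 where a
    sum would not.\<close>
  define G where "G = rec_nat (\<lambda>x. 0 :: real) (\<lambda>k g x. if x \<in> E k then \<tau> k g * sgn (v (n k) x) else g x)"
  have G0: "G 0 = (\<lambda>x. 0)"
    and GS: "G (Suc k) = (\<lambda>x. if x \<in> E k then \<tau> k (G k) * sgn (v (n k) x) else G k x)" for k
    unfolding G_def by simp_all
  have Gm[measurable]: "G k \<in> borel_measurable M" for k
    by (induction k) (simp_all add: G0 GS)
  have G1: "\<bar>G k x\<bar> \<le> 1" for k x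
    by (induction k) (auto simp: G0 GS \<tau>_def abs_mult sgn_real_def)
  define I where "I k j = (LINT x|M. v (n k) x * G j x)" for k j
  have I_start: "e \<le> \<bar>I k (Suc k)\<bar>" for k
  proof -
    let ?R = "\<lambda>x. v (n k) x * (if x \<in> E k then 0 else G k x)"
    have iR: "integrable M ?R" using G1 by (intro int_vg) auto
    have iE: "integrable M (\<lambda>x. \<tau> k (G k) * (indicator (E k) x * \<bar>v (n k) x\<bar>))"
      by (intro integrable_mult_right Bochner_Integration.integrable_bound[OF int[of "n k"]])
        (auto simp: indicator_def)
    have "I k (Suc k) = (LINT x|M. ?R x + \<tau> k (G k) * (indicator (E k) x * \<bar>v (n k) x\<bar>))"
      unfolding I_def GS
      by (intro Bochner_Integration.integral_cong) (auto simp: indicator_def abs_sgn mult_ac)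
    also have "\<dots> = (LINT x|M. ?R x) + \<tau> k (G k) * J (E k) (n k)"
      using iR iE by (simp add: J_def)
    finally show ?thesis using EJ[of k] \<open>0 < e\<close>
      by (cases "0 \<le> (LINT x|M. ?R x)") (simp_all add: \<tau>_def)
  qed
  \<comment> \<open>Overwriting on \<open>E j\<close> changes the function by at most 2 there, hence
    the integral by at most \<open>2 * J (E j) (n k)\<close>; this turns the 16 of
    \<open>EJ'\<close> into 8.\<close>
  have I_step: "\<bar>I k (Suc j) - I k j\<bar> \<le> e / 8 * (1/2)^j" if "k < j" for k j
  proof -
    have "I k (Suc j) - I k j = (LINT x|M. v (n k) x * G (Suc j) x - v (n k) x * G j x)"
      unfolding I_def using G1 by (intro Bochner_Integration.integral_diff[symmetric] int_vg) auto
    also have "\<bar>\<dots>\<bar> \<le> (LINT x|M. \<bar>v (n k) x * G (Suc j) x - v (n k) x * G j x\<bar>)"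
      by (rule integral_abs_bound)
    also have "\<dots> \<le> (LINT x|M. 2 * (indicator (E j) x * \<bar>v (n k) x\<bar>))"
    proof (rule integral_mono)
      show "integrable M (\<lambda>x. \<bar>v (n k) x * G (Suc j) x - v (n k) x * G j x\<bar>)"
        using G1 by (intro integrable_abs Bochner_Integration.integrable_diff int_vg) auto
      show "integrable M (\<lambda>x. 2 * (indicator (E j) x * \<bar>v (n k) x\<bar>))"
        by (intro integrable_mult_right Bochner_Integration.integrable_bound[OF int[of "n k"]])
          (auto simp: indicator_def)
      fix x
      have "\<bar>v (n k) x * (G (Suc j) x - G j x)\<bar> \<le> \<bar>v (n k) x\<bar> * 2"
        unfolding abs_mult using G1[of j x] G1[of "Suc j" x] by (intro mult_left_mono) linarith+
      moreover have "G (Suc j) x = G j x" if "x \<notin> E j" using that by (simp add: GS)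
      ultimately show "\<bar>v (n k) x * G (Suc j) x - v (n k) x * G j x\<bar> \<le> 2 * (indicator (E j) x * \<bar>v (n k) x\<bar>)"
        by (cases "x \<in> E j") (simp_all add: algebra_simps)
    qed
    also have "\<dots> = 2 * J (E j) (n k)" by (simp add: J_def)
    also have "\<dots> \<le> e / 8 * (1/2)^j" using EJ'[OF that] by simp
    finally show ?thesis .
  qed
  \<comment> \<open>The term \<open>e / 4 * (1/2)^j\<close> is the budget for all changes still to
    come: at step \<open>j\<close> it drops by exactly \<open>e / 8 * (1/2)^j\<close>, the bound of
    \<open>I_step\<close>.\<close>
  have I_low: "e / 2 + e / 4 * (1/2)^j \<le> \<bar>I k j\<bar>" if "Suc k \<le> j" for k j
    using that
  proof (induction j rule: dec_induct)
    case base
    have "(1/2::real) ^ Suc k \<le> 1" by (intro power_le_one) auto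
    then have "e / 4 * (1/2) ^ Suc k \<le> e / 4 * 1" using \<open>0 < e\<close> by (intro mult_left_mono) auto
    then show ?case using I_start[of k] \<open>0 < e\<close> by linarith
  next
    case (step j)
    define x where "x = e * (1/2)^j"
    have "\<bar>I k (Suc j) - I k j\<bar> \<le> x / 8" using I_step[of k j] step by (simp add: x_def)
    moreover have "e / 2 + x / 4 \<le> \<bar>I k j\<bar>" using step by (simp add: x_def)
    ultimately have "e / 2 + x / 8 \<le> \<bar>I k (Suc j)\<bar>" by linarith
    then show ?case by (simp add: x_def)
  qed
  have conv: "AE x in M. convergent (\<lambda>k. G k x)"
  proof -
    \<comment> \<open>By Borel-Cantelli almost every point lies in only finitely many
      \<open>E k\<close>, and there \<open>G k x\<close> is eventually constant.\<close>
    have "AE x in M. eventually (\<lambda>k. x \<in> space M - E k) sequentially"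
    proof (rule borel_cantelli_AE1)
      show "summable (\<lambda>k. measure M (E k))"
        by (rule summable_comparison_test'[where g = "\<lambda>k. (1/2)^k" and N = 0]) (use Em in auto)
    qed (auto simp: emeasure_eq_measure)
    then show ?thesis
    proof eventually_elim
      case (elim x)
      then obtain K where K: "\<And>k. K \<le> k \<Longrightarrow> x \<notin> E k" by (auto simp: eventually_sequentially)
      have "G k x = G K x" if "K \<le> k" for k
        using that by (induction k rule: dec_induct) (auto simp: GS K)
      then have "(\<lambda>k. G k x) \<longlonglongrightarrow> G K x"
        by (intro tendsto_eventually eventually_sequentiallyI[of K])
      then show ?case by (rule convergentI)
    qed
  qed
  \<comment> \<open>The limit has an unspecified value where \<open>G k x\<close> diverges; clamping
    secures the bound at every point, as required of a test function.\<close>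
  define g where "g x = max (-1) (min 1 (lim (\<lambda>k. G k x)))" for x
  have gm[measurable]: "g \<in> borel_measurable M" unfolding g_def by measurable
  have g1: "\<bar>g x\<bar> \<le> 1" for x unfolding g_def by auto
  have lim_g: "AE x in M. (\<lambda>k. G k x) \<longlonglongrightarrow> g x"
    using conv
  proof eventually_elim
    case (elim x)
    then have *: "(\<lambda>k. G k x) \<longlonglongrightarrow> lim (\<lambda>k. G k x)" by (simp add: convergent_LIMSEQ_iff)
    have "lim (\<lambda>k. G k x) \<le> 1" "-1 \<le> lim (\<lambda>k. G k x)"
      using G1[of _ x] by (auto intro!: LIMSEQ_le_const2[OF *] LIMSEQ_le_const[OF *] simp: abs_le_iff minus_le_iff)
    then show ?case using * by (simp add: g_def)
  qed
  have "e / 2 \<le> \<bar>LINT x|M. v (n k) x * g x\<bar>" for k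
  proof -
    have "(\<lambda>j. LINT x|M. v (n k) x * G j x) \<longlonglongrightarrow> (LINT x|M. v (n k) x * g x)"
    proof (rule integral_dominated_convergence[where w = "\<lambda>x. \<bar>v (n k) x\<bar>"])
      show "AE x in M. (\<lambda>j. v (n k) x * G j x) \<longlonglongrightarrow> v (n k) x * g x"
        using lim_g by eventually_elim (rule tendsto_mult_left)
    qed (use G1 int in \<open>auto simp: abs_mult intro!: mult_left_le\<close>)
    then have "(\<lambda>j. \<bar>I k j\<bar>) \<longlonglongrightarrow> \<bar>LINT x|M. v (n k) x * g x\<bar>"
      unfolding I_def by (rule tendsto_rabs)
    moreover have "e / 2 \<le> \<bar>I k j\<bar>" if "Suc k \<le> j" for j
    proof -
      have "0 \<le> e / 4 * (1/2)^j" using \<open>0 < e\<close> by simp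
      then show ?thesis using I_low[OF that] by linarith
    qed
    ultimately show ?thesis by (intro LIMSEQ_le_const) auto
  qed
  moreover have "(\<lambda>k. LINT x|M. v (n k) x * g x) \<longlonglongrightarrow> 0"
    using LIMSEQ_subseq_LIMSEQ[OF lim[OF gm g1] mono] by (simp add: o_def)
  then have "eventually (\<lambda>k. \<bar>LINT x|M. v (n k) x * g x\<bar> < e / 2) sequentially"
    using \<open>0 < e\<close> by (auto dest!: tendstoD[where e = "e / 2"])
  ultimately show False by (auto simp: eventually_sequentially not_less[symmetric])
qed

section \<open>Weakly convergent sequences are bounded\<close>

lemma powr_abs_le_one_add:
  fixes x r :: real
  assumes "1 \<le> r"
  shows "\<bar>x\<bar> \<le> 1 + \<bar>x\<bar> powr r"
proof (cases "\<bar>x\<bar> \<le> 1")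
  case False
  then have "\<bar>x\<bar> powr 1 \<le> \<bar>x\<bar> powr r" using assms by (intro powr_mono) auto
  then show ?thesis using False by simp
qed (simp add: add_increasing2)

lemma powr_abs_add_le:
  fixes x y r :: real
  assumes "0 \<le> r"
  shows "\<bar>x + y\<bar> powr r \<le> 2 powr r * (\<bar>x\<bar> powr r + \<bar>y\<bar> powr r)"
proof -
  have "\<bar>x + y\<bar> powr r \<le> (2 * max \<bar>x\<bar> \<bar>y\<bar>) powr r"
    using assms by (intro powr_mono2) auto
  also have "\<dots> = 2 powr r * (max \<bar>x\<bar> \<bar>y\<bar>) powr r"
    by (simp add: powr_mult)
  also have "\<dots> \<le> 2 powr r * (\<bar>x\<bar> powr r + \<bar>y\<bar> powr r)"
    by (intro mult_left_mono) (auto simp: max_def)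
  finally show ?thesis .
qed

text \<open>Young's inequality for the exponents \<open>r\<close> and \<open>r / (r - 1)\<close>,
  applied to \<open>x\<close> and \<open>z powr (r - 1)\<close>. In this form the conjugate
  exponent, infinite for \<open>r = 1\<close>, does not appear and that case is included.\<close>

lemma Young_conjugate_powr:
  fixes x z r :: real
  assumes "1 \<le> r" "0 \<le> x" "0 \<le> z"
  shows "x * z powr (r - 1) \<le> x powr r / r + z powr r * (r - 1) / r"
proof (cases "x = 0 \<or> z = 0")
  case True
  then show ?thesis using assms by auto
next
  case False
  then have "x > 0" "z > 0" using assms by auto
  have "(x powr r) powr (1 / r) * (z powr r) powr ((r - 1) / r) \<le> 1 / r * x powr r + (r - 1) / r * z powr r"
    using assms \<open>x > 0\<close> \<open>z > 0\<close> by (intro Youngs_inequality_0) (auto simp: field_simps)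
  then show ?thesis using assms \<open>x > 0\<close> \<open>z > 0\<close> by (simp add: powr_powr mult_ac)
qed

section \<open>Seminorm estimates and functionals for a finite exponent on a finite measure
  space\<close>

locale finite_exponent_Lp = finite_measure M for M :: "'a measure" +
  fixes p :: ennreal
  assumes p_ge_1: "1 \<le> p" and p_finite: "p \<noteq> \<infinity>"
begin

abbreviation r :: real where "r \<equiv> enn2real p"

lemma r_ge_1: "1 \<le> r"
proof -
  have "p = ennreal r" using p_finite by (simp add: less_top)
  then show ?thesis using p_ge_1 by (metis ennreal_1 ennreal_le_iff enn2real_nonneg)
qed

lemma mem_Lp: "f \<in> Lp_space p M \<longleftrightarrow> f \<in> borel_measurable M \<and> integrable M (\<lambda>x. \<bar>f x\<bar> powr r)"
  using p_finite by (simp add: Lp_space_def)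

lemma Lp_norm_eq: "Lp_norm p M f = (LINT x|M. \<bar>f x\<bar> powr r) powr (1 / r)"
  using p_finite by (simp add: Lp_norm_def)

lemma Lp_measurable: "f \<in> Lp_space p M \<Longrightarrow> f \<in> borel_measurable M"
  by (simp add: mem_Lp)

lemma Lp_mono:
  assumes "f \<in> Lp_space p M" "g \<in> borel_measurable M" "\<And>x. x \<in> space M \<Longrightarrow> \<bar>g x\<bar> \<le> \<bar>f x\<bar>"
  shows "g \<in> Lp_space p M"
proof -
  have [measurable]: "g \<in> borel_measurable M" by fact
  have "integrable M (\<lambda>x. \<bar>g x\<bar> powr r)"
    by (rule Bochner_Integration.integrable_bound[where f = "\<lambda>x. \<bar>f x\<bar> powr r"])
      (use assms r_ge_1 in \<open>auto simp: mem_Lp intro!: powr_mono2\<close>)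
  then show ?thesis using assms by (simp add: mem_Lp)
qed

lemma Lp_bounded:
  assumes "g \<in> borel_measurable M" "\<And>x. x \<in> space M \<Longrightarrow> \<bar>g x\<bar> \<le> K"
  shows "g \<in> Lp_space p M"
proof (rule Lp_mono[of "\<lambda>x. \<bar>K\<bar>"])
  show "\<bar>g x\<bar> \<le> \<bar>\<bar>K\<bar>\<bar>" if "x \<in> space M" for x using assms(2)[OF that] by simp
qed (use assms in \<open>auto simp: mem_Lp\<close>)

lemma Lp_add:
  assumes "f \<in> Lp_space p M" "g \<in> Lp_space p M"
  shows "(\<lambda>x. f x + g x) \<in> Lp_space p M"
proof -
  have [measurable]: "f \<in> borel_measurable M" "g \<in> borel_measurable M"
    using assms by (simp_all add: mem_Lp)
  have "integrable M (\<lambda>x. \<bar>f x + g x\<bar> powr r)"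
    by (rule Bochner_Integration.integrable_bound[where f = "\<lambda>x. 2 powr r * (\<bar>f x\<bar> powr r + \<bar>g x\<bar> powr r)"])
      (use assms r_ge_1 in \<open>auto simp: mem_Lp intro!: powr_abs_add_le\<close>)
  then show ?thesis by (simp add: mem_Lp)
qed

lemma Lp_cmult:
  assumes "f \<in> Lp_space p M"
  shows "(\<lambda>x. c * f x) \<in> Lp_space p M"
  using assms by (auto simp: mem_Lp abs_mult powr_mult)

lemma Lp_diff:
  assumes "f \<in> Lp_space p M" "g \<in> Lp_space p M"
  shows "(\<lambda>x. f x - g x) \<in> Lp_space p M"
  using Lp_add[OF assms(1) Lp_cmult[OF assms(2), of "-1"]] by simp

lemma Lp_indicator_mult:
  assumes "f \<in> Lp_space p M" "A \<in> sets M"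
  shows "(\<lambda>x. indicator A x * f x) \<in> Lp_space p M"
  using assms by (intro Lp_mono[OF assms(1)] borel_measurable_times) (auto simp: mem_Lp indicator_def)

lemma Lp_integrable:
  assumes "f \<in> Lp_space p M"
  shows "integrable M f"
  by (rule Bochner_Integration.integrable_bound[where f = "\<lambda>x. 1 + \<bar>f x\<bar> powr r"])
    (use assms r_ge_1 powr_abs_le_one_add[of r] in \<open>auto simp: mem_Lp\<close>)

lemma Lp_norm_nonneg: "0 \<le> Lp_norm p M f"
  by (simp add: Lp_norm_eq)

lemma Lp_norm_powr: "Lp_norm p M f powr r = (LINT x|M. \<bar>f x\<bar> powr r)"
  using r_ge_1 by (simp add: Lp_norm_eq powr_powr)

lemma Lp_norm_0_AE:
  assumes "f \<in> Lp_space p M" "Lp_norm p M f = 0"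
  shows "AE x in M. f x = 0"
proof -
  have "(LINT x|M. \<bar>f x\<bar> powr r) = 0" using assms(2) r_ge_1 by (simp add: Lp_norm_eq)
  then have "AE x in M. \<bar>f x\<bar> powr r = 0"
    using assms(1) by (subst (asm) integral_nonneg_eq_0_iff_AE) (auto simp: mem_Lp)
  then show ?thesis by simp
qed

text \<open>By homogeneity, a Hoelder-type bound need only be verified after scaling \<open>f\<close> to norm \<open>1\<close>;
  the number \<open>s\<close> is the norm of \<open>f\<close>.\<close>

lemma Lp_pairing_bound:
  assumes f: "f \<in> Lp_space p M" and \<phi>[measurable]: "\<phi> \<in> borel_measurable M"
    and C: "0 \<le> C"
    and bound: "\<And>s. 0 < s \<Longrightarrow> s powr r = (LINT x|M. \<bar>f x\<bar> powr r) \<Longrightarrow>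
       integrable M (\<lambda>x. b s x) \<and> (LINT x|M. b s x) \<le> C \<and> (\<forall>x\<in>space M. \<bar>f x\<bar> / s * \<bar>\<phi> x\<bar> \<le> b s x)"
  shows "integrable M (\<lambda>x. f x * \<phi> x)" and "\<bar>LINT x|M. f x * \<phi> x\<bar> \<le> C * Lp_norm p M f"
proof -
  have [measurable]: "f \<in> borel_measurable M" using f by (simp add: mem_Lp)
  define s where "s = Lp_norm p M f"
  have "integrable M (\<lambda>x. f x * \<phi> x) \<and> \<bar>LINT x|M. f x * \<phi> x\<bar> \<le> C * s"
  proof (cases "s = 0")
    case True
    then have ae: "AE x in M. f x * \<phi> x = 0" using Lp_norm_0_AE[OF f] by (auto simp: s_def)
    have "integrable M (\<lambda>x. f x * \<phi> x) \<longleftrightarrow> integrable M (\<lambda>x. 0 :: real)"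
      using ae by (intro integrable_cong_AE) auto
    moreover have "(LINT x|M. f x * \<phi> x) = (LINT x|M. 0)"
      using ae by (intro integral_cong_AE) auto
    ultimately show ?thesis using True by simp
  next
    case False
    then have "0 < s" using Lp_norm_nonneg[of f] by (simp add: s_def)
    from bound[OF this] have b: "integrable M (\<lambda>x. b s x)" "(LINT x|M. b s x) \<le> C"
      and le: "\<And>x. x \<in> space M \<Longrightarrow> \<bar>f x\<bar> / s * \<bar>\<phi> x\<bar> \<le> b s x"
      by (auto simp: s_def Lp_norm_powr)
    have le': "\<bar>f x * \<phi> x\<bar> \<le> s * b s x" if "x \<in> space M" for x
      using le[OF that] \<open>0 < s\<close> by (simp add: abs_mult field_simps)
    have int: "integrable M (\<lambda>x. f x * \<phi> x)"
      by (rule Bochner_Integration.integrable_bound[OF integrable_mult_right[OF b(1), of s]])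
        (auto intro!: AE_I2 order_trans[OF le'])
    have "\<bar>LINT x|M. f x * \<phi> x\<bar> \<le> (LINT x|M. \<bar>f x * \<phi> x\<bar>)" by (rule integral_abs_bound)
    also have "\<dots> \<le> (LINT x|M. s * b s x)"
      using int b le' by (intro integral_mono) auto
    also have "\<dots> \<le> C * s" using b \<open>0 < s\<close> by (simp add: mult.commute)
    finally show ?thesis using int by simp
  qed
  then show "integrable M (\<lambda>x. f x * \<phi> x)" and "\<bar>LINT x|M. f x * \<phi> x\<bar> \<le> C * Lp_norm p M f"
    by (simp_all add: s_def)
qed

text \<open>This is how convergence against bounded functions is read off from weak convergence. On
  a finite measure space the crude bound \<open>t \<le> 1 + t powr r\<close> can stand in for
  Hoelder: for \<open>f\<close> of norm 1 its right side integrates to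
  \<open>measure M (space M) + 1\<close>.\<close>

lemma Lp_functional_bounded_density:
  assumes g[measurable]: "g \<in> borel_measurable M" and K: "\<And>x. \<bar>g x\<bar> \<le> K"
  shows "Lp_functional p M (\<lambda>f. LINT x|M. f x * g x)"
proof -
  have K0: "0 \<le> K" using K[of undefined] by linarith
  have *: "integrable M (\<lambda>x. f x * g x) \<and> \<bar>LINT x|M. f x * g x\<bar> \<le> K * (measure M (space M) + 1) * Lp_norm p M f"
    if f: "f \<in> Lp_space p M" for f
  proof -
    have "integrable M (\<lambda>x. K * (1 + (\<bar>f x\<bar> / s) powr r)) \<and>
       (LINT x|M. K * (1 + (\<bar>f x\<bar> / s) powr r)) \<le> K * (measure M (space M) + 1) \<and>
       (\<forall>x\<in>space M. \<bar>f x\<bar> / s * \<bar>g x\<bar> \<le> K * (1 + (\<bar>f x\<bar> / s) powr r))"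
      if s: "0 < s" "s powr r = (LINT x|M. \<bar>f x\<bar> powr r)" for s
    proof (intro conjI ballI)
      have i: "integrable M (\<lambda>x. \<bar>f x\<bar> powr r / s powr r)" using f by (simp add: mem_Lp)
      have e: "(\<bar>f x\<bar> / s) powr r = \<bar>f x\<bar> powr r / s powr r" for x
        using s by (simp add: powr_divide)
      show "integrable M (\<lambda>x. K * (1 + (\<bar>f x\<bar> / s) powr r))" unfolding e using i by simp
      show "(LINT x|M. K * (1 + (\<bar>f x\<bar> / s) powr r)) \<le> K * (measure M (space M) + 1)"
      proof -
        have "0 < s powr r" using s(1) by (metis powr_gt_zero less_irrefl)
        then have "0 < (LINT x|M. \<bar>f x\<bar> powr r)" using s by simp
        then show ?thesis unfolding e using i s by simp
      qed
      fix x
      have "\<bar>f x\<bar> / s * \<bar>g x\<bar> \<le> (1 + (\<bar>f x\<bar> / s) powr r) * K"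
        using powr_abs_le_one_add[OF r_ge_1, of "f x / s"] s K by (intro mult_mono) auto
      then show "\<bar>f x\<bar> / s * \<bar>g x\<bar> \<le> K * (1 + (\<bar>f x\<bar> / s) powr r)" by (simp add: mult.commute)
    qed
    note b = this
    have "0 \<le> K * (measure M (space M) + 1)" using K0 by simp
    from Lp_pairing_bound[OF f g this b] show ?thesis by simp
  qed
  show ?thesis unfolding Lp_functional_def
  proof (intro conjI ballI allI exI)
    fix f assume f: "f \<in> Lp_space p M"
    then show "\<bar>LINT x|M. f x * g x\<bar> \<le> K * (measure M (space M) + 1) * Lp_norm p M f" using * by blast
    show "(LINT x|M. c * f x * g x) = c * (LINT x|M. f x * g x)" for c
      by (simp add: mult.assoc)
    fix f' assume f': "f' \<in> Lp_space p M"
    show "(LINT x|M. (f x + f' x) * g x) = (LINT x|M. f x * g x) + (LINT x|M. f' x * g x)"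
      using *[OF f] *[OF f'] by (simp add: distrib_right)
  qed
qed

text \<open>Equality in Hoelder's inequality is attained by a multiple of
  \<open>sgn (v x) * \<bar>v x\<bar> powr (r - 1)\<close>, which reduces to \<open>sgn (v x)\<close>
  for \<open>r = 1\<close>. The resulting functional has norm at most 1 and attains the norm of
  \<open>v\<close>, as one from Hahn-Banach would.\<close>

lemma norming_density:
  assumes v: "v \<in> Lp_space p M"
  obtains \<phi> where "\<phi> \<in> borel_measurable M"
    "\<And>f. f \<in> Lp_space p M \<Longrightarrow> integrable M (\<lambda>x. f x * \<phi> x)"
    "\<And>f. f \<in> Lp_space p M \<Longrightarrow> \<bar>LINT x|M. f x * \<phi> x\<bar> \<le> Lp_norm p M f"
    "(LINT x|M. v x * \<phi> x) = Lp_norm p M v"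
proof (cases "Lp_norm p M v = 0")
  case True
  show ?thesis by (rule that[of "\<lambda>x. 0"]) (use True in \<open>auto simp: Lp_norm_nonneg\<close>)
next
  case False
  define c where "c = Lp_norm p M v"
  have c: "0 < c" using False Lp_norm_nonneg[of v] by (simp add: c_def)
  have [measurable]: "v \<in> borel_measurable M" using v by (simp add: mem_Lp)
  define \<phi> where "\<phi> x = sgn (v x) * (\<bar>v x\<bar> / c) powr (r - 1)" for x
  have [measurable]: "\<phi> \<in> borel_measurable M" unfolding \<phi>_def by measurable
  have cr: "c powr r = (LINT x|M. \<bar>v x\<bar> powr r)" by (simp add: c_def Lp_norm_powr)
  have *: "integrable M (\<lambda>x. f x * \<phi> x) \<and> \<bar>LINT x|M. f x * \<phi> x\<bar> \<le> 1 * Lp_norm p M f"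
    if f: "f \<in> Lp_space p M" for f
  proof -
    \<comment> \<open>Young's bound for the normalised \<open>f\<close> and \<open>v\<close>; its
      two terms integrate to \<open>1 / r\<close> and \<open>(r - 1) / r\<close>.\<close>
    let ?b = "\<lambda>s x. (\<bar>f x\<bar> / s) powr r / r + (\<bar>v x\<bar> / c) powr r * (r - 1) / r"
    have "integrable M (?b s) \<and> (LINT x|M. ?b s x) \<le> 1 \<and> (\<forall>x\<in>space M. \<bar>f x\<bar> / s * \<bar>\<phi> x\<bar> \<le> ?b s x)"
      if s: "0 < s" "s powr r = (LINT x|M. \<bar>f x\<bar> powr r)" for s
    proof (intro conjI ballI)
      have pos: "0 < s powr r" "0 < c powr r" using s(1) c by (metis powr_gt_zero less_irrefl)+
      have i: "integrable M (\<lambda>x. \<bar>f x\<bar> powr r)" "integrable M (\<lambda>x. \<bar>v x\<bar> powr r)"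
        using f v by (simp_all add: mem_Lp)
      have e: "?b s x = (1 / (s powr r * r)) * \<bar>f x\<bar> powr r + ((r - 1) / (c powr r * r)) * \<bar>v x\<bar> powr r" for x
        using s c by (simp add: powr_divide)
      show "integrable M (?b s)" unfolding e using i by simp
      have "(LINT x|M. ?b s x) = (1 / (s powr r * r)) * (s powr r) + ((r - 1) / (c powr r * r)) * (c powr r)"
        unfolding e using i by (simp add: s cr)
      also have "\<dots> = 1" using pos r_ge_1 by (simp add: field_simps)
      finally show "(LINT x|M. ?b s x) \<le> 1" by simp
      fix x
      have "\<bar>\<phi> x\<bar> \<le> (\<bar>v x\<bar> / c) powr (r - 1)"
        by (auto simp: \<phi>_def abs_mult sgn_real_def)
      then have "\<bar>f x\<bar> / s * \<bar>\<phi> x\<bar> \<le> \<bar>f x\<bar> / s * (\<bar>v x\<bar> / c) powr (r - 1)"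
        using s by (intro mult_left_mono) auto
      also have "\<dots> \<le> ?b s x"
        using s c r_ge_1 by (intro Young_conjugate_powr) auto
      finally show "\<bar>f x\<bar> / s * \<bar>\<phi> x\<bar> \<le> ?b s x" .
    qed
    then show ?thesis using Lp_pairing_bound[OF f, of \<phi> 1 ?b] by simp
  qed
  have "v x * \<phi> x = \<bar>v x\<bar> powr r / c powr (r - 1)" for x
  proof (cases "v x = 0")
    case False
    then have "\<bar>v x\<bar> * \<bar>v x\<bar> powr (r - 1) = \<bar>v x\<bar> powr r"
      by (simp add: powr_mult_base)
    then show ?thesis using c by (simp add: \<phi>_def powr_divide abs_sgn mult_ac)
  qed (use r_ge_1 in simp)
  then have "(LINT x|M. v x * \<phi> x) = c powr r / c powr (r - 1)" by (simp add: cr)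
  also have "\<dots> = c" using c by (simp add: powr_diff)
  finally have "(LINT x|M. v x * \<phi> x) = Lp_norm p M v" by (simp add: c_def)
  then show ?thesis using * by (intro that[of \<phi>]) auto
qed

lemma Lp_functional_add:
  "Lp_functional p M F \<Longrightarrow> f \<in> Lp_space p M \<Longrightarrow> g \<in> Lp_space p M \<Longrightarrow> F (\<lambda>x. f x + g x) = F f + F g"
  by (simp add: Lp_functional_def)

lemma Lp_functional_cmult:
  "Lp_functional p M F \<Longrightarrow> f \<in> Lp_space p M \<Longrightarrow> F (\<lambda>x. c * f x) = c * F f"
  by (simp add: Lp_functional_def)

lemma Lp_functional_diff:
  assumes "Lp_functional p M F" "f \<in> Lp_space p M" "g \<in> Lp_space p M"
  shows "F (\<lambda>x. f x - g x) = F f - F g"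
  using Lp_functional_add[OF assms(1,2) Lp_cmult[OF assms(3), of "-1"]]
    Lp_functional_cmult[OF assms(1,3), of "-1"] by simp

lemma Lp_functional_bound:
  assumes "Lp_functional p M F"
  obtains C where "0 < C" "\<And>f. f \<in> Lp_space p M \<Longrightarrow> \<bar>F f\<bar> \<le> C * Lp_norm p M f"
proof -
  obtain C where C: "\<And>f. f \<in> Lp_space p M \<Longrightarrow> \<bar>F f\<bar> \<le> C * Lp_norm p M f"
    using assms unfolding Lp_functional_def by blast
  show ?thesis
  proof (rule that[of "\<bar>C\<bar> + 1"])
    fix f assume "f \<in> Lp_space p M"
    then have "\<bar>F f\<bar> \<le> C * Lp_norm p M f" by (rule C)
    also have "\<dots> \<le> (\<bar>C\<bar> + 1) * Lp_norm p M f"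
      using Lp_norm_nonneg[of f] by (intro mult_right_mono) auto
    finally show "\<bar>F f\<bar> \<le> (\<bar>C\<bar> + 1) * Lp_norm p M f" .
  qed auto
qed

text \<open>For a finite exponent a dominated sequence converges in norm, since
  \<open>\<bar>fn n x - f x\<bar> powr r\<close> lies below
  \<open>\<bar>2 * w x\<bar> powr r\<close>. Through this a bounded functional acquires the
  continuity of an integral along pointwise limits.\<close>

lemma Lp_functional_dominated_convergence:
  assumes F: "Lp_functional p M F" and w: "w \<in> Lp_space p M"
    and f: "f \<in> borel_measurable M" and fn: "\<And>n. fn n \<in> borel_measurable M"
    and lim: "\<And>x. x \<in> space M \<Longrightarrow> (\<lambda>n. fn n x) \<longlonglongrightarrow> f x"
    and dom: "\<And>n x. x \<in> space M \<Longrightarrow> \<bar>fn n x\<bar> \<le> \<bar>w x\<bar>"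
  shows "(\<lambda>n. F (fn n)) \<longlonglongrightarrow> F f"
proof -
  have dom': "\<bar>f x\<bar> \<le> \<bar>w x\<bar>" if "x \<in> space M" for x
    using tendsto_rabs[OF lim[OF that]] dom[OF that] by (intro LIMSEQ_le_const2) auto
  have fL: "f \<in> Lp_space p M" and fnL: "\<And>n. fn n \<in> Lp_space p M"
    using f fn dom dom' by (auto intro!: Lp_mono[OF w])
  note [measurable] = f fn
  have iw: "integrable M (\<lambda>x. \<bar>2 * w x\<bar> powr r)" using Lp_cmult[OF w, of 2] by (simp add: mem_Lp)
  obtain C where C: "0 < C" "\<And>f. f \<in> Lp_space p M \<Longrightarrow> \<bar>F f\<bar> \<le> C * Lp_norm p M f"
    using Lp_functional_bound[OF F] by blast
  have "(\<lambda>n. LINT x|M. \<bar>fn n x - f x\<bar> powr r) \<longlonglongrightarrow> (LINT x|M. 0)"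
  proof (rule integral_dominated_convergence[OF _ _ iw])
    show "AE x in M. (\<lambda>n. \<bar>fn n x - f x\<bar> powr r) \<longlonglongrightarrow> 0"
    proof (rule AE_I2)
      fix x assume "x \<in> space M"
      then have "(\<lambda>n. fn n x - f x) \<longlonglongrightarrow> 0" using lim[of x] by (simp add: LIM_zero)
      then have "(\<lambda>n. \<bar>fn n x - f x\<bar>) \<longlonglongrightarrow> 0" by (rule tendsto_rabs_zero)
      then show "(\<lambda>n. \<bar>fn n x - f x\<bar> powr r) \<longlonglongrightarrow> 0"
        using r_ge_1 by (intro tendsto_zero_powrI[where b = r]) auto
    qed
    fix n
    show "AE x in M. norm (\<bar>fn n x - f x\<bar> powr r) \<le> \<bar>2 * w x\<bar> powr r"
    proof (rule AE_I2)
      fix x assume x: "x \<in> space M"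
      have "\<bar>fn n x - f x\<bar> \<le> \<bar>2 * w x\<bar>" using dom[OF x, of n] dom'[OF x] by linarith
      then show "norm (\<bar>fn n x - f x\<bar> powr r) \<le> \<bar>2 * w x\<bar> powr r"
        using r_ge_1 by (auto intro!: powr_mono2)
    qed
  qed auto
  then have "(\<lambda>n. Lp_norm p M (\<lambda>x. fn n x - f x)) \<longlonglongrightarrow> 0"
    unfolding Lp_norm_eq using r_ge_1
    by (intro tendsto_zero_powrI[where b = "1 / r"]) auto
  then have z: "(\<lambda>n. C * Lp_norm p M (\<lambda>x. fn n x - f x)) \<longlonglongrightarrow> 0"
    by (rule tendsto_mult_right_zero)
  have "(\<lambda>n. F (fn n) - F f) \<longlonglongrightarrow> 0"
  proof (rule Lim_null_comparison[OF _ z], rule always_eventually, rule allI)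
    fix n
    show "norm (F (fn n) - F f) \<le> C * Lp_norm p M (\<lambda>x. fn n x - f x)"
      using C(2)[OF Lp_diff[OF fnL[of n] fL]] by (simp add: Lp_functional_diff[OF F fnL fL])
  qed
  then show ?thesis by (rule LIM_zero_cancel)
qed

text \<open>Uniform boundedness without an appeal to Baire category: the signed series of norming
  functionals in \<open>gliding_hump_real\<close> converges absolutely, with bound
  \<open>\<Sum>n. (1/4)^n\<close>, and is therefore itself a functional to which \<open>bdd\<close>
  applies.\<close>

lemma weakly_bounded_imp_norm_bounded:
  assumes v: "\<And>h. v h \<in> Lp_space p M"
    and bdd: "\<And>F. Lp_functional p M F \<Longrightarrow> Bseq (\<lambda>h. F (v h))"
  shows "\<exists>K. \<forall>h. Lp_norm p M (v h) \<le> K"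
proof -
  have "\<exists>\<phi>. (\<forall>f\<in>Lp_space p M. integrable M (\<lambda>x. f x * \<phi> x) \<and> \<bar>LINT x|M. f x * \<phi> x\<bar> \<le> Lp_norm p M f) \<and>
      (LINT x|M. v h x * \<phi> x) = Lp_norm p M (v h)" for h
    by (rule norming_density[OF v[of h]]) blast
  then obtain \<phi> where \<phi>:
      "\<And>h f. f \<in> Lp_space p M \<Longrightarrow> integrable M (\<lambda>x. f x * \<phi> h x)"
      "\<And>h f. f \<in> Lp_space p M \<Longrightarrow> \<bar>LINT x|M. f x * \<phi> h x\<bar> \<le> Lp_norm p M f"
      "\<And>h. (LINT x|M. v h x * \<phi> h x) = Lp_norm p M (v h)"
    by metis
  define G where "G i f = (LINT x|M. f x * \<phi> i x)" for i and f :: "'a \<Rightarrow> real"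
  show ?thesis
  proof (rule gliding_hump_real[where A = "\<lambda>i h. G i (v h)"])
    show "\<bar>G i (v h)\<bar> \<le> Lp_norm p M (v h)" for i h using \<phi>(2)[OF v] by (simp add: G_def)
    show "Lp_norm p M (v h) / 2 \<le> G h (v h)" for h
      using \<phi>(3)[of h] Lp_norm_nonneg[of "v h"] by (simp add: G_def)
    fix s :: "nat \<Rightarrow> real" and q :: "nat \<Rightarrow> nat"
    assume s: "\<And>n. \<bar>s n\<bar> = 1"
    let ?t = "\<lambda>f n. s n * (1/4)^n * G (q n) f"
    have le: "norm (?t f n) \<le> (1/4)^n * Lp_norm p M f" if "f \<in> Lp_space p M" for f n
      using \<phi>(2)[OF that, of "q n"] s[of n] by (simp add: abs_mult G_def)
    have geo: "summable (\<lambda>n. (1/4::real)^n * a)" for a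
      by (intro summable_mult2 summable_geometric) auto
    have sm: "summable (?t f)" if "f \<in> Lp_space p M" for f
      by (rule summable_comparison_test'[OF geo, of 0]) (use le[OF that] in auto)
    have "Lp_functional p M (\<lambda>f. \<Sum>n. ?t f n)"
      unfolding Lp_functional_def
    proof (intro conjI ballI allI exI)
      fix f assume f: "f \<in> Lp_space p M"
      show "(\<Sum>n. ?t (\<lambda>x. c * f x) n) = c * (\<Sum>n. ?t f n)" for c
        using sm[OF f] by (subst suminf_mult[symmetric]) (auto simp: G_def mult_ac)
      have "norm (\<Sum>n. ?t f n) \<le> (\<Sum>n. (1/4)^n * Lp_norm p M f)"
        by (rule norm_suminf_le[OF le[OF f] geo])
      also have "\<dots> = (\<Sum>n. (1/4)^n) * Lp_norm p M f"
        by (rule suminf_mult2[symmetric]) (auto intro!: summable_geometric)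
      finally show "\<bar>\<Sum>n. ?t f n\<bar> \<le> (\<Sum>n. (1/4)^n) * Lp_norm p M f" by simp
      fix g assume g: "g \<in> Lp_space p M"
      have "G i (\<lambda>x. f x + g x) = G i f + G i g" for i
        using \<phi>(1)[OF f] \<phi>(1)[OF g] by (simp add: G_def distrib_right)
      then show "(\<Sum>n. ?t (\<lambda>x. f x + g x) n) = (\<Sum>n. ?t f n) + (\<Sum>n. ?t g n)"
        using suminf_add[OF sm[OF f] sm[OF g]] by (simp add: algebra_simps)
    qed
    from bdd[OF this] show "\<exists>K. \<forall>h. \<bar>\<Sum>n. s n * (1/4)^n * G (q n) (v h)\<bar> \<le> K"
      by (auto simp: Bseq_def)
  qed
qed

end

text \<open>The essential supremum need not be attained by a test function: \<open>\<phi> h\<close>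
  averages \<open>sgn (v h x)\<close> over the set where \<open>\<bar>v h x\<bar>\<close> exceeds
  half its norm, and so recovers only that half. This is why \<open>gliding_hump_real\<close> asks
  for no more than \<open>c h / 2\<close>. The signed series is now a single test function in
  L^1.\<close>

lemma (in finite_measure) weakly_star_bounded_imp_esssup_bounded:
  assumes v: "\<And>h. v h \<in> Lp_space \<infinity> M"
    and bdd: "\<And>\<phi>. integrable M \<phi> \<Longrightarrow> Bseq (\<lambda>h. LINT x|M. v h x * \<phi> x)"
  shows "\<exists>K. \<forall>h. AE x in M. \<bar>v h x\<bar> \<le> K"
proof -
  have vm[measurable]: "v h \<in> borel_measurable M" for h using v[of h] by (simp add: Lp_space_def)
  define c where "c h = enn2real (esssup M (\<lambda>x. ennreal \<bar>v h x\<bar>))" for h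
  have c0: "0 \<le> c h" for h by (simp add: c_def)
  have ess: "esssup M (\<lambda>x. ennreal \<bar>v h x\<bar>) = ennreal (c h)" for h
    using v[of h] by (auto simp: c_def Lp_space_def)
  have AEc: "AE x in M. \<bar>v h x\<bar> \<le> c h" for h
    using esssup_AE[of "\<lambda>x. ennreal \<bar>v h x\<bar>" M] unfolding ess by (simp add: c0)
  define S where "S h = {x \<in> space M. c h / 2 < \<bar>v h x\<bar>}" for h
  have [measurable]: "S h \<in> sets M" for h unfolding S_def by measurable
  have Spos: "0 < measure M (S h)" if "0 < c h" for h
  proof (rule ccontr)
    assume "\<not> ?thesis"
    then have "S h \<in> null_sets M"
      by (auto simp: null_sets_def emeasure_eq_measure not_less measure_le_0_iff)
    then have "AE x in M. \<bar>v h x\<bar> \<le> c h / 2"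
      by (rule AE_I'[where N = "S h"]) (auto simp: S_def)
    then have "AE x in M. ennreal \<bar>v h x\<bar> \<le> ennreal (c h / 2)"
      by eventually_elim (rule ennreal_leI)
    then have "esssup M (\<lambda>x. ennreal \<bar>v h x\<bar>) \<le> ennreal (c h / 2)"
      by (intro esssup_I) auto
    then show False using that unfolding ess by simp
  qed
  \<comment> \<open>The guard separates the case \<open>c h = 0\<close>, in which \<open>S h\<close>
    is null and cannot be averaged over.\<close>
  define \<phi> where "\<phi> h x = (if 0 < c h then sgn (v h x) * indicator (S h) x / measure M (S h) else 0)" for h x
  have [measurable]: "\<phi> h \<in> borel_measurable M" for h unfolding \<phi>_def by measurable
  have \<phi>_int: "integrable M (\<phi> h)" for h
    by (rule integrable_const_bound[where B = "1 / measure M (S h)"])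
      (auto simp: \<phi>_def abs_mult indicator_def sgn_real_def intro!: AE_I2)
  have \<phi>1: "(LINT x|M. \<bar>\<phi> h x\<bar>) \<le> 1" for h
  proof (cases "0 < c h")
    case True
    have "(LINT x|M. \<bar>\<phi> h x\<bar>) \<le> (LINT x|M. indicator (S h) x / measure M (S h))"
    proof (rule integral_mono)
      show "\<bar>\<phi> h x\<bar> \<le> indicator (S h) x / measure M (S h)" for x
        by (auto simp: \<phi>_def abs_mult indicator_def sgn_real_def)
    qed (use \<phi>_int in \<open>auto simp: emeasure_eq_measure\<close>)
    also have "\<dots> \<le> 1" by simp
    finally show ?thesis .
  qed (simp add: \<phi>_def)
  have v\<phi>: "integrable M (\<lambda>x. v h x * f x)" "\<bar>LINT x|M. v h x * f x\<bar> \<le> c h * (LINT x|M. \<bar>f x\<bar>)"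
    if f: "integrable M f" for h f
  proof -
    have ae: "AE x in M. norm (v h x * f x) \<le> norm (c h * \<bar>f x\<bar>)"
      using AEc[of h] by eventually_elim (auto simp: abs_mult c0 intro!: mult_right_mono)
    have i: "integrable M (\<lambda>x. c h * \<bar>f x\<bar>)" using f by simp
    have [measurable]: "f \<in> borel_measurable M" using f by auto
    show i2: "integrable M (\<lambda>x. v h x * f x)"
      by (rule Bochner_Integration.integrable_bound[OF i _ ae]) auto
    have "\<bar>LINT x|M. v h x * f x\<bar> \<le> (LINT x|M. \<bar>v h x * f x\<bar>)" by (rule integral_abs_bound)
    also have "\<dots> \<le> (LINT x|M. c h * \<bar>f x\<bar>)"
      using i i2 ae by (intro integral_mono_AE) (auto simp: c0)
    finally show "\<bar>LINT x|M. v h x * f x\<bar> \<le> c h * (LINT x|M. \<bar>f x\<bar>)" by simp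
  qed
  have "\<exists>K. \<forall>h. c h \<le> K"
  proof (rule gliding_hump_real[where A = "\<lambda>i h. LINT x|M. v h x * \<phi> i x"])
    show "\<bar>LINT x|M. v h x * \<phi> i x\<bar> \<le> c h" for i h
      using v\<phi>(2)[OF \<phi>_int[of i], of h] mult_left_mono[OF \<phi>1[of i] c0[of h]] by simp
    show "c h / 2 \<le> (LINT x|M. v h x * \<phi> h x)" for h
    proof (cases "0 < c h")
      case True
      have "c h / 2 = (LINT x|M. c h / 2 * (indicator (S h) x / measure M (S h)))"
        using Spos[OF True] by simp
      also have "\<dots> \<le> (LINT x|M. v h x * \<phi> h x)"
      proof (rule integral_mono)
        show "integrable M (\<lambda>x. c h / 2 * (indicator (S h) x / measure M (S h)))"
          by (simp add: emeasure_eq_measure)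
        fix x
        show "c h / 2 * (indicator (S h) x / measure M (S h)) \<le> v h x * \<phi> h x"
          using True Spos[OF True] by (auto simp: \<phi>_def indicator_def S_def abs_sgn[symmetric] sgn_real_def divide_simps)
      qed (rule v\<phi>(1)[OF \<phi>_int])
      finally show ?thesis .
    qed (use c0[of h] in \<open>simp add: \<phi>_def\<close>)
    fix s :: "nat \<Rightarrow> real" and q :: "nat \<Rightarrow> nat"
    assume s: "\<And>n. \<bar>s n\<bar> = 1"
    let ?t = "\<lambda>n x. s n * (1/4)^n * \<phi> (q n) x"
    have ti: "integrable M (?t n)" for n using \<phi>_int by simp
    have tn: "(LINT x|M. norm (?t n x)) \<le> (1/4)^n" for n
      using \<phi>1[of "q n"] s[of n] by (simp add: abs_mult)
    have geo: "summable (\<lambda>n. (1/4::real)^n)" by (rule summable_geometric) auto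
    have sm1: "summable (\<lambda>n. LINT x|M. norm (?t n x))"
      by (rule summable_comparison_test'[OF geo, of 0]) (use tn in auto)
    \<comment> \<open>The integrals of the absolute values stay below a geometric series, so the sum
      converges absolutely almost everywhere; this also permits exchanging it with the integral
      against each \<open>v h\<close>.\<close>
    have AEs: "AE x in M. summable (\<lambda>n. norm (?t n x))"
    proof -
      have "(\<integral>\<^sup>+x. (\<Sum>n. ennreal (norm (?t n x))) \<partial>M) = (\<Sum>n. \<integral>\<^sup>+x. ennreal (norm (?t n x)) \<partial>M)"
        by (rule nn_integral_suminf) auto
      also have "\<dots> = (\<Sum>n. ennreal (LINT x|M. norm (?t n x)))"
        using ti by (subst nn_integral_eq_integral) auto
      also have "\<dots> = ennreal (\<Sum>n. LINT x|M. norm (?t n x))"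
        by (rule suminf_ennreal2[OF _ sm1]) auto
      finally have "(\<integral>\<^sup>+x. (\<Sum>n. ennreal (norm (?t n x))) \<partial>M) \<noteq> \<infinity>" by simp
      then have "AE x in M. (\<Sum>n. ennreal (norm (?t n x))) \<noteq> \<infinity>"
        by (intro nn_integral_PInf_AE) auto
      then show ?thesis by eventually_elim (rule summable_suminf_not_top, auto)
    qed
    define \<Phi> where "\<Phi> x = (\<Sum>n. ?t n x)" for x
    have \<Phi>_int: "integrable M \<Phi>"
      unfolding \<Phi>_def by (rule integrable_suminf[OF ti AEs sm1])
    have "(\<Sum>n. s n * (1/4)^n * (LINT x|M. v h x * \<phi> (q n) x)) = (LINT x|M. v h x * \<Phi> x)" for h
    proof -
      have i: "integrable M (\<lambda>x. v h x * ?t n x)" for n by (rule v\<phi>(1)[OF ti])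
      have "(LINT x|M. (\<Sum>n. v h x * ?t n x)) = (\<Sum>n. LINT x|M. v h x * ?t n x)"
      proof (rule integral_suminf[OF i])
        show "AE x in M. summable (\<lambda>n. norm (v h x * ?t n x))"
          using AEs
        proof eventually_elim
          case (elim x)
          then show ?case using summable_mult[OF elim, of "\<bar>v h x\<bar>"] by (simp add: abs_mult)
        qed
        have "(LINT x|M. norm (v h x * ?t n x)) \<le> c h * (1/4)^n" for n
        proof -
          have "(LINT x|M. norm (v h x * ?t n x)) \<le> (LINT x|M. c h * norm (?t n x))"
          proof (rule integral_mono_AE)
            show "AE x in M. norm (v h x * ?t n x) \<le> c h * norm (?t n x)"
              using AEc[of h] by eventually_elim (simp only: norm_mult, intro mult_right_mono, auto)
          qed (use i[of n] ti[of n] in auto)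
          also have "\<dots> \<le> c h * (1/4)^n" using mult_left_mono[OF tn c0] by simp
          finally show ?thesis .
        qed
        then show "summable (\<lambda>n. LINT x|M. norm (v h x * ?t n x))"
          by (intro summable_comparison_test'[OF summable_mult[OF geo, of "c h"], of 0]) auto
      qed
      moreover have "AE x in M. (\<Sum>n. v h x * ?t n x) = v h x * \<Phi> x"
        using AEs unfolding \<Phi>_def
        by eventually_elim (rule suminf_mult, rule summable_norm_cancel)
      then have "(LINT x|M. (\<Sum>n. v h x * ?t n x)) = (LINT x|M. v h x * \<Phi> x)"
        using i \<Phi>_int by (intro integral_cong_AE) auto
      moreover have "(LINT x|M. v h x * ?t n x) = s n * (1/4)^n * (LINT x|M. v h x * \<phi> (q n) x)" for n
        by (subst integral_mult_right_zero[symmetric]) (simp only: mult_ac)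
      ultimately show ?thesis by (simp only:)
    qed
    then show "\<exists>K. \<forall>h. \<bar>\<Sum>n. s n * (1/4)^n * (LINT x|M. v h x * \<phi> (q n) x)\<bar> \<le> K"
      using bdd[OF \<Phi>_int] by (auto simp: Bseq_def)
  qed
  then obtain K where K: "\<And>h. c h \<le> K" by blast
  have "AE x in M. \<bar>v h x\<bar> \<le> K" for h
    using AEc[of h] by (rule eventually_mono) (use K[of h] in linarith)
  then show ?thesis by blast
qed

section \<open>Continuous functionals on \<open>L\<^sup>p\<close>\<close>

text \<open>Finite additivity suffices: the bound \<open>C * measure M A powr s\<close> drives
  \<open>m\<close> to 0 along sets decreasing to the empty set, hence countable additivity, and it
  gives absolute continuity. The exponent \<open>s\<close> accommodates \<open>1 / r\<close>, the
  power with which the norm of an indicator depends on the measure.\<close>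

lemma (in finite_measure) Radon_Nikodym_additive:
  fixes m :: "'a set \<Rightarrow> real"
  assumes nn: "\<And>A. A \<in> sets M \<Longrightarrow> 0 \<le> m A"
    and add: "\<And>A B. A \<in> sets M \<Longrightarrow> B \<in> sets M \<Longrightarrow> A \<inter> B = {} \<Longrightarrow> m (A \<union> B) = m A + m B"
    and dom: "\<And>A. A \<in> sets M \<Longrightarrow> m A \<le> C * measure M A powr s" and "0 < s"
  shows "\<exists>g. integrable M g \<and> (\<forall>A\<in>sets M. m A = (LINT x|M. indicator A x * g x))"
proof -
  define N where "N = measure_of (space M) (sets M) (\<lambda>A. ennreal (m A))"
  have m0: "m {} = 0" using add[of "{}" "{}"] by simp
  have pos: "positive (sets M) (\<lambda>A. ennreal (m A))" by (simp add: positive_def m0)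
  have ca: "countably_additive (sets M) (\<lambda>A. ennreal (m A))"
  proof (rule sets.empty_continuous_imp_countably_additive[OF pos])
    show "additive (sets M) (\<lambda>A. ennreal (m A))"
      by (auto simp: additive_def add nn)
    fix A :: "nat \<Rightarrow> 'a set" assume A: "range A \<subseteq> sets M" "decseq A" "(\<Inter>i. A i) = {}"
    have "(\<lambda>i. measure M (A i)) \<longlonglongrightarrow> 0"
      using finite_Lim_measure_decseq[OF A(1,2)] A(3) by simp
    then have "(\<lambda>i. measure M (A i) powr s) \<longlonglongrightarrow> 0"
      using \<open>0 < s\<close> by (intro tendsto_zero_powrI[where b = s]) auto
    then have z: "(\<lambda>i. C * measure M (A i) powr s) \<longlonglongrightarrow> 0" by (rule tendsto_mult_right_zero)
    have "(\<lambda>i. m (A i)) \<longlonglongrightarrow> 0"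
    proof (rule tendsto_sandwich[OF _ _ tendsto_const z])
      have "A i \<in> sets M" for i using A by auto
      then show "\<forall>\<^sub>F i in sequentially. 0 \<le> m (A i)" "\<forall>\<^sub>F i in sequentially. m (A i) \<le> C * measure M (A i) powr s"
        using nn dom by auto
    qed
    then show "(\<lambda>i. ennreal (m (A i))) \<longlonglongrightarrow> 0"
      using tendsto_ennrealI[of "\<lambda>i. m (A i)" 0] by simp
  qed auto
  have N_eq: "emeasure N A = ennreal (m A)" if "A \<in> sets M" for A
    unfolding N_def using pos ca that by (simp add: emeasure_measure_of_sigma sets.sigma_algebra_axioms)
  have sets_N: "sets N = sets M" and space_N: "space N = space M"
    by (simp_all add: N_def)
  have "finite_measure N"
    by (rule finite_measureI) (simp add: space_N N_eq)
  moreover have "absolutely_continuous M N"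
    unfolding absolutely_continuous_def
  proof
    fix A assume "A \<in> null_sets M"
    then have "A \<in> sets M" "measure M A = 0" by (auto simp: null_sets_def measure_def)
    then have "m A = 0" using nn[of A] dom[of A] by simp
    then show "A \<in> null_sets N" using \<open>A \<in> sets M\<close> by (simp add: null_sets_def sets_N N_eq)
  qed
  ultimately obtain f where f[measurable]: "f \<in> borel_measurable M" and dens: "density M f = N"
    using Radon_Nikodym_finite_measure[OF _ sets_N] by blast
  have f_int: "(\<integral>\<^sup>+x. f x * indicator A x \<partial>M) = ennreal (m A)" if "A \<in> sets M" for A
    using emeasure_density[OF f that] N_eq[OF that] by (simp add: dens)
  have "(\<integral>\<^sup>+x. f x \<partial>M) = (\<integral>\<^sup>+x. f x * indicator (space M) x \<partial>M)"
    by (intro nn_integral_cong) simp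
  also have "\<dots> = ennreal (m (space M))" by (rule f_int) auto
  finally have "(\<integral>\<^sup>+x. f x \<partial>M) \<noteq> \<infinity>" by simp
  then have fin: "AE x in M. f x \<noteq> \<infinity>" by (intro nn_integral_PInf_AE) auto
  define g where "g x = enn2real (f x)" for x
  have [measurable]: "g \<in> borel_measurable M" unfolding g_def by measurable
  have fg: "AE x in M. f x = ennreal (g x)"
    using fin by eventually_elim (simp add: g_def less_top)
  have ig: "(\<integral>\<^sup>+x. ennreal (indicator A x * g x) \<partial>M) = ennreal (m A)" if "A \<in> sets M" for A
    unfolding f_int[OF that, symmetric] using fg
    by (intro nn_integral_cong_AE) (auto simp: indicator_def elim!: eventually_mono)
  have "integrable M g"
  proof (rule integrableI_nonneg)
    have "(\<integral>\<^sup>+x. ennreal (g x) \<partial>M) = (\<integral>\<^sup>+x. ennreal (indicator (space M) x * g x) \<partial>M)"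
      by (intro nn_integral_cong) simp
    then show "(\<integral>\<^sup>+x. ennreal (g x) \<partial>M) < \<infinity>" using ig[of "space M"] by simp
  qed (auto simp: g_def)
  moreover have "m A = (LINT x|M. indicator A x * g x)" if A: "A \<in> sets M" for A
    using A nn[OF A] ig[OF A]
    by (subst integral_eq_nn_integral) (auto simp: g_def)
  ultimately show ?thesis by blast
qed

text \<open>The positive part of the signed measure is \<open>A \<mapsto> sup {\<nu> B | B \<subseteq> A}\<close>.\<close>

lemma (in finite_measure) Radon_Nikodym_signed_additive:
  fixes \<nu> :: "'a set \<Rightarrow> real"
  assumes add: "\<And>A B. A \<in> sets M \<Longrightarrow> B \<in> sets M \<Longrightarrow> A \<inter> B = {} \<Longrightarrow> \<nu> (A \<union> B) = \<nu> A + \<nu> B"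
    and dom: "\<And>A. A \<in> sets M \<Longrightarrow> \<bar>\<nu> A\<bar> \<le> C * measure M A powr s" and "0 < s" and "0 \<le> C"
  shows "\<exists>g. integrable M g \<and> (\<forall>A\<in>sets M. \<nu> A = (LINT x|M. indicator A x * g x))"
proof -
  define S where "S A = \<nu> ` {B \<in> sets M. B \<subseteq> A}" for A
  define P where "P A = Sup (S A)" for A
  have bnd: "y \<le> C * measure M A powr s" if A: "A \<in> sets M" and y: "y \<in> S A" for A y
  proof -
    obtain B where B: "B \<in> sets M" "B \<subseteq> A" "y = \<nu> B" using y by (auto simp: S_def)
    have "y \<le> C * measure M B powr s" using dom[OF B(1)] B(3) by simp
    also have "\<dots> \<le> C * measure M A powr s"
      using B A \<open>0 < s\<close> \<open>0 \<le> C\<close> by (intro mult_left_mono powr_mono2 finite_measure_mono) auto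
    finally show ?thesis .
  qed
  have bdd: "bdd_above (S A)" if "A \<in> sets M" for A
    using bnd[OF that] by (intro bdd_aboveI) auto
  have ne: "S A \<noteq> {}" for A by (auto simp: S_def)
  have upper: "\<nu> B \<le> P A" if "A \<in> sets M" "B \<in> sets M" "B \<subseteq> A" for A B
    unfolding P_def by (rule cSup_upper[OF _ bdd[OF that(1)]]) (use that in \<open>auto simp: S_def\<close>)
  have least: "P A \<le> c" if "\<And>B. B \<in> sets M \<Longrightarrow> B \<subseteq> A \<Longrightarrow> \<nu> B \<le> c" for A c
    unfolding P_def by (rule cSup_least[OF ne]) (use that in \<open>auto simp: S_def\<close>)
  have \<nu>0: "\<nu> {} = 0" using add[of "{}" "{}"] by simp
  have P0: "0 \<le> P A" if "A \<in> sets M" for A using upper[OF that, of "{}"] \<nu>0 by simp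
  have Pdom: "P A \<le> C * measure M A powr s" if "A \<in> sets M" for A
    unfolding P_def by (rule cSup_least[OF ne bnd[OF that]])
  have Padd: "P (A \<union> B) = P A + P B" if A: "A \<in> sets M" and B: "B \<in> sets M" and AB: "A \<inter> B = {}" for A B
  proof (rule antisym)
    show "P (A \<union> B) \<le> P A + P B"
    proof (rule least)
      fix D assume D: "D \<in> sets M" "D \<subseteq> A \<union> B"
      have "\<nu> ((D \<inter> A) \<union> (D \<inter> B)) = \<nu> (D \<inter> A) + \<nu> (D \<inter> B)"
        using D A B AB by (intro add) auto
      moreover have "(D \<inter> A) \<union> (D \<inter> B) = D" using D by auto
      moreover have "\<nu> (D \<inter> A) \<le> P A" "\<nu> (D \<inter> B) \<le> P B" using A B D by (auto intro!: upper)
      ultimately show "\<nu> D \<le> P A + P B" by simp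
    qed
    \<comment> \<open>For superadditivity the two suprema are taken one after the other, over
      \<open>D\<close> with \<open>E\<close> fixed and then over \<open>E\<close>.\<close>
    have "\<nu> D + \<nu> E \<le> P (A \<union> B)" if "D \<in> sets M" "D \<subseteq> A" "E \<in> sets M" "E \<subseteq> B" for D E
    proof -
      have "\<nu> (D \<union> E) = \<nu> D + \<nu> E" using that AB by (intro add) auto
      moreover have "\<nu> (D \<union> E) \<le> P (A \<union> B)" using that A B by (intro upper) auto
      ultimately show ?thesis by simp
    qed
    then have "P A \<le> P (A \<union> B) - \<nu> E" if "E \<in> sets M" "E \<subseteq> B" for E
      using that by (intro least) (simp add: le_diff_eq)
    then have "P B \<le> P (A \<union> B) - P A"
      by (intro least) (simp add: le_diff_eq add.commute)
    then show "P A + P B \<le> P (A \<union> B)" by simp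
  qed
  obtain g1 where g1: "integrable M g1" "\<And>A. A \<in> sets M \<Longrightarrow> P A = (LINT x|M. indicator A x * g1 x)"
    using Radon_Nikodym_additive[OF P0 Padd Pdom \<open>0 < s\<close>] by blast
  \<comment> \<open>The set function \<open>P A - \<nu> A\<close> is the negative part of the Jordan
    decomposition; both terms are dominated, hence the constant \<open>2 * C\<close>.\<close>
  have "\<exists>g. integrable M g \<and> (\<forall>A\<in>sets M. P A - \<nu> A = (LINT x|M. indicator A x * g x))"
  proof (rule Radon_Nikodym_additive[where C = "2 * C" and s = s])
    fix A assume A: "A \<in> sets M"
    show "0 \<le> P A - \<nu> A" using upper[OF A A] by simp
    show "P A - \<nu> A \<le> 2 * C * measure M A powr s" using Pdom[OF A] dom[OF A] by linarith
    fix B assume "B \<in> sets M" "A \<inter> B = {}"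
    then show "P (A \<union> B) - \<nu> (A \<union> B) = P A - \<nu> A + (P B - \<nu> B)" using A by (simp add: Padd add)
  qed fact
  then obtain g2 where g2: "integrable M g2" "\<And>A. A \<in> sets M \<Longrightarrow> P A - \<nu> A = (LINT x|M. indicator A x * g2 x)"
    by blast
  have "\<nu> A = (LINT x|M. indicator A x * (g1 x - g2 x))" if A: "A \<in> sets M" for A
  proof -
    have "integrable M (\<lambda>x. indicator A x * g1 x)" "integrable M (\<lambda>x. indicator A x * g2 x)"
      using A g1(1) g2(1) by (auto intro: integrable_real_mult_indicator simp: mult.commute)
    then show ?thesis using g1(2)[OF A] g2(2)[OF A] by (simp add: right_diff_distrib)
  qed
  then show ?thesis using g1(1) g2(1) by (intro exI[of _ "\<lambda>x. g1 x - g2 x"]) auto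
qed

section \<open>Truncated integral representation of a functional, and its tails\<close>

context finite_exponent_Lp
begin

text \<open>The norm of an indicator is \<open>measure M A powr (1 / r)\<close>, so the values of
  \<open>F\<close> on indicators form a dominated signed set function. What comes out is an
  integrable \<open>g\<close>, which does not by itself give a meaning to the integral of
  \<open>f x * g x\<close> for every \<open>f\<close> in the space.\<close>

lemma Lp_functional_density:
  assumes F: "Lp_functional p M F"
  obtains g where "integrable M g" "\<And>A. A \<in> sets M \<Longrightarrow> F (indicator A) = (LINT x|M. indicator A x * g x)"
proof -
  obtain C where C: "0 < C" "\<And>f. f \<in> Lp_space p M \<Longrightarrow> \<bar>F f\<bar> \<le> C * Lp_norm p M f"
    using Lp_functional_bound[OF F] by blast
  have ind: "indicator A \<in> Lp_space p M" if "A \<in> sets M" for A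
    using that by (intro Lp_bounded[where K = 1]) (auto simp: indicator_def)
  have "\<exists>g. integrable M g \<and> (\<forall>A\<in>sets M. F (indicator A) = (LINT x|M. indicator A x * g x))"
  proof (rule Radon_Nikodym_signed_additive[where C = C and s = "1 / r"])
    fix A assume A: "A \<in> sets M"
    have "\<bar>indicator A x :: real\<bar> powr r = indicator A x" for x
      by (auto simp: indicator_def)
    then have "Lp_norm p M (indicator A) = measure M A powr (1 / r)"
      using A by (simp add: Lp_norm_eq)
    then show "\<bar>F (indicator A)\<bar> \<le> C * measure M A powr (1 / r)" using C(2)[OF ind[OF A]] by simp
    fix B assume B: "B \<in> sets M" "A \<inter> B = {}"
    have "indicator (A \<union> B) = (\<lambda>x. indicator A x + indicator B x :: real)"
      using B by (auto simp: indicator_def fun_eq_iff)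
    then show "F (indicator (A \<union> B)) = F (indicator A) + F (indicator B)"
      using Lp_functional_add[OF F ind[OF A] ind[OF B(1)]] by simp
  qed (use r_ge_1 C in auto)
  then show ?thesis using that by blast
qed

text \<open>Where \<open>g\<close> is bounded the product with any \<open>f\<close> in the space is
  integrable, and the identity spreads from indicators by linearity and monotone limits:
  \<open>Lp_functional_dominated_convergence\<close> handles the side of \<open>F\<close>, dominated
  convergence the side of the integral.\<close>

lemma Lp_functional_truncated_representation:
  assumes F: "Lp_functional p M F" and g: "integrable M g"
    and F_ind: "\<And>A. A \<in> sets M \<Longrightarrow> F (indicator A) = (LINT x|M. indicator A x * g x)"
    and E[measurable]: "E \<in> sets M" and gE: "\<And>x. x \<in> E \<Longrightarrow> \<bar>g x\<bar> \<le> K"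
    and f: "f \<in> Lp_space p M"
  shows "F (\<lambda>x. indicator E x * f x) = (LINT x|M. f x * (indicator E x * g x))"
proof -
  have gm[measurable]: "g \<in> borel_measurable M" using g by auto
  have bound: "\<bar>indicator E x * g x\<bar> \<le> \<bar>K\<bar>" for x using gE[of x] by (auto simp: indicator_def)
  have int: "integrable M (\<lambda>x. f x * (indicator E x * g x))" if "f \<in> Lp_space p M" for f
  proof (rule Bochner_Integration.integrable_bound[where f = "\<lambda>x. \<bar>K\<bar> * \<bar>f x\<bar>"])
    show "AE x in M. norm (f x * (indicator E x * g x)) \<le> norm (\<bar>K\<bar> * \<bar>f x\<bar>)"
      using mult_mono[OF bound order_refl, of "\<bar>f _\<bar>"] by (auto simp: abs_mult mult_ac)
  qed (use Lp_integrable[OF that] in auto)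
  \<comment> \<open>Membership in the space is a premise inside the induction predicate, because the
    rule ranges over all nonnegative measurable functions.\<close>
  have nonneg: "f \<in> Lp_space p M \<longrightarrow> F (\<lambda>x. indicator E x * f x) = (LINT x|M. f x * (indicator E x * g x))"
    if "f \<in> borel_measurable M" "\<And>x. 0 \<le> f x" for f
    using that
  proof (induction rule: borel_measurable_induct_real)
    case (set A)
    have "(\<lambda>x. indicator E x * indicator A x) = (indicator (E \<inter> A) :: _ \<Rightarrow> real)"
      by (auto simp: indicator_def)
    moreover have "(LINT x|M. indicator (E \<inter> A) x * g x) = (LINT x|M. indicator A x * (indicator E x * g x))"
      by (intro Bochner_Integration.integral_cong) (auto simp: indicator_def)
    ultimately show ?case using F_ind[of "E \<inter> A"] set by simp
  next
    case (mult u c)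
    show ?case
    proof
      assume cu: "(\<lambda>x. c * u x) \<in> Lp_space p M"
      show "F (\<lambda>x. indicator E x * (c * u x)) = (LINT x|M. c * u x * (indicator E x * g x))"
      proof (cases "c = 0")
        case True
        have "F (\<lambda>x. 0) = 0" using Lp_functional_cmult[OF F f, of 0] by simp
        then show ?thesis using True by simp
      next
        case False
        then have u: "u \<in> Lp_space p M" using Lp_cmult[OF cu, of "1 / c"] by simp
        have "F (\<lambda>x. indicator E x * (c * u x)) = F (\<lambda>x. c * (indicator E x * u x))"
          by (simp add: mult_ac)
        also have "\<dots> = c * F (\<lambda>x. indicator E x * u x)"
          by (rule Lp_functional_cmult[OF F Lp_indicator_mult[OF u E]])
        finally show ?thesis using mult u by (simp add: mult.assoc)
      qed
    qed
  next
    case (add u v)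
    show ?case
    proof
      assume uv: "(\<lambda>x. v x + u x) \<in> Lp_space p M"
      have u: "u \<in> Lp_space p M" and v: "v \<in> Lp_space p M"
        using add by (auto intro!: Lp_mono[OF uv])
      have "F (\<lambda>x. indicator E x * (v x + u x)) = F (\<lambda>x. indicator E x * v x + indicator E x * u x)"
        by (simp add: distrib_left)
      also have "\<dots> = F (\<lambda>x. indicator E x * v x) + F (\<lambda>x. indicator E x * u x)"
        using u v by (intro Lp_functional_add[OF F] Lp_indicator_mult) auto
      also have "\<dots> = (LINT x|M. v x * (indicator E x * g x)) + (LINT x|M. u x * (indicator E x * g x))"
        using add u v by simp
      also have "\<dots> = (LINT x|M. (v x + u x) * (indicator E x * g x))"
        using int[OF u] int[OF v] by (simp add: distrib_right)
      finally show "F (\<lambda>x. indicator E x * (v x + u x)) = (LINT x|M. (v x + u x) * (indicator E x * g x))" .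
    qed
  next
    case (seq U)
    show ?case
    proof
      assume u: "f \<in> Lp_space p M"
      have Um: "\<And>i. U i \<in> borel_measurable M" and U0: "\<And>i x. 0 \<le> U i x" and Uinc: "incseq U"
        and Ulim: "\<And>x. x \<in> space M \<Longrightarrow> (\<lambda>i. U i x) \<longlonglongrightarrow> f x"
        and UP: "\<And>i. U i \<in> Lp_space p M \<Longrightarrow>
          F (\<lambda>x. indicator E x * U i x) = (LINT x|M. U i x * (indicator E x * g x))"
        using seq by auto
      have Uf: "\<bar>U i x\<bar> \<le> \<bar>f x\<bar>" if "x \<in> space M" for i x
      proof -
        have "incseq (\<lambda>i. U i x)" using Uinc by (auto simp: incseq_def le_fun_def)
        then have "U i x \<le> f x" using Ulim[OF that] by (rule incseq_le)
        then show ?thesis using U0[of i x] by simp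
      qed
      have UL: "U i \<in> Lp_space p M" for i
        using Uf Um by (intro Lp_mono[OF u]) auto
      note [measurable] = Um Lp_measurable[OF u]
      have "(\<lambda>i. F (\<lambda>x. indicator E x * U i x)) \<longlonglongrightarrow> F (\<lambda>x. indicator E x * f x)"
        using Ulim Uf by (intro Lp_functional_dominated_convergence[OF F u] tendsto_mult_left)
          (auto simp: indicator_def)
      moreover have "(\<lambda>i. LINT x|M. U i x * (indicator E x * g x)) \<longlonglongrightarrow> (LINT x|M. f x * (indicator E x * g x))"
      proof (rule integral_dominated_convergence[where w = "\<lambda>x. \<bar>f x * (indicator E x * g x)\<bar>"])
        show "AE x in M. (\<lambda>i. U i x * (indicator E x * g x)) \<longlonglongrightarrow> f x * (indicator E x * g x)"
          using Ulim by (intro AE_I2 tendsto_mult_right)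
        show "AE x in M. norm (U i x * (indicator E x * g x)) \<le> \<bar>f x * (indicator E x * g x)\<bar>" for i
          using Uf by (intro AE_I2) (auto simp: abs_mult intro!: mult_right_mono)
      qed (use int[OF u] in auto)
      moreover have "F (\<lambda>x. indicator E x * U i x) = (LINT x|M. U i x * (indicator E x * g x))" for i
        using UP[OF UL] .
      ultimately show "F (\<lambda>x. indicator E x * f x) = (LINT x|M. f x * (indicator E x * g x))"
        by (simp only: LIMSEQ_unique)
    qed
  qed
  have fm[measurable]: "f \<in> borel_measurable M" using f by (rule Lp_measurable)
  have P: "(\<lambda>x. max 0 (f x)) \<in> Lp_space p M" and N: "(\<lambda>x. max 0 (- f x)) \<in> Lp_space p M"
    by (auto intro!: Lp_mono[OF f])
  have dec: "f x = max 0 (f x) - max 0 (- f x)" for x by auto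
  have "F (\<lambda>x. indicator E x * f x) = F (\<lambda>x. indicator E x * max 0 (f x) - indicator E x * max 0 (- f x))"
    by (subst dec) (simp add: right_diff_distrib)
  also have "\<dots> = F (\<lambda>x. indicator E x * max 0 (f x)) - F (\<lambda>x. indicator E x * max 0 (- f x))"
    by (intro Lp_functional_diff[OF F] Lp_indicator_mult P N E)
  also have "\<dots> = (LINT x|M. max 0 (f x) * (indicator E x * g x)) - (LINT x|M. max 0 (- f x) * (indicator E x * g x))"
    using nonneg[of "\<lambda>x. max 0 (f x)"] nonneg[of "\<lambda>x. max 0 (- f x)"] P N by simp
  also have "\<dots> = (LINT x|M. max 0 (f x) * (indicator E x * g x) - max 0 (- f x) * (indicator E x * g x))"
    using int[OF P] int[OF N] by simp
  also have "\<dots> = (LINT x|M. f x * (indicator E x * g x))"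
    by (subst (3) dec) (simp only: left_diff_distrib)
  finally show ?thesis .
qed

lemma Lp_functional_zero: "Lp_functional p M F \<Longrightarrow> F (\<lambda>x. 0) = 0"
  using Lp_functional_cmult[of F "\<lambda>x. 0" 0] Lp_bounded[of "\<lambda>x. 0" 0] by simp

text \<open>\<open>F\<close> takes functions on the whole type; values outside
  \<open>space M\<close> are invisible to it because the seminorm of the difference
  vanishes.\<close>

lemma Lp_functional_cong:
  assumes F: "Lp_functional p M F" and f: "f \<in> Lp_space p M" "g \<in> Lp_space p M"
    and eq: "\<And>x. x \<in> space M \<Longrightarrow> f x = g x"
  shows "F f = F g"
proof -
  obtain C where C: "\<And>f. f \<in> Lp_space p M \<Longrightarrow> \<bar>F f\<bar> \<le> C * Lp_norm p M f"
    using Lp_functional_bound[OF F] by blast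
  have "(LINT x|M. \<bar>f x - g x\<bar> powr r) = (LINT x|M. 0)"
    by (intro Bochner_Integration.integral_cong) (auto simp: eq)
  then have "Lp_norm p M (\<lambda>x. f x - g x) = 0" by (simp add: Lp_norm_eq)
  then have "F (\<lambda>x. f x - g x) = 0" using C[OF Lp_diff[OF f]] by simp
  then show ?thesis by (simp add: Lp_functional_diff[OF F f])
qed

text \<open>One fixed \<open>f\<close> dominates all its restrictions, and these tend to 0
  pointwise. Uniformity over a ball is a different matter and is the subject of the next
  lemma.\<close>

lemma Lp_functional_vanishing_tail:
  assumes F: "Lp_functional p M F" and T: "\<And>n. T n \<in> sets M" "decseq T" "(\<Inter>n. T n) = {}"
    and f: "f \<in> Lp_space p M"
  shows "(\<lambda>n. F (\<lambda>x. indicator (T n) x * f x)) \<longlonglongrightarrow> 0"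
proof -
  note [measurable] = T(1) Lp_measurable[OF f]
  have "(\<lambda>n. F (\<lambda>x. indicator (T n) x * f x)) \<longlonglongrightarrow> F (\<lambda>x. 0)"
  proof (rule Lp_functional_dominated_convergence[OF F f])
    fix x
    obtain k where "x \<notin> T k" using T(3) by blast
    then have "x \<notin> T n" if "k \<le> n" for n using T(2) that by (auto simp: decseq_def)
    then show "(\<lambda>n. indicator (T n) x * f x) \<longlonglongrightarrow> 0"
      by (intro tendsto_eventually eventually_sequentiallyI[of k]) simp
  qed (auto simp: indicator_def)
  then show ?thesis using Lp_functional_zero[OF F] by simp
qed

text \<open>Here \<open>p > 1\<close> is essential: a sum of \<open>k\<close> disjointly supported functions from a ball has norm
  of order \<open>k powr (1 / p)\<close>, whereas functional values bounded below would add up to order \<open>k\<close>.\<close>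

lemma Lp_functional_uniformly_vanishing_tail:
  assumes F: "Lp_functional p M F" and T: "\<And>n. T n \<in> sets M" "decseq T" "(\<Inter>n. T n) = {}"
    and r: "1 < r" and "0 < e"
  shows "\<exists>N. \<forall>n\<ge>N. \<forall>f\<in>Lp_space p M. (LINT x|M. \<bar>f x\<bar> powr r) \<le> B \<longrightarrow>
     \<bar>F (\<lambda>x. indicator (T n) x * f x)\<bar> \<le> e"
proof (rule ccontr)
  assume neg: "\<not> ?thesis"
  define D where "D n m = T n - T m" for n m
  have [measurable]: "D n m \<in> sets M" for n m unfolding D_def using T(1) by auto
  \<comment> \<open>A witness beyond \<open>n\<close>: a function of the ball whose part on the band
    \<open>T k - T m\<close> already has value at least \<open>e / 2\<close>. Cutting off at a
    suitable \<open>m\<close> costs the other half, since the tail of one fixed \<open>f\<close>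
    vanishes.\<close>
  define Q where "Q n k m f \<longleftrightarrow> n \<le> k \<and> k < m \<and> f \<in> Lp_space p M \<and> (LINT x|M. \<bar>f x\<bar> powr r) \<le> B \<and>
      e / 2 \<le> F (\<lambda>x. indicator (D k m) x * f x)" for n k m f
  have step: "\<exists>k m f. Q n k m f" for n
  proof -
    obtain k f where f: "n \<le> k" "f \<in> Lp_space p M" "(LINT x|M. \<bar>f x\<bar> powr r) \<le> B"
        "e < \<bar>F (\<lambda>x. indicator (T k) x * f x)\<bar>"
      using neg by (meson not_le)
    have "eventually (\<lambda>m. \<bar>F (\<lambda>x. indicator (T m) x * f x)\<bar> < e / 2) sequentially"
      using tendstoD[OF Lp_functional_vanishing_tail[OF F T f(2)], of "e / 2"] \<open>0 < e\<close> by simp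
    then obtain m0 where m0: "\<And>m. m0 \<le> m \<Longrightarrow> \<bar>F (\<lambda>x. indicator (T m) x * f x)\<bar> < e / 2"
      by (auto simp: eventually_sequentially)
    define m where "m = max m0 (Suc k)"
    have m: "k < m" "\<bar>F (\<lambda>x. indicator (T m) x * f x)\<bar> < e / 2"
      using m0[of m] by (auto simp: m_def)
    have sub: "T m \<subseteq> T k" using T(2) m(1) by (auto simp: decseq_def)
    have "(\<lambda>x. indicator (D k m) x * f x) = (\<lambda>x. indicator (T k) x * f x - indicator (T m) x * f x)"
      using sub by (auto simp: D_def indicator_def fun_eq_iff)
    then have "F (\<lambda>x. indicator (D k m) x * f x) = F (\<lambda>x. indicator (T k) x * f x) - F (\<lambda>x. indicator (T m) x * f x)"
      using Lp_functional_diff[OF F Lp_indicator_mult[OF f(2) T(1)] Lp_indicator_mult[OF f(2) T(1)]] by simp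
    then have *: "e / 2 \<le> \<bar>F (\<lambda>x. indicator (D k m) x * f x)\<bar>" using f(4) m(2) by linarith
    \<comment> \<open>Flipping the sign makes the value positive, so that values on different bands
      add up.\<close>
    define f' where "f' = (\<lambda>x. sgn (F (\<lambda>x. indicator (D k m) x * f x)) * f x)"
    have f': "f' \<in> Lp_space p M" unfolding f'_def by (rule Lp_cmult[OF f(2)])
    have "(LINT x|M. \<bar>f' x\<bar> powr r) \<le> B"
      using f(3) * \<open>0 < e\<close> by (simp add: f'_def abs_mult sgn_real_def)
    moreover
    have "F (\<lambda>x. indicator (D k m) x * f' x) = \<bar>F (\<lambda>x. indicator (D k m) x * f x)\<bar>"
    proof -
      have "F (\<lambda>x. indicator (D k m) x * f' x) = F (\<lambda>x. sgn (F (\<lambda>x. indicator (D k m) x * f x)) * (indicator (D k m) x * f x))"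
        by (simp add: f'_def mult_ac)
      also have "\<dots> = sgn (F (\<lambda>x. indicator (D k m) x * f x)) * F (\<lambda>x. indicator (D k m) x * f x)"
        by (rule Lp_functional_cmult[OF F Lp_indicator_mult[OF f(2)]]) simp
      also have "\<dots> = \<bar>F (\<lambda>x. indicator (D k m) x * f x)\<bar>" by (simp add: abs_sgn mult.commute)
      finally show ?thesis .
    qed
    ultimately show ?thesis using * f' m(1) f(1) by (intro exI[of _ k] exI[of _ m] exI[of _ f']) (simp add: Q_def)
  qed
  then obtain kk mm ff where "\<And>n. Q n (kk n) (mm n) (ff n)" by metis
  then have
     km: "\<And>n. n \<le> kk n" "\<And>n. kk n < mm n" and ff: "\<And>n. ff n \<in> Lp_space p M"
       "\<And>n. (LINT x|M. \<bar>ff n x\<bar> powr r) \<le> B" "\<And>n. e / 2 \<le> F (\<lambda>x. indicator (D (kk n) (mm n)) x * ff n x)"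
    unfolding Q_def by blast+
  \<comment> \<open>The next band is sought beyond the end \<open>mm (q j)\<close> of the current
    one, which makes the bands disjoint.\<close>
  define q where "q = rec_nat 0 (\<lambda>_ n. mm n)"
  have qS: "q (Suc j) = mm (q j)" for j by (simp add: q_def)
  define \<phi> where "\<phi> j x = indicator (D (kk (q j)) (mm (q j))) x * ff (q j) x" for j x
  have \<phi>L: "\<phi> j \<in> Lp_space p M" for j
    unfolding \<phi>_def by (intro Lp_indicator_mult ff) auto
  have \<phi>B: "(LINT x|M. \<bar>\<phi> j x\<bar> powr r) \<le> B" for j
  proof -
    have "(LINT x|M. \<bar>\<phi> j x\<bar> powr r) \<le> (LINT x|M. \<bar>ff (q j) x\<bar> powr r)"
      using \<phi>L[of j] ff(1)[of "q j"] by (intro integral_mono) (auto simp: mem_Lp \<phi>_def indicator_def)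
    then show ?thesis using ff(2)[of "q j"] by simp
  qed
  define S where "S j x = (\<Sum>i<j. \<phi> i x)" for j x
  have S_supp: "S j x = 0" if "x \<in> T (q j)" for j x
    using that
  proof (induction j)
    case (Suc j)
    have "q j \<le> mm (q j)" using km(1)[of "q j"] km(2)[of "q j"] by simp
    then have "x \<in> T (q j)" using Suc.prems T(2) by (auto simp: qS decseq_def)
    then show ?case using Suc by (simp add: S_def \<phi>_def D_def qS)
  qed (simp add: S_def)
  have \<phi>_supp: "x \<in> T (q j)" if "\<phi> j x \<noteq> 0" for j x
  proof -
    have "x \<in> T (kk (q j))" using that by (auto simp: \<phi>_def D_def indicator_def split: if_splits)
    then show ?thesis using T(2) km(1)[of "q j"] by (auto simp: decseq_def)
  qed
  have S: "S j \<in> Lp_space p M \<and> real j * (e / 2) \<le> F (S j) \<and> (LINT x|M. \<bar>S j x\<bar> powr r) \<le> real j * B" for j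
  proof (induction j)
    case 0
    show ?case using Lp_functional_zero[OF F] Lp_bounded[of "\<lambda>x. 0" 0] by (simp add: S_def[abs_def])
  next
    case (Suc j)
    have eq: "S (Suc j) = (\<lambda>x. S j x + \<phi> j x)" by (simp add: S_def fun_eq_iff)
    have "F (S (Suc j)) = F (S j) + F (\<phi> j)"
      unfolding eq using Suc \<phi>L[of j] by (intro Lp_functional_add[OF F]) auto
    moreover have "e / 2 \<le> F (\<phi> j)" using ff(3)[of "q j"] by (simp add: \<phi>_def[abs_def])
    moreover have "(LINT x|M. \<bar>S (Suc j) x\<bar> powr r) = (LINT x|M. \<bar>S j x\<bar> powr r + \<bar>\<phi> j x\<bar> powr r)"
    proof (intro Bochner_Integration.integral_cong refl)
      fix x
      have "S j x = 0 \<or> \<phi> j x = 0" using S_supp[of x j] \<phi>_supp[of j x] by blast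
      then show "\<bar>S (Suc j) x\<bar> powr r = \<bar>S j x\<bar> powr r + \<bar>\<phi> j x\<bar> powr r" by (auto simp: eq)
    qed
    moreover have "\<dots> = (LINT x|M. \<bar>S j x\<bar> powr r) + (LINT x|M. \<bar>\<phi> j x\<bar> powr r)"
      using Suc \<phi>L[of j] by (intro Bochner_Integration.integral_add) (auto simp: mem_Lp)
    ultimately show ?case
      using Suc \<phi>B[of j] \<phi>L[of j] by (auto simp: eq Lp_add algebra_simps)
  qed
  obtain C where C: "0 < C" "\<And>f. f \<in> Lp_space p M \<Longrightarrow> \<bar>F f\<bar> \<le> C * Lp_norm p M f"
    using Lp_functional_bound[OF F] by blast
  have "0 \<le> (LINT x|M. \<bar>ff 0 x\<bar> powr r)" by (intro integral_nonneg_AE) auto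
  then have B0: "0 \<le> B" using ff(2)[of 0] by linarith
  \<comment> \<open>For \<open>n\<close> summands, dividing
    \<open>n * (e / 2) \<le> C * (n * B) powr (1 / r)\<close> by \<open>n powr (1 / r)\<close>
    leaves \<open>n powr (1 - 1 / r) \<le> c\<close>.\<close>
  define c where "c = 2 * C * B powr (1 / r) / e"
  have bound: "real (Suc j) powr (1 - 1 / r) \<le> c" for j
  proof -
    let ?n = "real (Suc j)"
    have "?n * (e / 2) \<le> C * Lp_norm p M (S (Suc j))"
      using S[of "Suc j"] C(2)[of "S (Suc j)"] by linarith
    also have "Lp_norm p M (S (Suc j)) \<le> (?n * B) powr (1 / r)"
      unfolding Lp_norm_eq using S[of "Suc j"] r by (intro powr_mono2) (auto intro!: integral_nonneg_AE)
    finally have "?n * (e / 2) \<le> C * (?n powr (1 / r) * B powr (1 / r))"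
      using C(1) B0 by (simp add: powr_mult)
    moreover have "?n powr (1 - 1 / r) * ?n powr (1 / r) = ?n"
      by (simp flip: powr_add)
    ultimately have "?n powr (1 / r) * (?n powr (1 - 1 / r) * (e / 2)) \<le> ?n powr (1 / r) * (C * B powr (1 / r))"
      by (simp add: mult_ac)
    then have "?n powr (1 - 1 / r) * (e / 2) \<le> C * B powr (1 / r)"
      by (rule mult_left_le_imp_le) simp
    then show ?thesis using \<open>0 < e\<close> by (simp add: c_def field_simps)
  qed
  define a where "a = 1 - 1 / r"
  have "0 < a" using r by (simp add: a_def)
  have "real (Suc j) \<le> c powr (1 / a)" for j
  proof -
    have "(real (Suc j) powr a) powr (1 / a) \<le> c powr (1 / a)"
      using bound[of j] \<open>0 < a\<close> by (intro powr_mono2) (auto simp: a_def)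
    then show ?thesis using \<open>0 < a\<close> by (simp add: powr_powr)
  qed
  moreover obtain j where "c powr (1 / a) < real j" using reals_Archimedean2 by blast
  ultimately show False by (metis le_less_trans lessI less_asym of_nat_less_iff)
qed

text \<open>The hypotheses on \<open>w\<close> serve three pieces: \<open>conv\<close> the part
  where the density is at most \<open>N\<close>, \<open>B\<close> the tail for \<open>r > 1\<close>,
  and \<open>UI\<close> the tail for \<open>r = 1\<close>, where counting disjoint bands gives no
  contradiction.\<close>

lemma Lp_functional_tendsto:
  assumes w: "\<And>n. w n \<in> Lp_space p M" and w0: "w0 \<in> Lp_space p M"
    and B: "\<And>n. (LINT x|M. \<bar>w n x\<bar> powr r) \<le> B"
    and UI: "\<And>e. 0 < e \<Longrightarrow> \<exists>d>0. \<forall>n. \<forall>E\<in>sets M. measure M E < d \<longrightarrow> (LINT x|M. indicator E x * \<bar>w n x\<bar>) < e"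
    and conv: "\<And>g K. g \<in> borel_measurable M \<Longrightarrow> (\<And>x. \<bar>g x\<bar> \<le> K) \<Longrightarrow>
      (\<lambda>n. LINT x|M. w n x * g x) \<longlonglongrightarrow> (LINT x|M. w0 x * g x)"
    and F: "Lp_functional p M F"
  shows "(\<lambda>n. F (w n)) \<longlonglongrightarrow> F w0"
proof -
  obtain g where g: "integrable M g" and F_ind: "\<And>A. A \<in> sets M \<Longrightarrow> F (indicator A) = (LINT x|M. indicator A x * g x)"
    using Lp_functional_density[OF F] by blast
  have gm[measurable]: "g \<in> borel_measurable M" using g by auto
  define T where "T n = {x \<in> space M. real n < \<bar>g x\<bar>}" for n
  have Tm[measurable]: "T n \<in> sets M" for n unfolding T_def by measurable
  \<comment> \<open>The density is real valued, so every point eventually leaves the sets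
    \<open>T n\<close>.\<close>
  have "\<exists>n. x \<notin> T n" for x
    using real_arch_simple[of "\<bar>g x\<bar>"] by (auto simp: T_def not_less)
  then have T: "decseq T" "(\<Inter>n. T n) = {}"
    by (auto simp: T_def decseq_def)
  have tail: "\<exists>N. (\<forall>n. \<bar>F (\<lambda>x. indicator (T N) x * w n x)\<bar> \<le> e) \<and> \<bar>F (\<lambda>x. indicator (T N) x * w0 x)\<bar> \<le> e" if e: "0 < e" for e
  proof -
    have "eventually (\<lambda>N. \<bar>F (\<lambda>x. indicator (T N) x * w0 x)\<bar> < e) sequentially"
      using tendstoD[OF Lp_functional_vanishing_tail[OF F Tm T w0] e] by simp
    then obtain N0 where N0: "\<And>N. N0 \<le> N \<Longrightarrow> \<bar>F (\<lambda>x. indicator (T N) x * w0 x)\<bar> < e"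
      by (auto simp: eventually_sequentially)
    have "\<exists>N1. \<forall>N\<ge>N1. \<forall>n. \<bar>F (\<lambda>x. indicator (T N) x * w n x)\<bar> \<le> e"
    proof (cases "1 < r")
      case True
      then show ?thesis
        using Lp_functional_uniformly_vanishing_tail[OF F Tm T True e, of B] w B by blast
    next
      case False
      then have r1: "r = 1" using r_ge_1 by simp
      obtain C where C: "0 < C" "\<And>f. f \<in> Lp_space p M \<Longrightarrow> \<bar>F f\<bar> \<le> C * Lp_norm p M f"
        using Lp_functional_bound[OF F] by blast
      obtain d where d: "0 < d" "\<And>n E. E \<in> sets M \<Longrightarrow> measure M E < d \<Longrightarrow> (LINT x|M. indicator E x * \<bar>w n x\<bar>) < e / C"
        using UI[of "e / C"] e C(1) by auto
      have "(\<lambda>N. measure M (T N)) \<longlonglongrightarrow> 0"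
        using finite_Lim_measure_decseq[of T] T Tm by (simp add: image_subset_iff)
      then have "eventually (\<lambda>N. measure M (T N) < d) sequentially"
        by (rule order_tendstoD(2)) fact
      then obtain N1 where N1: "\<And>N. N1 \<le> N \<Longrightarrow> measure M (T N) < d"
        by (auto simp: eventually_sequentially)
      have "\<bar>F (\<lambda>x. indicator (T N) x * w n x)\<bar> \<le> e" if "N1 \<le> N" for N n
      proof -
        have "Lp_norm p M (\<lambda>x. indicator (T N) x * w n x) = (LINT x|M. indicator (T N) x * \<bar>w n x\<bar>)"
          by (simp add: Lp_norm_eq r1 abs_mult integral_nonneg_AE)
        also have "\<dots> < e / C" using d(2)[OF Tm N1[OF that]] .
        finally have "C * Lp_norm p M (\<lambda>x. indicator (T N) x * w n x) \<le> e"
          using C(1) by (simp add: field_simps)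
        then show ?thesis using C(2)[OF Lp_indicator_mult[OF w Tm]] by (rule order_trans[rotated])
      qed
      then show ?thesis by blast
    qed
    then obtain N1 where N1: "\<And>N n. N1 \<le> N \<Longrightarrow> \<bar>F (\<lambda>x. indicator (T N) x * w n x)\<bar> \<le> e" by blast
    show ?thesis using N0[of "max N0 N1"] N1[of "max N0 N1"] by (intro exI[of _ "max N0 N1"]) auto
  qed
  have split: "F f = (LINT x|M. f x * (indicator (space M - T N) x * g x)) + F (\<lambda>x. indicator (T N) x * f x)"
    if f: "f \<in> Lp_space p M" for f N
  proof -
    have "F f = F (\<lambda>x. indicator (space M - T N) x * f x + indicator (T N) x * f x)"
    proof (rule Lp_functional_cong[OF F f])
      show "(\<lambda>x. indicator (space M - T N) x * f x + indicator (T N) x * f x) \<in> Lp_space p M"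
        by (intro Lp_add Lp_indicator_mult f) auto
    qed (auto simp: indicator_def)
    also have "\<dots> = F (\<lambda>x. indicator (space M - T N) x * f x) + F (\<lambda>x. indicator (T N) x * f x)"
      using f by (intro Lp_functional_add[OF F] Lp_indicator_mult) auto
    also have "F (\<lambda>x. indicator (space M - T N) x * f x) = (LINT x|M. f x * (indicator (space M - T N) x * g x))"
      by (rule Lp_functional_truncated_representation[OF F g F_ind _ _ f, where K = "real N"]) (auto simp: T_def)
    finally show ?thesis .
  qed
  show ?thesis
  proof (rule LIMSEQ_I)
    fix e :: real assume "0 < e"
    then obtain N where N: "\<And>n. \<bar>F (\<lambda>x. indicator (T N) x * w n x)\<bar> \<le> e / 4"
        "\<bar>F (\<lambda>x. indicator (T N) x * w0 x)\<bar> \<le> e / 4"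
      using tail[of "e / 4"] by auto
    have "(\<lambda>n. LINT x|M. w n x * (indicator (space M - T N) x * g x)) \<longlonglongrightarrow> (LINT x|M. w0 x * (indicator (space M - T N) x * g x))"
      by (rule conv[where K = "real N"]) (auto simp: indicator_def T_def)
    then obtain no where no: "\<And>n. no \<le> n \<Longrightarrow> \<bar>(LINT x|M. w n x * (indicator (space M - T N) x * g x)) - (LINT x|M. w0 x * (indicator (space M - T N) x * g x))\<bar> < e / 4"
      using LIMSEQ_D[where r = "e / 4"] \<open>0 < e\<close> by fastforce
    show "\<exists>no. \<forall>n\<ge>no. norm (F (w n) - F w0) < e"
    proof (intro exI[of _ no] allI impI)
      fix n assume "no \<le> n"
      then show "norm (F (w n) - F w0) < e"
        using no[of n] N(1)[of n] N(2) split[OF w, of n N] split[OF w0, of N] \<open>0 < e\<close> unfolding real_norm_def by linarith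
    qed
  qed
qed

end

text \<open>Here the sequence is bounded and the test function is not, so the truncation falls on
  \<open>f\<close>: its part above \<open>N\<close> pairs with every \<open>w n\<close> to at most
  \<open>\<bar>K\<bar>\<close> times a small L^1 norm.\<close>

lemma (in finite_measure) integral_mult_tendsto_of_bounded:
  fixes w :: "nat \<Rightarrow> 'a \<Rightarrow> real" and w0 f :: "'a \<Rightarrow> real"
  assumes wm: "\<And>n. w n \<in> borel_measurable M" and w0: "integrable M (\<lambda>x. w0 x * f x)"
    and K: "\<And>n. AE x in M. \<bar>w n x\<bar> \<le> K"
    and f: "integrable M f"
    and conv: "\<And>g C. g \<in> borel_measurable M \<Longrightarrow> (\<And>x. \<bar>g x\<bar> \<le> C) \<Longrightarrow>
      (\<lambda>n. LINT x|M. w n x * g x) \<longlonglongrightarrow> (LINT x|M. w0 x * g x)"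
  shows "(\<lambda>n. LINT x|M. w n x * f x) \<longlonglongrightarrow> (LINT x|M. w0 x * f x)"
proof (rule LIMSEQ_I)
  fix e :: real assume e: "0 < e"
  have fm[measurable]: "f \<in> borel_measurable M" using f by auto
  note [measurable] = wm
  define T where "T N = {x \<in> space M. real N < \<bar>f x\<bar>}" for N
  have Tm[measurable]: "T n \<in> sets M" for n unfolding T_def by measurable
  have i: "integrable M (\<lambda>x. indicator (T N) x * f x)" for N
    using f by (rule Bochner_Integration.integrable_bound) (auto simp: indicator_def)
  have iw0: "integrable M (\<lambda>x. indicator A x * (w0 x * f x))" if "A \<in> sets M" for A
    by (rule Bochner_Integration.integrable_bound[OF w0]) (use that w0 in \<open>auto simp: indicator_def\<close>)
  have iw: "integrable M (\<lambda>x. w n x * h x) \<and> \<bar>LINT x|M. w n x * h x\<bar> \<le> \<bar>K\<bar> * (LINT x|M. \<bar>h x\<bar>)" if h: "integrable M h" for n h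
  proof -
    have [measurable]: "h \<in> borel_measurable M" using h by auto
    have ae: "AE x in M. \<bar>w n x * h x\<bar> \<le> \<bar>K\<bar> * \<bar>h x\<bar>"
      using K[of n] by eventually_elim (auto simp: abs_mult intro!: mult_right_mono)
    have i1: "integrable M (\<lambda>x. \<bar>K\<bar> * \<bar>h x\<bar>)" using h by simp
    have i2: "integrable M (\<lambda>x. w n x * h x)"
      by (rule Bochner_Integration.integrable_bound[OF i1]) (use ae in auto)
    have "\<bar>LINT x|M. w n x * h x\<bar> \<le> (LINT x|M. \<bar>w n x * h x\<bar>)" by (rule integral_abs_bound)
    also have "\<dots> \<le> (LINT x|M. \<bar>K\<bar> * \<bar>h x\<bar>)" using i1 i2 ae by (intro integral_mono_AE) auto
    finally show ?thesis using i2 by simp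
  qed
  have "eventually (\<lambda>N. \<bar>LINT x|M. indicator (T N) x * (w0 x * f x)\<bar> < e / 4) sequentially"
    using tendstoD[OF tendsto_integral_tail[OF w0 fm], of "e / 4"] e by (simp add: T_def)
  \<comment> \<open>Dividing by \<open>\<bar>K\<bar> + 1\<close> rather than
    \<open>\<bar>K\<bar>\<close> keeps the threshold positive when \<open>K = 0\<close>.\<close>
  moreover have "eventually (\<lambda>N. (LINT x|M. indicator (T N) x * \<bar>f x\<bar>) < e / (4 * (\<bar>K\<bar> + 1))) sequentially"
    unfolding T_def using tendsto_integral_tail[OF integrable_abs[OF f] fm] e by (intro order_tendstoD(2)) auto
  ultimately have "\<exists>N. \<bar>LINT x|M. indicator (T N) x * (w0 x * f x)\<bar> < e / 4 \<and>
      (LINT x|M. indicator (T N) x * \<bar>f x\<bar>) < e / (4 * (\<bar>K\<bar> + 1))"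
    by (intro eventually_happens'[OF sequentially_bot] eventually_conj)
  then obtain N where N: "\<bar>LINT x|M. indicator (T N) x * (w0 x * f x)\<bar> < e / 4"
      "(LINT x|M. indicator (T N) x * \<bar>f x\<bar>) < e / (4 * (\<bar>K\<bar> + 1))"
    by blast
  have tail: "\<bar>LINT x|M. w n x * (indicator (T N) x * f x)\<bar> \<le> e / 4" for n
  proof -
    have "\<bar>LINT x|M. w n x * (indicator (T N) x * f x)\<bar> \<le> \<bar>K\<bar> * (LINT x|M. indicator (T N) x * \<bar>f x\<bar>)"
      using iw[OF i[of N], of n] by (simp add: abs_mult)
    also have "\<dots> \<le> (\<bar>K\<bar> + 1) * (e / (4 * (\<bar>K\<bar> + 1)))"
      using N(2) by (intro mult_mono) (auto intro!: integral_nonneg_AE)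
    also have "\<dots> = e / 4"
    proof -
      have *: "k * (e / (4 * k)) = e / 4" if "0 < k" for k :: real using that by simp
      show ?thesis by (rule *) (simp add: add_nonneg_pos)
    qed
    finally show ?thesis .
  qed
  let ?g = "\<lambda>x. indicator (space M - T N) x * f x"
  have i': "integrable M ?g" using f by (rule Bochner_Integration.integrable_bound) (auto simp: indicator_def)
  have split_w: "(LINT x|M. w n x * f x) = (LINT x|M. w n x * ?g x) + (LINT x|M. w n x * (indicator (T N) x * f x))" for n
  proof -
    have "(LINT x|M. w n x * f x) = (LINT x|M. w n x * ?g x + w n x * (indicator (T N) x * f x))"
      by (intro Bochner_Integration.integral_cong) (auto simp: indicator_def)
    also have "\<dots> = (LINT x|M. w n x * ?g x) + (LINT x|M. w n x * (indicator (T N) x * f x))"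
      using iw[OF i'] iw[OF i] by (intro Bochner_Integration.integral_add) blast+
    finally show ?thesis .
  qed
  have "(LINT x|M. w0 x * f x) = (LINT x|M. indicator (space M - T N) x * (w0 x * f x) + indicator (T N) x * (w0 x * f x))"
    by (intro Bochner_Integration.integral_cong) (auto simp: indicator_def)
  also have "\<dots> = (LINT x|M. indicator (space M - T N) x * (w0 x * f x)) + (LINT x|M. indicator (T N) x * (w0 x * f x))"
    using iw0 by (intro Bochner_Integration.integral_add) auto
  finally have "(LINT x|M. w0 x * f x) = (LINT x|M. indicator (space M - T N) x * (w0 x * f x)) + (LINT x|M. indicator (T N) x * (w0 x * f x))" .
  then have split_w0: "(LINT x|M. w0 x * f x) = (LINT x|M. w0 x * ?g x) + (LINT x|M. indicator (T N) x * (w0 x * f x))"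
    by (simp add: mult_ac)
  have "(\<lambda>n. LINT x|M. w n x * ?g x) \<longlonglongrightarrow> (LINT x|M. w0 x * ?g x)"
    by (rule conv[where C = "real N"]) (auto simp: indicator_def T_def)
  then obtain no where no: "\<And>n. no \<le> n \<Longrightarrow> \<bar>(LINT x|M. w n x * ?g x) - (LINT x|M. w0 x * ?g x)\<bar> < e / 4"
    using LIMSEQ_D[where r = "e / 4"] e by fastforce
  show "\<exists>no. \<forall>n\<ge>no. norm ((LINT x|M. w n x * f x) - (LINT x|M. w0 x * f x)) < e"
  proof (intro exI[of _ no] allI impI)
    fix n assume "no \<le> n"
    then show "norm ((LINT x|M. w n x * f x) - (LINT x|M. w0 x * f x)) < e"
      using no[of n] N(1) tail[of n] split_w[of n] split_w0 e unfolding real_norm_def by linarith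
  qed
qed

section \<open>Dilations of periodic functions\<close>

lemma affine_euclidean_scaleR:
  fixes x t :: "'a::euclidean_space"
  shows "t + (\<Sum>j\<in>Basis. (c * (x \<bullet> j)) *\<^sub>R j) = t + c *\<^sub>R x"
  by (simp add: scaleR_sum_right[symmetric] euclidean_representation scaleR_scaleR[symmetric] del: scaleR_scaleR)

lemma lebesgue_affine_scaleR:
  fixes t :: "'a::euclidean_space"
  assumes "c \<noteq> 0"
  shows "lebesgue = density (distr lebesgue lebesgue (\<lambda>x. t + c *\<^sub>R x)) (\<lambda>_. ennreal (\<bar>c\<bar> ^ DIM('a)))"
    and "(\<lambda>x. t + c *\<^sub>R x) \<in> lebesgue \<rightarrow>\<^sub>M lebesgue"
  using lebesgue_affine_euclidean[of "\<lambda>_. c" t] lebesgue_affine_measurable[of "\<lambda>_. c" t] assms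
  by (simp_all add: affine_euclidean_scaleR)

lemma nn_integral_lebesgue_affine:
  fixes f :: "'a::euclidean_space \<Rightarrow> ennreal"
  assumes [measurable]: "f \<in> borel_measurable lebesgue" and c: "c \<noteq> 0"
  shows "(\<integral>\<^sup>+x. f x \<partial>lebesgue) = ennreal (\<bar>c\<bar> ^ DIM('a)) * (\<integral>\<^sup>+x. f (t + c *\<^sub>R x) \<partial>lebesgue)"
proof -
  note [measurable] = lebesgue_affine_scaleR(2)[OF c, of t]
  have "(\<integral>\<^sup>+x. f x \<partial>lebesgue)
      = (\<integral>\<^sup>+x. f x \<partial>density (distr lebesgue lebesgue (\<lambda>x. t + c *\<^sub>R x)) (\<lambda>_. ennreal (\<bar>c\<bar> ^ DIM('a))))"
    by (subst lebesgue_affine_scaleR(1)[OF c, of t]) (rule refl)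
  also have "\<dots> = ennreal (\<bar>c\<bar> ^ DIM('a)) * (\<integral>\<^sup>+x. f (t + c *\<^sub>R x) \<partial>lebesgue)"
    by (simp add: nn_integral_density nn_integral_distr nn_integral_cmult)
  finally show ?thesis .
qed

lemma AE_lebesgue_affine:
  fixes t :: "'a::euclidean_space"
  assumes c: "c \<noteq> 0" and P: "AE x in lebesgue. P x"
  shows "AE x in lebesgue. P (t + c *\<^sub>R x)"
proof -
  note [measurable] = lebesgue_affine_scaleR(2)[OF c, of t]
  have "AE x in density (distr lebesgue lebesgue (\<lambda>x. t + c *\<^sub>R x)) (\<lambda>_. ennreal (\<bar>c\<bar> ^ DIM('a))). P x"
    using P by (subst lebesgue_affine_scaleR(1)[OF c, of t, symmetric])
  then have "AE x in distr lebesgue lebesgue (\<lambda>x. t + c *\<^sub>R x). P x"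
    using c by (simp add: AE_density)
  then show ?thesis by (rule AE_distrD[rotated]) measurable
qed

lemma AE_lebesgue_translate:
  fixes t :: "'a::euclidean_space"
  assumes "AE x in lebesgue. P x"
  shows "AE x in lebesgue. P (x + t)"
  using AE_lebesgue_affine[OF _ assms, of 1 t] by (simp add: add.commute)

text \<open>The vectors \<open>t\<close> with \<open>f (x + t) = f x\<close> almost everywhere form
  a group, because null sets are translation invariant, and the coordinate periods generate the
  lattice.\<close>

lemma AE_period_lattice:
  fixes f :: "real ^ 'n \<Rightarrow> 'b" and l :: "real ^ 'n"
  assumes per: "\<And>j. AE x in lebesgue. f (x + (l $ j) *\<^sub>R axis j 1) = f x"
  shows "AE x in lebesgue. f (x + (\<chi> j. of_int (k j) * l $ j)) = f x"
proof -
  define P where "P t \<longleftrightarrow> (AE x in lebesgue. f (x + t) = f x)" for t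
  have P0: "P 0" by (simp add: P_def)
  have P_add: "P (s + t)" if "P s" "P t" for s t
    using that(1) AE_lebesgue_translate[OF that(2)[unfolded P_def], of s] unfolding P_def
    by eventually_elim (simp add: add.assoc)
  have P_neg: "P (- t)" if "P t" for t
    using AE_lebesgue_translate[OF that[unfolded P_def], of "-t"] unfolding P_def
    by eventually_elim simp
  have P_int: "P (of_int m *\<^sub>R t)" if "P t" for m :: int and t
  proof (induction m rule: int_induct[where k = 0])
    case (step1 i)
    then show ?case using P_add[OF step1(2) \<open>P t\<close>] by (simp add: algebra_simps)
  next
    case (step2 i)
    then show ?case using P_add[OF step2(2) P_neg[OF \<open>P t\<close>]] by (simp add: algebra_simps)
  qed (simp add: P0)
  have "P (\<Sum>j\<in>J. of_int (k j) *\<^sub>R ((l $ j) *\<^sub>R axis j 1))" if "finite J" for J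
    using that
  proof (induction J rule: finite_induct)
    case (insert j J)
    then show ?case using P_add P_int[of "(l $ j) *\<^sub>R axis j 1" "k j"] per[of j] by (simp add: P_def)
  qed (simp add: P0)
  from this[of UNIV] have "P (\<Sum>j\<in>UNIV. of_int (k j) *\<^sub>R ((l $ j) *\<^sub>R axis j 1))" by simp
  moreover have "(\<Sum>j\<in>UNIV. of_int (k j) *\<^sub>R ((l $ j) *\<^sub>R axis j 1)) = (\<chi> j. of_int (k j) * l $ j)"
    by (simp add: vec_eq_iff axis_def if_distrib if_distribR cong: if_cong)
  ultimately show ?thesis by (simp add: P_def)
qed

text \<open>Translates of the half-open cell cover each point exactly once, so a factor 1 can be
  inserted as a sum over the lattice; after exchanging sum and integral each term is shifted back to
  the cell, and periodicity removes the shift from \<open>f\<close>. The sum is an integral over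
  \<open>count_space\<close>, so the exchange is Tonelli's theorem in [0, infinity].\<close>

lemma nn_integral_unfold_lattice:
  fixes f G :: "real ^ 'n \<Rightarrow> ennreal" and l a :: "real ^ 'n"
  assumes f[measurable]: "f \<in> borel_measurable lebesgue" and G[measurable]: "G \<in> borel_measurable lebesgue"
    and per: "\<And>j. AE x in lebesgue. f (x + (l $ j) *\<^sub>R axis j 1) = f x"
    and l: "\<And>j. 0 < l $ j"
  shows "(\<integral>\<^sup>+x. f x * G x \<partial>lebesgue) =
    (\<integral>\<^sup>+x. f x * indicator {x. \<forall>j. a $ j \<le> x $ j \<and> x $ j < a $ j + l $ j} x
        * (\<integral>\<^sup>+k. G (x + (\<chi> j. of_int (k j) * l $ j)) \<partial>count_space UNIV) \<partial>lebesgue)"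
proof -
  define Y where "Y = {x. \<forall>j. a $ j \<le> x $ j \<and> x $ j < a $ j + l $ j}"
  define L where "L k = (\<chi> j. of_int (k j) * l $ j)" for k :: "'n \<Rightarrow> int"
  have "Y \<in> sets borel" unfolding Y_def by measurable
  then have [measurable]: "Y \<in> sets lebesgue" by auto
  have tr: "(\<lambda>x. x + t) \<in> lebesgue \<rightarrow>\<^sub>M lebesgue" for t :: "real ^ 'n"
    using lebesgue_affine_scaleR(2)[of 1 t] by (simp add: add.commute)
  have [measurable]: "(\<lambda>x. F (x + t)) \<in> borel_measurable lebesgue"
    if "F \<in> borel_measurable lebesgue" for F :: "real ^ 'n \<Rightarrow> ennreal" and t
    using measurable_compose[OF tr that] .
  have [measurable]: "(\<lambda>x. F (x - t)) \<in> borel_measurable lebesgue"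
    if "F \<in> borel_measurable lebesgue" for F :: "real ^ 'n \<Rightarrow> ennreal" and t
    using measurable_compose[OF tr[of "-t"] that] by simp
  have indY[measurable]: "(indicator Y :: _ \<Rightarrow> ennreal) \<in> borel_measurable lebesgue" by measurable
  \<comment> \<open>The translate containing \<open>x\<close> is found by rounding down in each
    coordinate.\<close>
  have one: "(\<integral>\<^sup>+k. indicator Y (x - L k) \<partial>count_space UNIV) = (1 :: ennreal)" for x
  proof -
    have "x - L k \<in> Y \<longleftrightarrow> k = (\<lambda>j. \<lfloor>(x $ j - a $ j) / l $ j\<rfloor>)" for k
    proof -
      have "a $ j \<le> x $ j - of_int m * l $ j \<and> x $ j - of_int m * l $ j < a $ j + l $ j
          \<longleftrightarrow> \<lfloor>(x $ j - a $ j) / l $ j\<rfloor> = m" for j and m :: int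
        using l[of j] by (simp add: floor_eq_iff field_simps)
      then show ?thesis by (auto simp: Y_def L_def fun_eq_iff)
    qed
    then have "indicator Y (x - L k) = (indicator {\<lambda>j. \<lfloor>(x $ j - a $ j) / l $ j\<rfloor>} k :: ennreal)" for k
      by (simp add: indicator_def)
    then show ?thesis by simp
  qed
  have "(\<integral>\<^sup>+x. f x * G x \<partial>lebesgue)
      = (\<integral>\<^sup>+x. (\<integral>\<^sup>+k. f x * G x * indicator Y (x - L k) \<partial>count_space UNIV) \<partial>lebesgue)"
    by (simp add: nn_integral_cmult one)
  also have "\<dots> = (\<integral>\<^sup>+k. (\<integral>\<^sup>+x. f x * G x * indicator Y (x - L k) \<partial>lebesgue) \<partial>count_space UNIV)"
    by (rule nn_integral_count_space_nn_integral) auto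
  also have "\<dots> = (\<integral>\<^sup>+k. (\<integral>\<^sup>+x. f x * indicator Y x * G (x + L k) \<partial>lebesgue) \<partial>count_space UNIV)"
  proof (rule nn_integral_cong)
    fix k
    have "(\<integral>\<^sup>+x. f x * G x * indicator Y (x - L k) \<partial>lebesgue)
        = (\<integral>\<^sup>+x. f (x + L k) * G (x + L k) * indicator Y x \<partial>lebesgue)"
      by (subst nn_integral_lebesgue_affine[where c = 1 and t = "L k"]) (auto simp: add.commute)
    also have "\<dots> = (\<integral>\<^sup>+x. f x * indicator Y x * G (x + L k) \<partial>lebesgue)"
      using AE_period_lattice[of f l k, OF per] unfolding L_def[symmetric]
      by (intro nn_integral_cong_AE) (auto simp: mult_ac elim!: eventually_mono)
    finally show "(\<integral>\<^sup>+x. f x * G x * indicator Y (x - L k) \<partial>lebesgue)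
        = (\<integral>\<^sup>+x. f x * indicator Y x * G (x + L k) \<partial>lebesgue)" .
  qed
  also have "\<dots> = (\<integral>\<^sup>+x. (\<integral>\<^sup>+k. f x * indicator Y x * G (x + L k) \<partial>count_space UNIV) \<partial>lebesgue)"
    by (rule nn_integral_count_space_nn_integral[symmetric]) auto
  also have "\<dots> = (\<integral>\<^sup>+x. f x * indicator Y x * (\<integral>\<^sup>+k. G (x + L k) \<partial>count_space UNIV) \<partial>lebesgue)"
    by (simp add: nn_integral_cmult)
  finally show ?thesis unfolding Y_def L_def .
qed

text \<open>Dividing by \<open>l\<close> gives a half-open interval, whose integers number a
  difference of two ceilings; that misses the length by less than 1.\<close>

lemma int_points_interval:
  fixes \<alpha> \<beta> y l :: real
  assumes "\<alpha> \<le> \<beta>" "0 < l"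
  shows "finite {m::int. \<alpha> \<le> y + of_int m * l \<and> y + of_int m * l < \<beta>}"
    and "\<bar>real (card {m::int. \<alpha> \<le> y + of_int m * l \<and> y + of_int m * l < \<beta>}) - (\<beta> - \<alpha>) / l\<bar> \<le> 1"
proof -
  have eq: "{m::int. \<alpha> \<le> y + of_int m * l \<and> y + of_int m * l < \<beta>} = {\<lceil>(\<alpha> - y) / l\<rceil> ..< \<lceil>(\<beta> - y) / l\<rceil>}"
  proof (intro set_eqI)
    fix m :: int
    have "\<alpha> \<le> y + of_int m * l \<longleftrightarrow> \<lceil>(\<alpha> - y) / l\<rceil> \<le> m" "y + of_int m * l < \<beta> \<longleftrightarrow> m < \<lceil>(\<beta> - y) / l\<rceil>"
      using \<open>0 < l\<close> by (auto simp: ceiling_le_iff less_ceiling_iff field_simps)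
    then show "m \<in> {m::int. \<alpha> \<le> y + of_int m * l \<and> y + of_int m * l < \<beta>} \<longleftrightarrow> m \<in> {\<lceil>(\<alpha> - y) / l\<rceil> ..< \<lceil>(\<beta> - y) / l\<rceil>}"
      by simp
  qed
  show "finite {m::int. \<alpha> \<le> y + of_int m * l \<and> y + of_int m * l < \<beta>}" by (simp add: eq)
  have "(\<alpha> - y) / l \<le> (\<beta> - y) / l" using assms by (intro divide_right_mono) auto
  then have "\<lceil>(\<alpha> - y) / l\<rceil> \<le> \<lceil>(\<beta> - y) / l\<rceil>" by (rule ceiling_mono)
  moreover have "(\<beta> - \<alpha>) / l = (\<beta> - y) / l - (\<alpha> - y) / l" by (simp add: diff_divide_distrib)
  ultimately show "\<bar>real (card {m::int. \<alpha> \<le> y + of_int m * l \<and> y + of_int m * l < \<beta>}) - (\<beta> - \<alpha>) / l\<bar> \<le> 1"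
    unfolding eq by simp linarith
qed

text \<open>With \<open>G\<close> the indicator of the dilated box, the inner sum of the unfolding
  counts the lattice translates of \<open>x\<close> lying in it: a product of coordinate counts,
  each within 1 of \<open>h * ((d $ j - c $ j) / l $ j)\<close>. Distributing the Jacobian over the
  factors turns the error 1 into \<open>1 / h\<close>. The \<open>max 0\<close> keeps the lower
  factors nonnegative, as monotonicity of the product requires when the dilated box is narrower than
  a period.\<close>

lemma nn_integral_dilate_periodic_halfopen:
  fixes f :: "real ^ 'n \<Rightarrow> ennreal" and l a c d :: "real ^ 'n" and h :: real
  assumes f[measurable]: "f \<in> borel_measurable lebesgue"
    and per: "\<And>j. AE x in lebesgue. f (x + (l $ j) *\<^sub>R axis j 1) = f x"
    and l: "\<And>j. 0 < l $ j" and cd: "\<And>j. c $ j \<le> d $ j" and h: "0 < h"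
  defines "I \<equiv> (\<integral>\<^sup>+x. f x * indicator {x. \<forall>j. a $ j \<le> x $ j \<and> x $ j < a $ j + l $ j} x \<partial>lebesgue)"
    and "K \<equiv> (\<integral>\<^sup>+x. f (h *\<^sub>R x) * indicator {x. \<forall>j. c $ j \<le> x $ j \<and> x $ j < d $ j} x \<partial>lebesgue)"
  shows "K \<le> ennreal (\<Prod>j\<in>UNIV. (d $ j - c $ j) / l $ j + 1 / h) * I"
    and "ennreal (\<Prod>j\<in>UNIV. max 0 ((d $ j - c $ j) / l $ j - 1 / h)) * I \<le> K"
proof -
  define Y where "Y = {x. \<forall>j. a $ j \<le> x $ j \<and> x $ j < a $ j + l $ j}"
  define Q where "Q = {x. \<forall>j. c $ j \<le> x $ j \<and> x $ j < d $ j}"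
  have "Y \<in> sets borel" "Q \<in> sets borel" unfolding Y_def Q_def by measurable
  then have [measurable]: "Y \<in> sets lebesgue" "Q \<in> sets lebesgue" by auto
  define G :: "real ^ 'n \<Rightarrow> ennreal" where "G x = indicator Q ((1 / h) *\<^sub>R x)" for x
  have G[measurable]: "G \<in> borel_measurable lebesgue"
    unfolding G_def by measurable
  define N where "N y j = card {m::int. h * c $ j \<le> y $ j + of_int m * l $ j \<and> y $ j + of_int m * l $ j < h * d $ j}" for y j
  have count: "(\<integral>\<^sup>+k. G (y + (\<chi> j. of_int (k j) * l $ j)) \<partial>count_space UNIV) = ennreal (\<Prod>j\<in>UNIV. real (N y j))" for y
  proof -
    let ?S = "\<lambda>j. {m::int. h * c $ j \<le> y $ j + of_int m * l $ j \<and> y $ j + of_int m * l $ j < h * d $ j}"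
    have fin: "finite (?S j)" for j
      using cd[of j] l[of j] h by (intro int_points_interval) auto
    have "G (y + (\<chi> j. of_int (k j) * l $ j)) = indicator (Pi\<^sub>E UNIV ?S) k" for k
      using h by (auto simp: G_def Q_def indicator_def PiE_iff field_simps)
    then have "(\<integral>\<^sup>+k. G (y + (\<chi> j. of_int (k j) * l $ j)) \<partial>count_space UNIV) = emeasure (count_space UNIV) (Pi\<^sub>E UNIV ?S)"
      by simp
    also have "\<dots> = of_nat (card (Pi\<^sub>E UNIV ?S))"
      using fin by (intro emeasure_count_space_finite) (auto intro!: finite_PiE)
    also have "\<dots> = ennreal (\<Prod>j\<in>UNIV. real (N y j))"
      by (simp add: card_PiE N_def ennreal_of_nat_eq_real_of_nat)
    finally show ?thesis .
  qed
  have Nb: "\<bar>real (N y j) - h * ((d $ j - c $ j) / l $ j)\<bar> \<le> 1" for y j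
  proof -
    have eq: "h * ((d $ j - c $ j) / l $ j) = (h * d $ j - h * c $ j) / l $ j"
      by (simp add: right_diff_distrib)
    show ?thesis unfolding N_def eq
      using cd[of j] h l[of j] by (intro int_points_interval(2)) auto
  qed
  have F[measurable]: "(\<lambda>x. f (h *\<^sub>R x)) \<in> borel_measurable lebesgue" by measurable
  have "K = ennreal (\<bar>1 / h\<bar> ^ CARD('n)) * (\<integral>\<^sup>+x. f x * G x \<partial>lebesgue)"
    unfolding K_def Q_def[symmetric] G_def using h
    by (subst nn_integral_lebesgue_affine[where c = "1 / h" and t = 0]) auto
  also have "(\<integral>\<^sup>+x. f x * G x \<partial>lebesgue) = (\<integral>\<^sup>+x. f x * indicator Y x * ennreal (\<Prod>j\<in>UNIV. real (N x j)) \<partial>lebesgue)"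
    unfolding nn_integral_unfold_lattice[OF f G per l, of a] count Y_def[symmetric] by simp
  finally have K_eq: "K = ennreal ((1 / h) ^ CARD('n)) * (\<integral>\<^sup>+x. f x * indicator Y x * ennreal (\<Prod>j\<in>UNIV. real (N x j)) \<partial>lebesgue)"
    using h by simp
  have I_eq: "I = (\<integral>\<^sup>+x. f x * indicator Y x \<partial>lebesgue)" by (simp add: I_def Y_def)
  have scale: "(1 / h) ^ CARD('n) * (\<Prod>j\<in>UNIV. b j) = (\<Prod>j\<in>UNIV. b j / h)" for b :: "'n \<Rightarrow> real"
    by (simp add: prod_dividef power_one_over)
  have pull: "ennreal ((1 / h) ^ CARD('n)) * (\<integral>\<^sup>+x. f x * indicator Y x * ennreal b \<partial>lebesgue)
      = ennreal ((1 / h) ^ CARD('n) * b) * I" if "0 \<le> b" for b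
    using that h unfolding I_eq by (subst nn_integral_multc) (auto simp: ennreal_mult mult_ac)
  have "K \<le> ennreal ((1 / h) ^ CARD('n)) * (\<integral>\<^sup>+x. f x * indicator Y x * ennreal (\<Prod>j\<in>UNIV. h * ((d $ j - c $ j) / l $ j) + 1) \<partial>lebesgue)"
    unfolding K_eq using Nb
    by (intro mult_left_mono nn_integral_mono ennreal_leI prod_mono) (auto simp: abs_le_iff algebra_simps)
  also have "\<dots> = ennreal ((1 / h) ^ CARD('n) * (\<Prod>j\<in>UNIV. h * ((d $ j - c $ j) / l $ j) + 1)) * I"
    using h cd l by (intro pull prod_nonneg) (auto simp: less_imp_le)
  also have "(1 / h) ^ CARD('n) * (\<Prod>j\<in>UNIV. h * ((d $ j - c $ j) / l $ j) + 1) = (\<Prod>j\<in>UNIV. (d $ j - c $ j) / l $ j + 1 / h)"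
    unfolding scale using h by (intro prod.cong) (auto simp: add_divide_distrib)
  finally show "K \<le> ennreal (\<Prod>j\<in>UNIV. (d $ j - c $ j) / l $ j + 1 / h) * I" .
  have max_scale: "max 0 (h * t - 1) / h = max 0 (t - 1 / h)" for t
    using h by (auto simp: max_def field_simps)
  have "ennreal (\<Prod>j\<in>UNIV. max 0 ((d $ j - c $ j) / l $ j - 1 / h)) * I
      = ennreal ((1 / h) ^ CARD('n) * (\<Prod>j\<in>UNIV. max 0 (h * ((d $ j - c $ j) / l $ j) - 1))) * I"
    unfolding scale by (simp only: max_scale)
  also have "\<dots> = ennreal ((1 / h) ^ CARD('n)) * (\<integral>\<^sup>+x. f x * indicator Y x * ennreal (\<Prod>j\<in>UNIV. max 0 (h * ((d $ j - c $ j) / l $ j) - 1)) \<partial>lebesgue)"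
    by (intro pull[symmetric] prod_nonneg) auto
  also have "\<dots> \<le> K"
    unfolding K_eq using Nb
    by (intro mult_left_mono nn_integral_mono ennreal_leI prod_mono) (auto simp: abs_le_iff algebra_simps)
  finally show "ennreal (\<Prod>j\<in>UNIV. max 0 ((d $ j - c $ j) / l $ j - 1 / h)) * I \<le> K" .
qed

text \<open>Tiling calls for half-open boxes while the rectangles of the theorem are open; the
  difference lies in the frontier, a null set.\<close>

lemma AE_box_iff_halfopen:
  fixes c d :: "real ^ 'n"
  shows "AE x in lebesgue. x \<in> box c d \<longleftrightarrow> (\<forall>j. c $ j \<le> x $ j \<and> x $ j < d $ j)"
proof -
  have "cbox c d - box c d \<in> null_sets lebesgue"
    using negligible_frontier_interval[of c d] by (simp add: negligible_iff_null_sets)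
  then have "AE x in lebesgue. x \<notin> cbox c d - box c d" by (rule AE_not_in)
  then show ?thesis
    by eventually_elim (auto simp: mem_box_cart intro: less_imp_le)
qed

lemma nn_integral_dilate_periodic:
  fixes f :: "real ^ 'n \<Rightarrow> ennreal" and a b c d :: "real ^ 'n" and h :: real
  assumes f[measurable]: "f \<in> borel_measurable lebesgue" and per: "\<And>j. AE x in lebesgue. f (x + ((b - a) $ j) *\<^sub>R axis j 1) = f x"
    and ab: "\<And>j. a $ j < b $ j" and cd: "\<And>j. c $ j \<le> d $ j" and h: "0 < h"
  shows "(\<integral>\<^sup>+x. f (h *\<^sub>R x) \<partial>lebesgue_on (box c d))
      \<le> ennreal (\<Prod>j\<in>UNIV. (d $ j - c $ j) / (b $ j - a $ j) + 1 / h) * (\<integral>\<^sup>+x. f x \<partial>lebesgue_on (box a b))"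
    and "ennreal (\<Prod>j\<in>UNIV. max 0 ((d $ j - c $ j) / (b $ j - a $ j) - 1 / h)) * (\<integral>\<^sup>+x. f x \<partial>lebesgue_on (box a b))
      \<le> (\<integral>\<^sup>+x. f (h *\<^sub>R x) \<partial>lebesgue_on (box c d))"
proof -
  have *: "(\<integral>\<^sup>+x. F x \<partial>lebesgue_on (box c d)) = (\<integral>\<^sup>+x. F x * indicator {x. \<forall>j. c $ j \<le> x $ j \<and> x $ j < d $ j} x \<partial>lebesgue)"
    for F and c d :: "real ^ 'n"
    using AE_box_iff_halfopen[of c d]
    by (subst nn_integral_restrict_space) (auto intro!: nn_integral_cong_AE elim!: eventually_mono simp: indicator_def)
  have Y: "{x. \<forall>j. a $ j \<le> x $ j \<and> x $ j < b $ j} = {x. \<forall>j. a $ j \<le> x $ j \<and> x $ j < a $ j + (b - a) $ j}"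
    by simp
  have l: "0 < (b - a) $ j" for j using ab[of j] by simp
  show "(\<integral>\<^sup>+x. f (h *\<^sub>R x) \<partial>lebesgue_on (box c d))
      \<le> ennreal (\<Prod>j\<in>UNIV. (d $ j - c $ j) / (b $ j - a $ j) + 1 / h) * (\<integral>\<^sup>+x. f x \<partial>lebesgue_on (box a b))"
    and "ennreal (\<Prod>j\<in>UNIV. max 0 ((d $ j - c $ j) / (b $ j - a $ j) - 1 / h)) * (\<integral>\<^sup>+x. f x \<partial>lebesgue_on (box a b))
      \<le> (\<integral>\<^sup>+x. f (h *\<^sub>R x) \<partial>lebesgue_on (box c d))"
    unfolding * Y using nn_integral_dilate_periodic_halfopen[OF f per l cd h, of a] by simp_all
qed

text \<open>Return from [0, infinity] to real integrals: finiteness of the upper bound is what makes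
  the dilate integrable.\<close>

lemma integral_dilate_periodic_nonneg:
  fixes f :: "real ^ 'n \<Rightarrow> real" and a b c d :: "real ^ 'n" and h :: real
  assumes f[measurable]: "f \<in> borel_measurable lebesgue" and f0: "\<And>x. 0 \<le> f x"
    and per: "\<And>j. AE x in lebesgue. f (x + ((b - a) $ j) *\<^sub>R axis j 1) = f x"
    and ab: "\<And>j. a $ j < b $ j" and cd: "\<And>j. c $ j \<le> d $ j" and h: "0 < h"
    and int: "integrable (lebesgue_on (box a b)) f"
  shows "integrable (lebesgue_on (box c d)) (\<lambda>x. f (h *\<^sub>R x))"
    and "(LINT x|lebesgue_on (box c d). f (h *\<^sub>R x))
      \<le> (\<Prod>j\<in>UNIV. (d $ j - c $ j) / (b $ j - a $ j) + 1 / h) * (LINT x|lebesgue_on (box a b). f x)"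
    and "(\<Prod>j\<in>UNIV. max 0 ((d $ j - c $ j) / (b $ j - a $ j) - 1 / h)) * (LINT x|lebesgue_on (box a b). f x)
      \<le> (LINT x|lebesgue_on (box c d). f (h *\<^sub>R x))"
proof -
  let ?U = "\<Prod>j\<in>UNIV. (d $ j - c $ j) / (b $ j - a $ j) + 1 / h"
  let ?L = "\<Prod>j\<in>UNIV. max 0 ((d $ j - c $ j) / (b $ j - a $ j) - 1 / h)"
  let ?I = "LINT x|lebesgue_on (box a b). f x"
  have per': "AE x in lebesgue. ennreal (f (x + ((b - a) $ j) *\<^sub>R axis j 1)) = ennreal (f x)" for j
    using per[of j] by eventually_elim simp
  have U0: "0 \<le> ?U" using ab cd h by (auto intro!: prod_nonneg add_nonneg_nonneg divide_nonneg_nonneg simp: less_imp_le)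
  have L0: "0 \<le> ?L" by (auto intro!: prod_nonneg)
  have I0: "0 \<le> ?I" using f0 by (intro integral_nonneg_AE) auto
  have I: "(\<integral>\<^sup>+x. ennreal (f x) \<partial>lebesgue_on (box a b)) = ennreal ?I"
    using int f0 by (intro nn_integral_eq_integral) auto
  have m: "(\<lambda>x. f (h *\<^sub>R x)) \<in> borel_measurable lebesgue" by measurable
  then have m': "(\<lambda>x. f (h *\<^sub>R x)) \<in> borel_measurable (lebesgue_on (box c d))"
    by (rule measurable_restrict_space1)
  have up: "(\<integral>\<^sup>+x. ennreal (f (h *\<^sub>R x)) \<partial>lebesgue_on (box c d)) \<le> ennreal (?U * ?I)"
    using nn_integral_dilate_periodic(1)[of "\<lambda>x. ennreal (f x)", OF _ per' ab cd h] U0 I0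
    unfolding I by (simp add: ennreal_mult)
  have low: "ennreal (?L * ?I) \<le> (\<integral>\<^sup>+x. ennreal (f (h *\<^sub>R x)) \<partial>lebesgue_on (box c d))"
    using nn_integral_dilate_periodic(2)[of "\<lambda>x. ennreal (f x)", OF _ per' ab cd h] L0 I0
    unfolding I by (simp add: ennreal_mult)
  show i: "integrable (lebesgue_on (box c d)) (\<lambda>x. f (h *\<^sub>R x))"
    using m' f0 up by (intro integrableI_nonneg) (auto intro: le_less_trans)
  have K: "(\<integral>\<^sup>+x. ennreal (f (h *\<^sub>R x)) \<partial>lebesgue_on (box c d)) = ennreal (LINT x|lebesgue_on (box c d). f (h *\<^sub>R x))"
    using i f0 by (intro nn_integral_eq_integral) auto
  show "(LINT x|lebesgue_on (box c d). f (h *\<^sub>R x)) \<le> ?U * ?I"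
    using up U0 I0 unfolding K by (subst (asm) ennreal_le_iff) auto
  show "?L * ?I \<le> (LINT x|lebesgue_on (box c d). f (h *\<^sub>R x))"
    using low f0 unfolding K by (subst (asm) ennreal_le_iff) (auto intro!: integral_nonneg_AE)
qed

text \<open>For a nonnegative function the dilated integral and \<open>D\<close> times the cell
  integral both lie between \<open>L\<close> and \<open>U\<close> times the cell integral. Positive
  and negative parts are again periodic, and their cell integrals add up to that of
  \<open>\<bar>f x\<bar>\<close>.\<close>

lemma integral_dilate_periodic:
  fixes f :: "real ^ 'n \<Rightarrow> real" and a b c d :: "real ^ 'n" and h :: real
  assumes f[measurable]: "f \<in> borel_measurable lebesgue"
    and per: "\<And>j. AE x in lebesgue. f (x + ((b - a) $ j) *\<^sub>R axis j 1) = f x"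
    and ab: "\<And>j. a $ j < b $ j" and cd: "\<And>j. c $ j \<le> d $ j" and h: "0 < h"
    and int: "integrable (lebesgue_on (box a b)) f"
  shows "integrable (lebesgue_on (box c d)) (\<lambda>x. f (h *\<^sub>R x))"
    and "\<bar>(LINT x|lebesgue_on (box c d). f (h *\<^sub>R x))
        - (\<Prod>j\<in>UNIV. (d $ j - c $ j) / (b $ j - a $ j)) * (LINT x|lebesgue_on (box a b). f x)\<bar>
      \<le> ((\<Prod>j\<in>UNIV. (d $ j - c $ j) / (b $ j - a $ j) + 1 / h)
          - (\<Prod>j\<in>UNIV. max 0 ((d $ j - c $ j) / (b $ j - a $ j) - 1 / h)))
        * (LINT x|lebesgue_on (box a b). \<bar>f x\<bar>)"
proof -
  define U where "U = (\<Prod>j\<in>UNIV. (d $ j - c $ j) / (b $ j - a $ j) + 1 / h)"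
  define L where "L = (\<Prod>j\<in>UNIV. max 0 ((d $ j - c $ j) / (b $ j - a $ j) - 1 / h))"
  define D where "D = (\<Prod>j\<in>UNIV. (d $ j - c $ j) / (b $ j - a $ j))"
  have D0: "0 \<le> (d $ j - c $ j) / (b $ j - a $ j)" for j using ab[of j] cd[of j] by simp
  have LD: "L \<le> D" unfolding L_def D_def using D0 h by (intro prod_mono) auto
  have DU: "D \<le> U" unfolding D_def U_def using D0 h by (intro prod_mono) auto
  have *: "integrable (lebesgue_on (box c d)) (\<lambda>x. g (h *\<^sub>R x)) \<and>
     \<bar>(LINT x|lebesgue_on (box c d). g (h *\<^sub>R x)) - D * (LINT x|lebesgue_on (box a b). g x)\<bar>
       \<le> (U - L) * (LINT x|lebesgue_on (box a b). g x)"
    if g: "g \<in> borel_measurable lebesgue" "\<And>x. 0 \<le> g x" "integrable (lebesgue_on (box a b)) g"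
      and pg: "\<And>j. AE x in lebesgue. g (x + ((b - a) $ j) *\<^sub>R axis j 1) = g x" for g
  proof -
    note b = integral_dilate_periodic_nonneg[OF g(1,2) pg ab cd h g(3), folded U_def L_def]
    have "0 \<le> (LINT x|lebesgue_on (box a b). g x)" using g(2) by (intro integral_nonneg_AE) auto
    then have "L * (LINT x|lebesgue_on (box a b). g x) \<le> D * (LINT x|lebesgue_on (box a b). g x)"
       "D * (LINT x|lebesgue_on (box a b). g x) \<le> U * (LINT x|lebesgue_on (box a b). g x)"
      using LD DU by (auto intro: mult_right_mono)
    then show ?thesis using b by (auto simp: left_diff_distrib abs_le_iff)
  qed
  define fp where "fp x = max 0 (f x)" for x
  define fn where "fn x = max 0 (- f x)" for x
  have [measurable]: "fp \<in> borel_measurable lebesgue" "fn \<in> borel_measurable lebesgue"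
    unfolding fp_def fn_def by measurable
  have ip: "integrable (lebesgue_on (box a b)) fp" and iN: "integrable (lebesgue_on (box a b)) fn"
    unfolding fp_def fn_def using int by auto
  have pp: "AE x in lebesgue. fp (x + ((b - a) $ j) *\<^sub>R axis j 1) = fp x" for j
    using per[of j] unfolding fp_def by eventually_elim simp
  have pn: "AE x in lebesgue. fn (x + ((b - a) $ j) *\<^sub>R axis j 1) = fn x" for j
    using per[of j] unfolding fn_def by eventually_elim simp
  have P: "integrable (lebesgue_on (box c d)) (\<lambda>x. fp (h *\<^sub>R x))"
     "\<bar>(LINT x|lebesgue_on (box c d). fp (h *\<^sub>R x)) - D * (LINT x|lebesgue_on (box a b). fp x)\<bar>
       \<le> (U - L) * (LINT x|lebesgue_on (box a b). fp x)"
    using *[of fp] ip pp by (auto simp: fp_def)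
  have N: "integrable (lebesgue_on (box c d)) (\<lambda>x. fn (h *\<^sub>R x))"
     "\<bar>(LINT x|lebesgue_on (box c d). fn (h *\<^sub>R x)) - D * (LINT x|lebesgue_on (box a b). fn x)\<bar>
       \<le> (U - L) * (LINT x|lebesgue_on (box a b). fn x)"
    using *[of fn] iN pn by (auto simp: fn_def)
  have dec: "f = (\<lambda>x. fp x - fn x)" and adec: "(\<lambda>x. \<bar>f x\<bar>) = (\<lambda>x. fp x + fn x)"
    by (auto simp: fp_def fn_def fun_eq_iff)
  show "integrable (lebesgue_on (box c d)) (\<lambda>x. f (h *\<^sub>R x))"
    unfolding dec using P N by auto
  have "\<bar>(LINT x|lebesgue_on (box c d). f (h *\<^sub>R x)) - D * (LINT x|lebesgue_on (box a b). f x)\<bar>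
      \<le> (U - L) * (LINT x|lebesgue_on (box a b). \<bar>f x\<bar>)"
    unfolding adec unfolding dec using P N ip iN by (simp add: algebra_simps abs_le_iff)
  then show "\<bar>(LINT x|lebesgue_on (box c d). f (h *\<^sub>R x))
        - (\<Prod>j\<in>UNIV. (d $ j - c $ j) / (b $ j - a $ j)) * (LINT x|lebesgue_on (box a b). f x)\<bar>
      \<le> ((\<Prod>j\<in>UNIV. (d $ j - c $ j) / (b $ j - a $ j) + 1 / h)
          - (\<Prod>j\<in>UNIV. max 0 ((d $ j - c $ j) / (b $ j - a $ j) - 1 / h)))
        * (LINT x|lebesgue_on (box a b). \<bar>f x\<bar>)"
    by (simp only: U_def L_def D_def)
qed

section \<open>Limits over boxes and uniform integrability of the dilates\<close>

lemma measure_lebesgue_box_cart: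
  fixes c d :: "real ^ 'n"
  assumes "\<And>j. c $ j \<le> d $ j"
  shows "measure lebesgue (box c d) = (\<Prod>j\<in>UNIV. d $ j - c $ j)"
proof -
  have "cbox c d \<noteq> {}" using assms by (simp add: interval_ne_empty_cart)
  then have "measure lebesgue (cbox c d) = (\<Prod>j\<in>UNIV. d $ j - c $ j)"
    using content_cbox_cart[of c d] by simp
  then show ?thesis by (simp add: measure_lborel_box_eq measure_lborel_cbox_eq)
qed

lemma tendsto_integral_dilate_box:
  fixes v :: "nat \<Rightarrow> real ^ 'n \<Rightarrow> real" and a b c d :: "real ^ 'n"
  assumes v: "\<And>n. v n \<in> borel_measurable lebesgue"
    and per: "\<And>n j. AE x in lebesgue. v n (x + ((b - a) $ j) *\<^sub>R axis j 1) = v n x"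
    and ab: "\<And>j. a $ j < b $ j" and cd: "\<And>j. c $ j \<le> d $ j"
    and int: "\<And>n. integrable (lebesgue_on (box a b)) (v n)"
    and B: "\<And>n. (LINT x|lebesgue_on (box a b). \<bar>v n x\<bar>) \<le> B"
    and lim: "(\<lambda>n. LINT x|lebesgue_on (box a b). v n x) \<longlonglongrightarrow> L"
  shows "(\<lambda>n. LINT x|lebesgue_on (box c d). v n (real (Suc n) *\<^sub>R x))
     \<longlonglongrightarrow> L / measure lebesgue (box a b) * measure lebesgue (box c d)"
proof -
  let ?D = "\<lambda>j. (d $ j - c $ j) / (b $ j - a $ j)"
  \<comment> \<open>The gap between upper and lower counting factors depends on the boxes and
    \<open>n\<close> only. Both products tend to that of the \<open>?D j\<close>, so
    \<open>e n * B\<close> is a vanishing error although function and dilation change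
    together.\<close>
  define e where "e n = (\<Prod>j\<in>UNIV. ?D j + 1 / real (Suc n)) - (\<Prod>j\<in>UNIV. max 0 (?D j - 1 / real (Suc n)))" for n
  have D0: "0 \<le> ?D j" for j using ab[of j] cd[of j] by simp
  have inv: "(\<lambda>n. 1 / real (Suc n)) \<longlonglongrightarrow> 0" by (rule LIMSEQ_Suc[OF lim_1_over_n])
  have "e \<longlonglongrightarrow> (\<Prod>j\<in>UNIV. ?D j + 0) - (\<Prod>j\<in>UNIV. max 0 (?D j - 0))"
    unfolding e_def by (intro tendsto_diff tendsto_prod tendsto_add tendsto_max tendsto_const inv)
  moreover have "max 0 (?D j) = ?D j" for j using D0[of j] by simp
  ultimately have "e \<longlonglongrightarrow> 0" by simp
  then have z: "(\<lambda>n. e n * B) \<longlonglongrightarrow> 0" by (rule tendsto_mult_left_zero)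
  have e0: "0 \<le> e n" for n
    unfolding e_def using D0 by (simp, intro prod_mono) (auto intro: add_nonneg_nonneg)
  have "(\<lambda>n. (LINT x|lebesgue_on (box c d). v n (real (Suc n) *\<^sub>R x)) - (\<Prod>j\<in>UNIV. ?D j) * (LINT x|lebesgue_on (box a b). v n x)) \<longlonglongrightarrow> 0"
  proof (rule Lim_null_comparison[OF always_eventually z], rule allI)
    fix n
    have "norm ((LINT x|lebesgue_on (box c d). v n (real (Suc n) *\<^sub>R x)) - (\<Prod>j\<in>UNIV. ?D j) * (LINT x|lebesgue_on (box a b). v n x))
        \<le> e n * (LINT x|lebesgue_on (box a b). \<bar>v n x\<bar>)"
      using integral_dilate_periodic(2)[OF v per ab cd _ int, of "real (Suc n)"] by (simp add: e_def)
    also have "\<dots> \<le> e n * B" using e0 B by (intro mult_left_mono) auto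
    finally show "norm ((LINT x|lebesgue_on (box c d). v n (real (Suc n) *\<^sub>R x)) - (\<Prod>j\<in>UNIV. ?D j) * (LINT x|lebesgue_on (box a b). v n x)) \<le> e n * B" .
  qed
  from tendsto_add[OF this tendsto_mult_left[OF lim, of "\<Prod>j\<in>UNIV. ?D j"]]
  have "(\<lambda>n. LINT x|lebesgue_on (box c d). v n (real (Suc n) *\<^sub>R x)) \<longlonglongrightarrow> (\<Prod>j\<in>UNIV. ?D j) * L" by simp
  also have "(\<Prod>j\<in>UNIV. ?D j) * L = L / measure lebesgue (box a b) * measure lebesgue (box c d)"
    unfolding measure_lebesgue_box_cart[OF cd] measure_lebesgue_box_cart[OF less_imp_le[OF ab]] prod_dividef
    by simp
  finally show ?thesis .
qed

text \<open>An arbitrary small set cannot be transported back to the cell, but the set where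
  \<open>\<bar>v n x\<bar>\<close> exceeds a level \<open>K\<close> is periodic up to null sets. The
  part above \<open>K\<close> is therefore dilated by the counting bound, and the part below
  \<open>K\<close> is controlled by the measure of the given set.\<close>

lemma uniformly_integrable_dilate:
  fixes v :: "nat \<Rightarrow> real ^ 'n \<Rightarrow> real" and a b c d :: "real ^ 'n"
  assumes v: "\<And>n. v n \<in> borel_measurable lebesgue"
    and per: "\<And>n j. AE x in lebesgue. v n (x + ((b - a) $ j) *\<^sub>R axis j 1) = v n x"
    and ab: "\<And>j. a $ j < b $ j" and cd: "\<And>j. c $ j \<le> d $ j"
    and int: "\<And>n. integrable (lebesgue_on (box a b)) (v n)"
    and B: "\<And>n. (LINT x|lebesgue_on (box a b). \<bar>v n x\<bar>) \<le> B"
    and UI: "\<And>e. 0 < e \<Longrightarrow> \<exists>t>0. \<forall>n. \<forall>E\<in>sets (lebesgue_on (box a b)). measure (lebesgue_on (box a b)) E < t \<longrightarrow>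
       (LINT x|lebesgue_on (box a b). indicator E x * \<bar>v n x\<bar>) < e"
    and e: "0 < e"
  shows "\<exists>t>0. \<forall>n. \<forall>E\<in>sets (lebesgue_on (box c d)). measure (lebesgue_on (box c d)) E < t \<longrightarrow>
       (LINT x|lebesgue_on (box c d). indicator E x * \<bar>v n (real (Suc n) *\<^sub>R x)\<bar>) < e"
proof -
  interpret Y: finite_measure "lebesgue_on (box a b)"
    by (rule finite_measure_lebesgue_on) auto
  interpret Q: finite_measure "lebesgue_on (box c d)"
    by (rule finite_measure_lebesgue_on) auto
  \<comment> \<open>The counting factor at dilation 1, which dominates that of every later
    one.\<close>
  define C where "C = (\<Prod>j\<in>UNIV. (d $ j - c $ j) / (b $ j - a $ j) + 1)"
  have D0: "0 \<le> (d $ j - c $ j) / (b $ j - a $ j)" for j using ab[of j] cd[of j] by simp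
  have C: "0 < C" unfolding C_def using D0 by (intro prod_pos) (auto intro: add_nonneg_pos)
  obtain t where t: "0 < t" "\<And>n E. E \<in> sets (lebesgue_on (box a b)) \<Longrightarrow> measure (lebesgue_on (box a b)) E < t \<Longrightarrow>
       (LINT x|lebesgue_on (box a b). indicator E x * \<bar>v n x\<bar>) < e / (2 * C)"
    using UI[of "e / (2 * C)"] e C by auto
  have B0: "0 \<le> B" by (rule order_trans[OF integral_nonneg_AE B]) auto
  \<comment> \<open>Chebyshev: since \<open>B < K * t\<close>, the set where
    \<open>\<bar>v n x\<bar>\<close> exceeds \<open>K\<close> has measure below \<open>t\<close> in
    the cell.\<close>
  define K where "K = B / t + 1"
  have K: "0 < K" using B0 t(1) by (auto simp: K_def intro: add_nonneg_pos)
  define E where "E n = {x. K < \<bar>v n x\<bar>}" for n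
  have Em[measurable]: "E n \<in> sets lebesgue" for n
  proof -
    note [measurable] = v
    have "{x \<in> space lebesgue. K < \<bar>v n x\<bar>} \<in> sets lebesgue" by measurable
    then show ?thesis by (simp add: E_def)
  qed
  have tail: "(LINT x|lebesgue_on (box a b). indicator (E n) x * \<bar>v n x\<bar>) < e / (2 * C)" for n
  proof -
    have s: "E n \<inter> box a b \<in> sets (lebesgue_on (box a b))"
      by (subst sets_restrict_space_iff) (auto intro!: sets.Int Em)
    have iK: "integrable (lebesgue_on (box a b)) (\<lambda>x. K * indicator (E n \<inter> box a b) x)"
      using s by (simp add: Y.emeasure_eq_measure)
    have "K * measure (lebesgue_on (box a b)) (E n \<inter> box a b) = (LINT x|lebesgue_on (box a b). K * indicator (E n \<inter> box a b) x)"
      using s by simp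
    also have "\<dots> \<le> (LINT x|lebesgue_on (box a b). \<bar>v n x\<bar>)"
      using int[of n] by (intro integral_mono[OF iK]) (auto simp: indicator_def E_def)
    also have "\<dots> \<le> B" by (rule B)
    also have "B < K * t" using t(1) by (simp add: K_def field_simps)
    finally have "measure (lebesgue_on (box a b)) (E n \<inter> box a b) < t" using K by simp
    from t(2)[OF s this] have "(LINT x|lebesgue_on (box a b). indicator (E n \<inter> box a b) x * \<bar>v n x\<bar>) < e / (2 * C)" .
    also have "(LINT x|lebesgue_on (box a b). indicator (E n \<inter> box a b) x * \<bar>v n x\<bar>)
        = (LINT x|lebesgue_on (box a b). indicator (E n) x * \<bar>v n x\<bar>)"
      by (intro Bochner_Integration.integral_cong) (auto simp: indicator_def)
    finally show ?thesis .
  qed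
  let ?f = "\<lambda>n x. indicator (E n) x * \<bar>v n x\<bar>"
  have f_m: "?f n \<in> borel_measurable lebesgue" for n using v by measurable
  have f_int: "integrable (lebesgue_on (box a b)) (?f n)" for n
    using int[of n] by (rule Bochner_Integration.integrable_bound)
      (auto simp: indicator_def intro!: measurable_restrict_space1[OF f_m, unfolded indicator_def])
  have f_per: "AE x in lebesgue. ?f n (x + ((b - a) $ j) *\<^sub>R axis j 1) = ?f n x" for n j
    using per[of n j] by eventually_elim (simp add: E_def indicator_def)
  have big: "integrable (lebesgue_on (box c d)) (\<lambda>x. ?f n (real (Suc n) *\<^sub>R x)) \<and>
      (LINT x|lebesgue_on (box c d). ?f n (real (Suc n) *\<^sub>R x)) < e / 2" for n
  proof -
    have f0: "0 \<le> ?f n x" for x by simp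
    have h: "0 < real (Suc n)" by simp
    note b = integral_dilate_periodic_nonneg[OF f_m f0 f_per ab cd h f_int]
    have "(\<Prod>j\<in>UNIV. (d $ j - c $ j) / (b $ j - a $ j) + 1 / real (Suc n)) \<le> C"
      unfolding C_def using D0 by (intro prod_mono) auto
    then have "(\<Prod>j\<in>UNIV. (d $ j - c $ j) / (b $ j - a $ j) + 1 / real (Suc n)) * (LINT x|lebesgue_on (box a b). ?f n x)
        \<le> C * (LINT x|lebesgue_on (box a b). ?f n x)"
      by (rule mult_right_mono) (intro integral_nonneg_AE AE_I2 f0)
    with b(2) have "(LINT x|lebesgue_on (box c d). ?f n (real (Suc n) *\<^sub>R x)) \<le> C * (LINT x|lebesgue_on (box a b). ?f n x)"
      by (rule order_trans)
    also have "\<dots> < C * (e / (2 * C))" using tail C by (intro mult_strict_left_mono) auto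
    also have "\<dots> = e / 2" using C by simp
    finally show ?thesis using b(1) by blast
  qed
  show ?thesis
  proof (intro exI[of _ "e / (2 * K)"] conjI allI ballI impI)
    show "0 < e / (2 * K)" using e K by simp
    fix n A assume A[measurable]: "A \<in> sets (lebesgue_on (box c d))" and mA: "measure (lebesgue_on (box c d)) A < e / (2 * K)"
    have AR: "A \<inter> box c d = A" using sets.sets_into_space[OF A] by auto
    have iA: "integrable (lebesgue_on (box c d)) (\<lambda>x. K * indicator A x)"
      using A by (simp add: Q.emeasure_eq_measure)
    have vi: "integrable (lebesgue_on (box c d)) (\<lambda>x. v n (real (Suc n) *\<^sub>R x))"
      by (rule integral_dilate_periodic(1)[OF v per ab cd _ int]) simp
    have "(LINT x|lebesgue_on (box c d). indicator A x * \<bar>v n (real (Suc n) *\<^sub>R x)\<bar>)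
        \<le> (LINT x|lebesgue_on (box c d). K * indicator A x + ?f n (real (Suc n) *\<^sub>R x))"
    proof (rule integral_mono)
      show "integrable (lebesgue_on (box c d)) (\<lambda>x. indicator A x * \<bar>v n (real (Suc n) *\<^sub>R x)\<bar>)"
        using vi by (rule Bochner_Integration.integrable_bound) (use vi in \<open>auto simp: indicator_def\<close>)
      show "indicator A x * \<bar>v n (real (Suc n) *\<^sub>R x)\<bar> \<le> K * indicator A x + ?f n (real (Suc n) *\<^sub>R x)" for x
        using K by (auto simp: indicator_def E_def)
    qed (use iA big[of n] in auto)
    also have "\<dots> = K * measure (lebesgue_on (box c d)) A + (LINT x|lebesgue_on (box c d). ?f n (real (Suc n) *\<^sub>R x))"
      using iA big[of n] AR by simp
    also have "\<dots> < K * (e / (2 * K)) + e / 2"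
      using mA K big[of n] by (intro add_strict_mono mult_strict_left_mono) auto
    also have "\<dots> = e" using K by simp
    finally show "(LINT x|lebesgue_on (box c d). indicator A x * \<bar>v n (real (Suc n) *\<^sub>R x)\<bar>) < e" .
  qed
qed

section \<open>From boxes to bounded test functions\<close>

text \<open>Rounding \<open>g\<close> down to multiples of \<open>\<delta>\<close> gives a simple
  function within \<open>\<delta>\<close> of \<open>g\<close>; the error in the integrals is at most
  \<open>\<delta>\<close> times an L^1 norm, uniformly in \<open>n\<close>.\<close>

lemma (in finite_measure) tendsto_integral_bounded_test:
  fixes w :: "nat \<Rightarrow> 'a \<Rightarrow> real" and w0 g :: "'a \<Rightarrow> real"
  assumes w: "\<And>n. integrable M (w n)" and w0: "integrable M w0"
    and B: "\<And>n. (LINT x|M. \<bar>w n x\<bar>) \<le> B"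
    and conv: "\<And>A. A \<in> sets M \<Longrightarrow> (\<lambda>n. LINT x|M. indicator A x * w n x) \<longlonglongrightarrow> (LINT x|M. indicator A x * w0 x)"
    and g[measurable]: "g \<in> borel_measurable M" and K: "\<And>x. \<bar>g x\<bar> \<le> K"
  shows "(\<lambda>n. LINT x|M. w n x * g x) \<longlonglongrightarrow> (LINT x|M. w0 x * g x)"
proof (rule LIMSEQ_I)
  fix e :: real assume e: "0 < e"
  \<comment> \<open>A common positive bound for all L^1 norms; with
    \<open>\<delta> = e / (4 * C)\<close> the two replacements of \<open>g\<close> cost at most
    \<open>e / 2\<close> together.\<close>
  define C where "C = \<bar>B\<bar> + (LINT x|M. \<bar>w0 x\<bar>) + 1"
  have w0_nn: "0 \<le> (LINT x|M. \<bar>w0 x\<bar>)" by (intro integral_nonneg_AE) auto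
  then have C: "0 < C" unfolding C_def using abs_ge_zero[of B] by linarith
  define \<delta> where "\<delta> = e / (4 * C)"
  have \<delta>: "0 < \<delta>" using e C by (simp add: \<delta>_def)
  \<comment> \<open>As \<open>\<bar>g x\<bar> \<le> K\<close>, only the levels from
    \<open>-N\<close> to \<open>N\<close> occur; the \<open>+ 1\<close> allows for rounding
    down.\<close>
  define N :: int where "N = \<lceil>K / \<delta>\<rceil> + 1"
  define A where "A k = {x \<in> space M. \<lfloor>g x / \<delta>\<rfloor> = k}" for k :: int
  have A[measurable]: "A k \<in> sets M" for k unfolding A_def by measurable
  define s where "s x = (\<Sum>k\<in>{-N..N}. \<delta> * real_of_int k * indicator (A k) x)" for x
  have s_eq: "s x = \<delta> * real_of_int \<lfloor>g x / \<delta>\<rfloor>" if x: "x \<in> space M" for x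
  proof -
    have "\<bar>g x / \<delta>\<bar> \<le> K / \<delta>" using K[of x] \<delta> by (simp add: divide_right_mono)
    then have "real_of_int (- N) \<le> real_of_int \<lfloor>g x / \<delta>\<rfloor>" "real_of_int \<lfloor>g x / \<delta>\<rfloor> \<le> real_of_int N"
      using le_of_int_ceiling[of "K / \<delta>"] of_int_floor_le[of "g x / \<delta>"] real_of_int_floor_gt_diff_one[of "g x / \<delta>"]
      unfolding N_def abs_le_iff of_int_minus of_int_add of_int_1 by linarith+
    then have "\<lfloor>g x / \<delta>\<rfloor> \<in> {-N..N}" by (simp only: of_int_le_iff atLeastAtMost_iff)
    then show ?thesis
      using x unfolding s_def A_def by (simp add: indicator_def if_distrib sum.delta' cong: if_cong)
  qed
  have gs: "\<bar>g x - s x\<bar> \<le> \<delta>" if "x \<in> space M" for x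
  proof -
    have "0 \<le> g x / \<delta> - real_of_int \<lfloor>g x / \<delta>\<rfloor>" "g x / \<delta> - real_of_int \<lfloor>g x / \<delta>\<rfloor> \<le> 1" by linarith+
    then have "0 \<le> \<delta> * (g x / \<delta> - real_of_int \<lfloor>g x / \<delta>\<rfloor>)" "\<delta> * (g x / \<delta> - real_of_int \<lfloor>g x / \<delta>\<rfloor>) \<le> \<delta> * 1"
      using \<delta> by (intro mult_nonneg_nonneg mult_left_mono; simp)+
    moreover have "\<delta> * (g x / \<delta> - real_of_int \<lfloor>g x / \<delta>\<rfloor>) = g x - s x"
      unfolding s_eq[OF that] using \<delta> by (simp add: right_diff_distrib)
    ultimately show ?thesis by simp
  qed
  have iA: "integrable M (\<lambda>x. f x * indicator (A k) x)" if "integrable M f" for f :: "'a \<Rightarrow> real" and k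
    using A that by (rule integrable_real_mult_indicator)
  have i_s: "integrable M (\<lambda>x. f x * s x) \<and> (LINT x|M. f x * s x) = (\<Sum>k\<in>{-N..N}. \<delta> * real_of_int k * (LINT x|M. indicator (A k) x * f x))"
    if f: "integrable M f" for f
  proof -
    have eq: "f x * s x = (\<Sum>k\<in>{-N..N}. \<delta> * real_of_int k * (f x * indicator (A k) x))" for x
      by (simp add: s_def sum_distrib_left mult_ac)
    have i: "integrable M (\<lambda>x. \<delta> * real_of_int k * (f x * indicator (A k) x))" for k
      by (rule integrable_mult_right[OF iA[OF f]])
    have "(LINT x|M. f x * s x) = (\<Sum>k\<in>{-N..N}. LINT x|M. \<delta> * real_of_int k * (f x * indicator (A k) x))"
      unfolding eq using i by (rule Bochner_Integration.integral_sum)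
    then show ?thesis unfolding eq using i by (simp add: mult.commute)
  qed
  have i_g: "integrable M (\<lambda>x. f x * g x)" if f: "integrable M f" for f
  proof (rule Bochner_Integration.integrable_bound[where f = "\<lambda>x. \<bar>K\<bar> * f x"])
    show "AE x in M. norm (f x * g x) \<le> norm (\<bar>K\<bar> * f x)"
    proof (rule AE_I2)
      fix x
      have "\<bar>f x\<bar> * \<bar>g x\<bar> \<le> \<bar>f x\<bar> * \<bar>K\<bar>" using K[of x] by (intro mult_left_mono) auto
      then show "norm (f x * g x) \<le> norm (\<bar>K\<bar> * f x)" by (simp add: abs_mult mult.commute)
    qed
  qed (use f in auto)
  have close: "\<bar>(LINT x|M. f x * g x) - (LINT x|M. f x * s x)\<bar> \<le> \<delta> * (LINT x|M. \<bar>f x\<bar>)" if f: "integrable M f" for f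
  proof -
    have i: "integrable M (\<lambda>x. f x * g x - f x * s x)" using i_g[OF f] i_s[OF f] by auto
    have "(LINT x|M. f x * g x) - (LINT x|M. f x * s x) = (LINT x|M. f x * g x - f x * s x)"
      using i_g[OF f] i_s[OF f] by simp
    also have "\<bar>\<dots>\<bar> \<le> (LINT x|M. \<bar>f x * g x - f x * s x\<bar>)" by (rule integral_abs_bound)
    also have "\<dots> \<le> (LINT x|M. \<delta> * \<bar>f x\<bar>)"
    proof (rule integral_mono)
      fix x assume "x \<in> space M"
      then have "\<bar>f x\<bar> * \<bar>g x - s x\<bar> \<le> \<bar>f x\<bar> * \<delta>" using gs by (intro mult_left_mono) auto
      then show "\<bar>f x * g x - f x * s x\<bar> \<le> \<delta> * \<bar>f x\<bar>"
        by (simp add: mult.commute flip: abs_mult right_diff_distrib)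
    qed (use i f in auto)
    finally show ?thesis by simp
  qed
  have "(\<lambda>n. LINT x|M. w n x * s x) \<longlonglongrightarrow> (LINT x|M. w0 x * s x)"
    using i_s[OF w] i_s[OF w0] by (simp only:) (intro tendsto_sum tendsto_mult_left conv A)
  then obtain no where no: "\<And>n. no \<le> n \<Longrightarrow> \<bar>(LINT x|M. w n x * s x) - (LINT x|M. w0 x * s x)\<bar> < e / 2"
    using LIMSEQ_D[where r = "e / 2"] e by fastforce
  show "\<exists>no. \<forall>n\<ge>no. norm ((LINT x|M. w n x * g x) - (LINT x|M. w0 x * g x)) < e"
  proof (intro exI[of _ no] allI impI)
    fix n assume n: "no \<le> n"
    have "(LINT x|M. \<bar>w n x\<bar>) \<le> C" "(LINT x|M. \<bar>w0 x\<bar>) \<le> C"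
      unfolding C_def using B[of n] w0_nn abs_ge_self[of B] abs_ge_zero[of B] by linarith+
    then have "\<delta> * (LINT x|M. \<bar>w n x\<bar>) \<le> \<delta> * C" "\<delta> * (LINT x|M. \<bar>w0 x\<bar>) \<le> \<delta> * C"
      using \<delta> by auto
    moreover have "\<delta> * C = e / 4" using C by (simp add: \<delta>_def)
    ultimately show "norm ((LINT x|M. w n x * g x) - (LINT x|M. w0 x * g x)) < e"
      using no[OF n] close[OF w, of n] close[OF w0] unfolding real_norm_def by linarith
  qed
qed

text \<open>Boxes are closed under intersection and generate the Borel sets. Complements rest on
  \<open>whole\<close>; for a countable disjoint union the limit in \<open>n\<close> must be
  exchanged with the sum over the pieces, and \<open>UI\<close> makes the remainder small uniformly
  in \<open>n\<close>.\<close>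

lemma tendsto_integral_of_boxes:
  fixes W :: "nat \<Rightarrow> 'a::euclidean_space \<Rightarrow> real" and R :: "'a set"
  assumes fin: "finite_measure (lebesgue_on R)" and R[measurable]: "R \<in> sets lebesgue"
    and W: "\<And>n. integrable (lebesgue_on R) (W n)"
    and UI: "\<And>e. 0 < e \<Longrightarrow> \<exists>t>0. \<forall>n. \<forall>E\<in>sets (lebesgue_on R). measure (lebesgue_on R) E < t \<longrightarrow>
       (LINT x|lebesgue_on R. indicator E x * \<bar>W n x\<bar>) < e"
    and whole: "(\<lambda>n. LINT x|lebesgue_on R. W n x) \<longlonglongrightarrow> m * measure (lebesgue_on R) R"
    and box: "\<And>c d. (\<lambda>n. LINT x|lebesgue_on R. indicator (box c d) x * W n x) \<longlonglongrightarrow> m * measure (lebesgue_on R) (box c d \<inter> R)"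
    and A: "A \<in> sets lebesgue"
  shows "(\<lambda>n. LINT x|lebesgue_on R. indicator A x * W n x) \<longlonglongrightarrow> m * measure (lebesgue_on R) (A \<inter> R)"
proof -
  interpret finite_measure "lebesgue_on R" by fact
  have inR: "S \<inter> R \<in> sets (lebesgue_on R)" if "S \<in> sets lebesgue" for S
    using that by (subst sets_restrict_space_iff) auto
  have ind: "integrable (lebesgue_on R) (\<lambda>x. indicator S x * W n x)" if "S \<in> sets lebesgue" for S n
  proof -
    have "integrable (lebesgue_on R) (\<lambda>x. W n x * indicator (S \<inter> R) x)"
      by (rule integrable_real_mult_indicator[OF inR[OF that] W])
    moreover have "integrable (lebesgue_on R) (\<lambda>x. W n x * indicator (S \<inter> R) x) \<longleftrightarrow> integrable (lebesgue_on R) (\<lambda>x. indicator S x * W n x)"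
      by (intro Bochner_Integration.integrable_cong) (auto simp: indicator_def)
    ultimately show ?thesis by simp
  qed
  define P where "P S \<longleftrightarrow> (\<lambda>n. LINT x|lebesgue_on R. indicator S x * W n x) \<longlonglongrightarrow> m * measure (lebesgue_on R) (S \<inter> R)" for S
  have borel: "P S" if "S \<in> sets borel" for S
  proof -
    have gen: "sets borel = sigma_sets UNIV (range (\<lambda>(c, d). box c d :: 'a set))"
      by (subst borel_eq_box) (simp add: sets_measure_of)
    have "Int_stable (range (\<lambda>(c, d). box c d :: 'a set))"
      unfolding Int_stable_def by (auto simp: box_Int_box)
    moreover have "range (\<lambda>(c, d). box c d :: 'a set) \<subseteq> Pow UNIV" by simp
    moreover have "S \<in> sigma_sets UNIV (range (\<lambda>(c, d). box c d :: 'a set))" using that gen by simp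
    ultimately show "P S"
    proof (induction rule: sigma_sets_induct_disjoint)
      case (basic S)
      then show ?case using box by (auto simp: P_def)
    next
      case empty
      show ?case by (simp add: P_def)
    next
      case (compl S)
      then have S: "S \<in> sets lebesgue" unfolding gen[symmetric] by auto
      have "(LINT x|lebesgue_on R. indicator (UNIV - S) x * W n x) = (LINT x|lebesgue_on R. W n x) - (LINT x|lebesgue_on R. indicator S x * W n x)" for n
      proof -
        have "(LINT x|lebesgue_on R. indicator (UNIV - S) x * W n x) = (LINT x|lebesgue_on R. W n x - indicator S x * W n x)"
          by (intro Bochner_Integration.integral_cong) (auto simp: indicator_def)
        then show ?thesis using ind[OF S] W by simp
      qed
      moreover have "measure (lebesgue_on R) ((UNIV - S) \<inter> R) = measure (lebesgue_on R) R - measure (lebesgue_on R) (S \<inter> R)"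
      proof -
        have "(UNIV - S) \<inter> R = space (lebesgue_on R) - (S \<inter> R)" by auto
        then show ?thesis using finite_measure_compl[OF inR[OF S]] by simp
      qed
      ultimately show ?case
        using tendsto_diff[OF whole compl.IH[unfolded P_def]] by (simp add: P_def right_diff_distrib)
    next
      case (union A)
      then have A: "A i \<in> sets lebesgue" for i unfolding gen[symmetric] by auto
      define U where "U = (\<Union>i. A i)"
      \<comment> \<open>The part of the union outside the first \<open>k\<close> sets; it decreases
        to the empty set, so its measure in \<open>R\<close> tends to 0.\<close>
      define T where "T k = U - (\<Union>i<k. A i)" for k
      have U: "U \<in> sets lebesgue" and T: "T k \<in> sets lebesgue" for k
        using A unfolding U_def T_def by auto
      have ind_U: "indicator U x = (\<Sum>i<k. indicator (A i) x) + (indicator (T k) x :: real)" for x k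
      proof -
        have "disjoint_family_on A {..<k}" using union(1) by (rule disjoint_family_on_mono[rotated]) simp
        then have "(\<Sum>i<k. indicator (A i) x) = (indicator (\<Union>i<k. A i) x :: real)"
          by (subst indicator_UN_disjoint) auto
        moreover have "(\<Union>i<k. A i) \<subseteq> U" by (auto simp: U_def)
        ultimately show ?thesis by (auto simp: T_def indicator_def)
      qed
      \<comment> \<open>Stated for general \<open>f\<close> because it serves both
        \<open>W n\<close> and, with \<open>f = 1\<close>, the measure of \<open>U\<close>.\<close>
      have split: "(LINT x|lebesgue_on R. indicator U x * f x) = (\<Sum>i<k. LINT x|lebesgue_on R. indicator (A i) x * f x) + (LINT x|lebesgue_on R. indicator (T k) x * f x)"
        if f: "\<And>S. S \<in> sets lebesgue \<Longrightarrow> integrable (lebesgue_on R) (\<lambda>x. indicator S x * f x)" for k and f :: "'a \<Rightarrow> real"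
      proof -
        have "(LINT x|lebesgue_on R. indicator U x * f x) = (LINT x|lebesgue_on R. (\<Sum>i<k. indicator (A i) x * f x) + indicator (T k) x * f x)"
          by (simp add: ind_U[of _ k] distrib_right sum_distrib_right)
        also have "\<dots> = (\<Sum>i<k. LINT x|lebesgue_on R. indicator (A i) x * f x) + (LINT x|lebesgue_on R. indicator (T k) x * f x)"
        proof -
          have "(LINT x|lebesgue_on R. (\<Sum>i<k. indicator (A i) x * f x) + indicator (T k) x * f x)
              = (LINT x|lebesgue_on R. (\<Sum>i<k. indicator (A i) x * f x)) + (LINT x|lebesgue_on R. indicator (T k) x * f x)"
            by (rule Bochner_Integration.integral_add[OF Bochner_Integration.integrable_sum]) (rule f A T)+
          also have "(LINT x|lebesgue_on R. (\<Sum>i<k. indicator (A i) x * f x)) = (\<Sum>i<k. LINT x|lebesgue_on R. indicator (A i) x * f x)"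
            by (rule Bochner_Integration.integral_sum) (rule f[OF A])
          finally show ?thesis .
        qed
        finally show ?thesis .
      qed
      have meas: "(LINT x|lebesgue_on R. indicator S x * 1) = measure (lebesgue_on R) (S \<inter> R)" if "S \<in> sets lebesgue" for S
      proof -
        have "(LINT x|lebesgue_on R. indicator S x * 1) = (LINT x|lebesgue_on R. indicator (S \<inter> R) x :: real)"
          by (intro Bochner_Integration.integral_cong) (auto simp: indicator_def)
        then show ?thesis using inR[OF that] by simp
      qed
      have one: "integrable (lebesgue_on R) (\<lambda>x. indicator S x * 1 :: real)" if "S \<in> sets lebesgue" for S
      proof -
        have "integrable (lebesgue_on R) (\<lambda>x. 1 * indicator (S \<inter> R) x :: real)"
          by (rule integrable_real_mult_indicator[OF inR[OF that]]) simp
        moreover have "integrable (lebesgue_on R) (\<lambda>x. 1 * indicator (S \<inter> R) x :: real) \<longleftrightarrow> integrable (lebesgue_on R) (\<lambda>x. indicator S x * 1 :: real)"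
          by (intro Bochner_Integration.integrable_cong) (auto simp: indicator_def)
        ultimately show ?thesis by simp
      qed
      have mU: "measure (lebesgue_on R) (U \<inter> R) = (\<Sum>i<k. measure (lebesgue_on R) (A i \<inter> R)) + measure (lebesgue_on R) (T k \<inter> R)" for k
        using split[of "\<lambda>x. 1" k, OF one] by (simp only: meas U A T)
      have T0: "(\<lambda>k. measure (lebesgue_on R) (T k \<inter> R)) \<longlonglongrightarrow> 0"
      proof -
        have "(\<Inter>k. T k \<inter> R) = {}" by (auto simp: T_def U_def)
        moreover have "decseq (\<lambda>k. T k \<inter> R)" by (auto simp: decseq_def T_def)
        moreover have "range (\<lambda>k. T k \<inter> R) \<subseteq> sets (lebesgue_on R)" using inR[OF T] by auto
        ultimately show ?thesis using finite_Lim_measure_decseq[of "\<lambda>k. T k \<inter> R"] by simp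
      qed
      show ?case unfolding P_def U_def[symmetric]
      proof (rule LIMSEQ_I)
        fix e :: real assume e: "0 < e"
        obtain t where t: "0 < t" "\<And>n E. E \<in> sets (lebesgue_on R) \<Longrightarrow> measure (lebesgue_on R) E < t \<Longrightarrow>
            (LINT x|lebesgue_on R. indicator E x * \<bar>W n x\<bar>) < e / 4"
          using UI[of "e / 4"] e by auto
        have "0 < min t (e / (4 * (\<bar>m\<bar> + 1)))" using t(1) e by auto
        from order_tendstoD(2)[OF T0 this] obtain k where k: "measure (lebesgue_on R) (T k \<inter> R) < min t (e / (4 * (\<bar>m\<bar> + 1)))"
          by (auto simp: eventually_sequentially)
        have W_T: "\<bar>LINT x|lebesgue_on R. indicator (T k) x * W n x\<bar> < e / 4" for n
        proof -
          have "\<bar>LINT x|lebesgue_on R. indicator (T k) x * W n x\<bar> \<le> (LINT x|lebesgue_on R. \<bar>indicator (T k) x * W n x\<bar>)"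
            by (rule integral_abs_bound)
          also have "\<dots> = (LINT x|lebesgue_on R. indicator (T k \<inter> R) x * \<bar>W n x\<bar>)"
            by (intro Bochner_Integration.integral_cong) (auto simp: indicator_def)
          also have "\<dots> < e / 4" using k by (intro t(2) inR T) simp
          finally show ?thesis .
        qed
        have m_T: "\<bar>m * measure (lebesgue_on R) (T k \<inter> R)\<bar> \<le> e / 4"
        proof -
          have "\<bar>m * measure (lebesgue_on R) (T k \<inter> R)\<bar> \<le> (\<bar>m\<bar> + 1) * (e / (4 * (\<bar>m\<bar> + 1)))"
            unfolding abs_mult using k by (intro mult_mono) auto
          also have "\<dots> = e / 4"
          proof -
            have *: "c * (e / (4 * c)) = e / 4" if "0 < c" for c :: real using that by simp
            show ?thesis by (rule *) (simp add: add_nonneg_pos)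
          qed
          finally show ?thesis .
        qed
        have "(\<lambda>n. \<Sum>i<k. LINT x|lebesgue_on R. indicator (A i) x * W n x) \<longlonglongrightarrow> (\<Sum>i<k. m * measure (lebesgue_on R) (A i \<inter> R))"
          using union.IH by (intro tendsto_sum) (auto simp: P_def)
        then obtain no where no: "\<And>n. no \<le> n \<Longrightarrow> \<bar>(\<Sum>i<k. LINT x|lebesgue_on R. indicator (A i) x * W n x) - (\<Sum>i<k. m * measure (lebesgue_on R) (A i \<inter> R))\<bar> < e / 4"
          using LIMSEQ_D[where r = "e / 4"] e by fastforce
        have mU': "m * measure (lebesgue_on R) (U \<inter> R) = (\<Sum>i<k. m * measure (lebesgue_on R) (A i \<inter> R)) + m * measure (lebesgue_on R) (T k \<inter> R)"
          by (simp add: mU[of k] distrib_left sum_distrib_left)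
        show "\<exists>no. \<forall>n\<ge>no. norm ((LINT x|lebesgue_on R. indicator U x * W n x) - m * measure (lebesgue_on R) (U \<inter> R)) < e"
        proof (intro exI[of _ no] allI impI)
          fix n assume "no \<le> n"
          then show "norm ((LINT x|lebesgue_on R. indicator U x * W n x) - m * measure (lebesgue_on R) (U \<inter> R)) < e"
            using no[of n] W_T[of n] m_T split[of "W n" k, OF ind] mU' e unfolding real_norm_def by linarith
        qed
      qed
    qed
  qed
  \<comment> \<open>By completion \<open>A\<close> agrees almost everywhere with a Borel set, which
    alters neither integrals nor measures.\<close>
  obtain S N N' where S: "A = S \<union> N" "N \<subseteq> N'" "N' \<in> null_sets lborel" "S \<in> sets lborel"
    using A by (rule sets_completionE)
  have "AE x in lborel. x \<notin> N'" using S(3) by (rule AE_not_in)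
  then have "AE x in lebesgue. x \<notin> N'" by (rule AE_completion)
  then have "AE x in lebesgue_on R. x \<notin> N'" by (subst AE_restrict_space_iff) auto
  then have AS: "AE x in lebesgue_on R. x \<in> A \<longleftrightarrow> x \<in> S"
    by eventually_elim (use S in auto)
  have S': "S \<in> sets borel" using S(4) by simp
  then have SL: "S \<in> sets lebesgue" by auto
  have "(LINT x|lebesgue_on R. indicator A x * W n x) = (LINT x|lebesgue_on R. indicator S x * W n x)" for n
    using AS borel_measurable_integrable[OF ind[OF A]] borel_measurable_integrable[OF ind[OF SL]]
    by (intro integral_cong_AE) (auto simp: indicator_def)
  moreover have "measure (lebesgue_on R) (A \<inter> R) = measure (lebesgue_on R) (S \<inter> R)"
    using AS inR[OF A] inR[OF SL] by (intro finite_measure_eq_AE) auto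
  ultimately show ?thesis using borel[OF S'] by (simp add: P_def)
qed

section \<open>Restriction to subsets, essential bounds, and the core common to all
  exponents\<close>

lemma lebesgue_on_subset:
  fixes f :: "'a::euclidean_space \<Rightarrow> real"
  assumes S: "S \<in> sets lebesgue" and R: "R \<in> sets lebesgue" and SR: "S \<subseteq> R"
    and f: "integrable (lebesgue_on R) f"
  shows "integrable (lebesgue_on S) f"
    and "(\<And>x. 0 \<le> f x) \<Longrightarrow> (LINT x|lebesgue_on S. f x) \<le> (LINT x|lebesgue_on R. f x)"
    and "(\<And>x. x \<notin> S \<Longrightarrow> f x = 0) \<Longrightarrow> (LINT x|lebesgue_on S. f x) = (LINT x|lebesgue_on R. f x)"
proof -
  have iR: "integrable lebesgue (\<lambda>x. indicator R x *\<^sub>R f x)"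
    using f R by (subst (asm) integrable_restrict_space) auto
  have "integrable lebesgue (\<lambda>x. indicator S x *\<^sub>R (indicator R x *\<^sub>R f x))"
    by (rule integrable_mult_indicator[OF S iR])
  moreover have "(\<lambda>x. indicator S x *\<^sub>R (indicator R x *\<^sub>R f x)) = (\<lambda>x. indicator S x *\<^sub>R f x)"
    using SR by (auto simp: indicator_def fun_eq_iff)
  ultimately have iS: "integrable lebesgue (\<lambda>x. indicator S x *\<^sub>R f x)" by simp
  then show "integrable (lebesgue_on S) f" using S by (subst integrable_restrict_space) auto
  have e: "(LINT x|lebesgue_on S. f x) = (LINT x|lebesgue. indicator S x *\<^sub>R f x)"
    "(LINT x|lebesgue_on R. f x) = (LINT x|lebesgue. indicator R x *\<^sub>R f x)"
    using S R by (intro integral_restrict_space; simp)+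
  show "(LINT x|lebesgue_on S. f x) \<le> (LINT x|lebesgue_on R. f x)" if "\<And>x. 0 \<le> f x"
    unfolding e using that SR by (intro integral_mono[OF iS iR]) (auto simp: indicator_def)
  show "(LINT x|lebesgue_on S. f x) = (LINT x|lebesgue_on R. f x)" if "\<And>x. x \<notin> S \<Longrightarrow> f x = 0"
    unfolding e using that SR by (intro Bochner_Integration.integral_cong) (auto simp: indicator_def)
qed

text \<open>Apply the counting bound to the indicator of the points with
  \<open>K < \<bar>f x\<bar>\<close>, which inherits periodicity: no mass in one cell means no mass
  in a dilated box.\<close>

lemma AE_dilate_periodic:
  fixes f :: "real ^ 'n \<Rightarrow> real" and a b c d :: "real ^ 'n"
  assumes f[measurable]: "f \<in> borel_measurable lebesgue"
    and per: "\<And>j. AE x in lebesgue. f (x + ((b - a) $ j) *\<^sub>R axis j 1) = f x"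
    and ab: "\<And>j. a $ j < b $ j" and cd: "\<And>j. c $ j \<le> d $ j" and h: "0 < h"
    and K: "AE x in lebesgue_on (box a b). \<bar>f x\<bar> \<le> K"
  shows "AE x in lebesgue_on (box c d). \<bar>f (h *\<^sub>R x)\<bar> \<le> K"
proof -
  define g where "g x = (indicator {y. K < \<bar>y\<bar>} (f x) :: ennreal)" for x
  have gm[measurable]: "g \<in> borel_measurable lebesgue" unfolding g_def by measurable
  have gper: "AE x in lebesgue. g (x + ((b - a) $ j) *\<^sub>R axis j 1) = g x" for j
    using per[of j] by eventually_elim (simp add: g_def)
  have hm: "(\<lambda>x. g (h *\<^sub>R x)) \<in> borel_measurable lebesgue" by measurable
  have "(\<integral>\<^sup>+x. g x \<partial>lebesgue_on (box a b)) = 0"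
  proof (subst nn_integral_0_iff_AE)
    show "g \<in> borel_measurable (lebesgue_on (box a b))" by (rule measurable_restrict_space1[OF gm])
    show "AE x in lebesgue_on (box a b). g x = 0" using K by eventually_elim (simp add: g_def)
  qed
  then have "(\<integral>\<^sup>+x. g (h *\<^sub>R x) \<partial>lebesgue_on (box c d)) = 0"
    using nn_integral_dilate_periodic(1)[OF gm gper ab cd h] by simp
  then have "AE x in lebesgue_on (box c d). g (h *\<^sub>R x) = 0"
    using measurable_restrict_space1[OF hm] by (subst (asm) nn_integral_0_iff_AE) auto
  then show ?thesis
    by eventually_elim (auto simp: g_def indicator_def split: if_splits)
qed

text \<open>\<open>Lp_loc\<close> speaks of compact sets only; truncations to growing balls converge
  pointwise to \<open>f\<close>.\<close>

lemma borel_measurable_lebesgue_of_cballs: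
  fixes f :: "'a::euclidean_space \<Rightarrow> real"
  assumes "\<And>k :: nat. f \<in> borel_measurable (lebesgue_on (cball 0 (real k)))"
  shows "f \<in> borel_measurable lebesgue"
proof (rule borel_measurable_LIMSEQ_real)
  show "(\<lambda>x. indicator (cball 0 (real k)) x *\<^sub>R f x) \<in> borel_measurable lebesgue" for k
    using assms[of k] by (subst (asm) borel_measurable_restrict_space_iff) auto
  fix x :: 'a
  obtain k :: nat where "norm x \<le> real k" using real_arch_simple by blast
  then show "(\<lambda>k. indicator (cball 0 (real k)) x *\<^sub>R f x) \<longlonglongrightarrow> f x"
    by (intro tendsto_eventually eventually_sequentiallyI[of k]) auto
qed

text \<open>Counting is available on boxes, so the work is done on a box containing
  \<open>\<Omega>\<close> and restricted to \<open>\<Omega>\<close> afterwards. No exponent occurs: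
  convergence against bounded functions on the cell is what both notions of weak convergence
  supply.\<close>

lemma dilate_weak_limit_bounded_test:
  fixes v :: "nat \<Rightarrow> real ^ 'n \<Rightarrow> real" and a b :: "real ^ 'n" and \<Omega> :: "(real ^ 'n) set"
  assumes v: "\<And>n. v n \<in> borel_measurable lebesgue"
    and per: "\<And>n j. AE x in lebesgue. v n (x + ((b - a) $ j) *\<^sub>R axis j 1) = v n x"
    and ab: "\<And>j. a $ j < b $ j" and cd: "\<And>j. c $ j \<le> d $ j"
    and \<Omega>: "\<Omega> \<in> sets lebesgue" "\<Omega> \<subseteq> box c d"
    and int: "\<And>n. integrable (lebesgue_on (box a b)) (v n)" and int0: "integrable (lebesgue_on (box a b)) v0"
    and B: "\<And>n. (LINT x|lebesgue_on (box a b). \<bar>v n x\<bar>) \<le> B"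
    and conv: "\<And>g K. g \<in> borel_measurable (lebesgue_on (box a b)) \<Longrightarrow> (\<And>x. \<bar>g x\<bar> \<le> K) \<Longrightarrow>
      (\<lambda>n. LINT x|lebesgue_on (box a b). v n x * g x) \<longlonglongrightarrow> (LINT x|lebesgue_on (box a b). v0 x * g x)"
  defines "W \<equiv> \<lambda>n x. v n (real (Suc n) *\<^sub>R x)"
    and "m \<equiv> (LINT x|lebesgue_on (box a b). v0 x) / measure lebesgue (box a b)"
  shows "integrable (lebesgue_on \<Omega>) (W n)"
    and "\<And>e. 0 < e \<Longrightarrow> \<exists>t>0. \<forall>n. \<forall>E\<in>sets (lebesgue_on \<Omega>). measure (lebesgue_on \<Omega>) E < t \<longrightarrow>
       (LINT x|lebesgue_on \<Omega>. indicator E x * \<bar>W n x\<bar>) < e"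
    and "\<And>g K. g \<in> borel_measurable (lebesgue_on \<Omega>) \<Longrightarrow> (\<And>x. \<bar>g x\<bar> \<le> K) \<Longrightarrow>
      (\<lambda>n. LINT x|lebesgue_on \<Omega>. W n x * g x) \<longlonglongrightarrow> (LINT x|lebesgue_on \<Omega>. m * g x)"
proof -
  let ?R = "box c d"
  interpret Y: finite_measure "lebesgue_on (box a b)" by (rule finite_measure_lebesgue_on) auto
  have finR: "finite_measure (lebesgue_on ?R)" by (rule finite_measure_lebesgue_on) auto
  then interpret R: finite_measure "lebesgue_on ?R" .
  have "?R \<in> lmeasurable" by simp
  then have "\<Omega> \<in> lmeasurable" using \<Omega> by (meson fmeasurableI2)
  then have "finite_measure (lebesgue_on \<Omega>)" by (rule finite_measure_lebesgue_on)
  then interpret O: finite_measure "lebesgue_on \<Omega>" .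
  have RL: "?R \<in> sets lebesgue" by simp
  have UI_Y: "\<exists>t>0. \<forall>n. \<forall>E\<in>sets (lebesgue_on (box a b)). measure (lebesgue_on (box a b)) E < t \<longrightarrow>
       (LINT x|lebesgue_on (box a b). indicator E x * \<bar>v n x\<bar>) < e" if e: "0 < e" for e
  proof -
    have i: "integrable (lebesgue_on (box a b)) (\<lambda>x. f x * g x)"
      if "integrable (lebesgue_on (box a b)) f" "g \<in> borel_measurable (lebesgue_on (box a b))" "\<And>x. \<bar>g x\<bar> \<le> 1" for f g :: "real ^ 'n \<Rightarrow> real"
      using that(1) by (rule Bochner_Integration.integrable_bound)
        (use that in \<open>auto simp: abs_mult intro!: mult_left_le AE_I2\<close>)
    \<comment> \<open>\<open>Vitali_Hahn_Saks_uniform\<close> requires limit 0, so it is applied to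
      \<open>v n x - v0 x\<close>; the single function \<open>v0\<close> is absolutely continuous on
      its own.\<close>
    have "\<exists>t>0. \<forall>n. \<forall>E\<in>sets (lebesgue_on (box a b)). measure (lebesgue_on (box a b)) E < t \<longrightarrow>
        (LINT x|lebesgue_on (box a b). indicator E x * \<bar>v n x - v0 x\<bar>) < e / 2"
    proof (rule Y.Vitali_Hahn_Saks_uniform)
      show "integrable (lebesgue_on (box a b)) (\<lambda>x. v n x - v0 x)" for n using int int0 by auto
      fix g :: "real ^ 'n \<Rightarrow> real"
      assume g: "g \<in> borel_measurable (lebesgue_on (box a b))" "\<And>x. \<bar>g x\<bar> \<le> 1"
      have "(LINT x|lebesgue_on (box a b). (v n x - v0 x) * g x) = (LINT x|lebesgue_on (box a b). v n x * g x) - (LINT x|lebesgue_on (box a b). v0 x * g x)" for n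
        using i[OF int g] i[OF int0 g] by (simp add: left_diff_distrib)
      then show "(\<lambda>n. LINT x|lebesgue_on (box a b). (v n x - v0 x) * g x) \<longlonglongrightarrow> 0"
        using conv[OF g] by (simp add: LIM_zero)
    qed (use e in simp)
    then obtain t1 where t1: "0 < t1" "\<And>n E. E \<in> sets (lebesgue_on (box a b)) \<Longrightarrow> measure (lebesgue_on (box a b)) E < t1 \<Longrightarrow>
        (LINT x|lebesgue_on (box a b). indicator E x * \<bar>v n x - v0 x\<bar>) < e / 2" by blast
    obtain t2 where t2: "0 < t2" "\<And>E. E \<in> sets (lebesgue_on (box a b)) \<Longrightarrow> measure (lebesgue_on (box a b)) E < t2 \<Longrightarrow>
        (LINT x|lebesgue_on (box a b). indicator E x * \<bar>v0 x\<bar>) < e / 2"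
      using Y.integral_absolutely_continuous[OF int0, of "e / 2"] e by auto
    show ?thesis
    proof (intro exI[of _ "min t1 t2"] conjI allI ballI impI)
      fix n E assume E: "E \<in> sets (lebesgue_on (box a b))" and mE: "measure (lebesgue_on (box a b)) E < min t1 t2"
      have iE: "integrable (lebesgue_on (box a b)) (\<lambda>x. indicator E x * \<bar>f x\<bar>)" if "integrable (lebesgue_on (box a b)) f" for f :: "real ^ 'n \<Rightarrow> real"
        using i[OF integrable_abs[OF that], of "indicator E"] E by (simp add: mult.commute indicator_def[abs_def])
      have i1: "integrable (lebesgue_on (box a b)) (\<lambda>x. indicator E x * \<bar>v n x - v0 x\<bar>)" using int int0 by (intro iE) auto
      have "(LINT x|lebesgue_on (box a b). indicator E x * \<bar>v n x\<bar>) \<le> (LINT x|lebesgue_on (box a b). indicator E x * \<bar>v n x - v0 x\<bar> + indicator E x * \<bar>v0 x\<bar>)"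
        by (intro integral_mono iE int Bochner_Integration.integrable_add i1 int0) (auto simp: indicator_def)
      also have "\<dots> = (LINT x|lebesgue_on (box a b). indicator E x * \<bar>v n x - v0 x\<bar>) + (LINT x|lebesgue_on (box a b). indicator E x * \<bar>v0 x\<bar>)"
        by (rule Bochner_Integration.integral_add[OF i1 iE[OF int0]])
      also have "\<dots> < e / 2 + e / 2" using t1(2)[OF E] t2(2)[OF E] mE by (intro add_strict_mono) auto
      finally show "(LINT x|lebesgue_on (box a b). indicator E x * \<bar>v n x\<bar>) < e" by simp
    qed (use t1 t2 in auto)
  qed
  have UI_R: "\<exists>t>0. \<forall>n. \<forall>E\<in>sets (lebesgue_on ?R). measure (lebesgue_on ?R) E < t \<longrightarrow>
       (LINT x|lebesgue_on ?R. indicator E x * \<bar>W n x\<bar>) < e" if "0 < e" for e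
    unfolding W_def by (rule uniformly_integrable_dilate[OF v per ab cd int B UI_Y that])
  have W_R: "integrable (lebesgue_on ?R) (W n)" for n
    unfolding W_def by (rule integral_dilate_periodic(1)[OF v per ab cd _ int]) simp
  have lim: "(\<lambda>n. LINT x|lebesgue_on (box a b). v n x) \<longlonglongrightarrow> (LINT x|lebesgue_on (box a b). v0 x)"
    using conv[of "\<lambda>x. 1" 1] by simp
  have boxes: "(\<lambda>n. LINT x|lebesgue_on (box c' d'). W n x) \<longlonglongrightarrow> m * measure lebesgue (box c' d')"
    if "\<And>j. c' $ j \<le> d' $ j" for c' d'
    unfolding W_def m_def by (rule tendsto_integral_dilate_box[OF v per ab that int B lim])
  have WR_ind: "integrable (lebesgue_on ?R) (\<lambda>x. indicator A x * \<bar>W n x\<bar>)"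
      "integrable (lebesgue_on ?R) (\<lambda>x. indicator A x * W n x)" if "A \<in> sets lebesgue" for A n
  proof -
    have A': "A \<inter> ?R \<in> sets (lebesgue_on ?R)"
      using that by (subst sets_restrict_space_iff) auto
    have "integrable (lebesgue_on ?R) (\<lambda>x. f x * indicator (A \<inter> ?R) x) \<longleftrightarrow> integrable (lebesgue_on ?R) (\<lambda>x. indicator A x * f x)" for f :: "real ^ 'n \<Rightarrow> real"
      by (intro Bochner_Integration.integrable_cong) (auto simp: indicator_def)
    then show "integrable (lebesgue_on ?R) (\<lambda>x. indicator A x * \<bar>W n x\<bar>)" "integrable (lebesgue_on ?R) (\<lambda>x. indicator A x * W n x)"
      using integrable_real_mult_indicator[OF A' W_R[of n]] integrable_real_mult_indicator[OF A' integrable_abs[OF W_R[of n]]] by auto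
  qed
  have setsconv: "(\<lambda>n. LINT x|lebesgue_on ?R. indicator A x * W n x) \<longlonglongrightarrow> m * measure (lebesgue_on ?R) (A \<inter> ?R)" if "A \<in> sets lebesgue" for A
  proof (rule tendsto_integral_of_boxes[OF finR RL W_R UI_R _ _ that])
    show "(\<lambda>n. LINT x|lebesgue_on ?R. W n x) \<longlonglongrightarrow> m * measure (lebesgue_on ?R) ?R"
      using boxes[OF cd] by (simp add: measure_restrict_space)
    fix c' d' :: "real ^ 'n"
    obtain c2 d2 where cd2: "box c' d' \<inter> ?R = box c2 d2" using box_Int_box by blast
    have "(LINT x|lebesgue_on ?R. indicator (box c' d') x * W n x) = (LINT x|lebesgue_on (box c2 d2). W n x)" for n
    proof -
      have "(LINT x|lebesgue_on ?R. indicator (box c' d') x * W n x) = (LINT x|lebesgue. indicator ?R x *\<^sub>R (indicator (box c' d') x * W n x))"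
        by (rule integral_restrict_space) simp
      also have "\<dots> = (LINT x|lebesgue. indicator (box c2 d2) x *\<^sub>R W n x)"
        by (intro Bochner_Integration.integral_cong) (auto simp: indicator_def cd2[symmetric])
      also have "\<dots> = (LINT x|lebesgue_on (box c2 d2). W n x)"
        by (rule integral_restrict_space[symmetric]) simp
      finally show ?thesis .
    qed
    moreover have "measure (lebesgue_on ?R) (box c' d' \<inter> ?R) = measure lebesgue (box c2 d2)"
      using cd2 by (subst measure_restrict_space) auto
    moreover have "(\<lambda>n. LINT x|lebesgue_on (box c2 d2). W n x) \<longlonglongrightarrow> m * measure lebesgue (box c2 d2)"
    \<comment> \<open>The intersection may be empty with corners out of order, a case that
      \<open>boxes\<close> does not cover.\<close>
    proof (cases "\<forall>j. c2 $ j \<le> d2 $ j")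
      case True
      then show ?thesis by (intro boxes) auto
    next
      case False
      then obtain j where "d2 $ j < c2 $ j" by (auto simp: not_le)
      then have "box c2 d2 = {}" unfolding interval_eq_empty_cart by (auto intro: less_imp_le)
      moreover have "(LINT x|lebesgue_on {}. W n x) = 0" for n
        by (subst integral_restrict_space) auto
      ultimately show ?thesis by simp
    qed
    ultimately show "(\<lambda>n. LINT x|lebesgue_on ?R. indicator (box c' d') x * W n x) \<longlonglongrightarrow> m * measure (lebesgue_on ?R) (box c' d' \<inter> ?R)"
      by simp
  qed
  \<comment> \<open>Measurable subsets of \<open>\<Omega>\<close> have the same measure in the box,
    so thresholds found there remain valid.\<close>
  have O_sets: "A \<in> sets lebesgue \<and> A \<subseteq> \<Omega> \<and> A \<in> sets (lebesgue_on ?R) \<and> A \<inter> ?R = A \<and>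
      measure (lebesgue_on ?R) A = measure (lebesgue_on \<Omega>) A" if "A \<in> sets (lebesgue_on \<Omega>)" for A
  proof -
    have A: "A \<in> sets lebesgue" "A \<subseteq> \<Omega>" using that \<Omega>(1) by (auto simp: sets_restrict_space_iff)
    moreover have "A \<in> sets (lebesgue_on ?R)" using A \<Omega> by (subst sets_restrict_space_iff) auto
    moreover have "measure (lebesgue_on ?R) A = measure lebesgue A" "measure (lebesgue_on \<Omega>) A = measure lebesgue A"
      using A \<Omega> by (auto intro!: measure_restrict_space)
    ultimately show ?thesis using \<Omega>(2) by auto
  qed
  show W_O: "integrable (lebesgue_on \<Omega>) (W n)" for n
    by (rule lebesgue_on_subset(1)[OF \<Omega>(1) RL \<Omega>(2) W_R])
  show "\<exists>t>0. \<forall>n. \<forall>E\<in>sets (lebesgue_on \<Omega>). measure (lebesgue_on \<Omega>) E < t \<longrightarrow>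
       (LINT x|lebesgue_on \<Omega>. indicator E x * \<bar>W n x\<bar>) < e" if "0 < e" for e
  proof -
    obtain t where t: "0 < t" "\<And>n E. E \<in> sets (lebesgue_on ?R) \<Longrightarrow> measure (lebesgue_on ?R) E < t \<Longrightarrow>
       (LINT x|lebesgue_on ?R. indicator E x * \<bar>W n x\<bar>) < e" using UI_R[OF \<open>0 < e\<close>] by blast
    have "(LINT x|lebesgue_on \<Omega>. indicator E x * \<bar>W n x\<bar>) < e"
      if E: "E \<in> sets (lebesgue_on \<Omega>)" "measure (lebesgue_on \<Omega>) E < t" for n E
    proof -
      have "(LINT x|lebesgue_on \<Omega>. indicator E x * \<bar>W n x\<bar>) = (LINT x|lebesgue_on ?R. indicator E x * \<bar>W n x\<bar>)"
        using O_sets[OF E(1)] by (intro lebesgue_on_subset(3)[OF \<Omega>(1) RL \<Omega>(2)] WR_ind) (auto simp: indicator_def)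
      then show ?thesis using t(2)[of E n] O_sets[OF E(1)] E(2) by simp
    qed
    then show ?thesis using t(1) by blast
  qed
  have W_B: "(LINT x|lebesgue_on \<Omega>. \<bar>W n x\<bar>) \<le> (\<Prod>j\<in>UNIV. (d $ j - c $ j) / (b $ j - a $ j) + 1) * B" for n
  proof -
    have "(LINT x|lebesgue_on \<Omega>. \<bar>W n x\<bar>) \<le> (LINT x|lebesgue_on ?R. \<bar>W n x\<bar>)"
      by (rule lebesgue_on_subset(2)[OF \<Omega>(1) RL \<Omega>(2) integrable_abs[OF W_R]]) simp
    also have "\<dots> \<le> (\<Prod>j\<in>UNIV. (d $ j - c $ j) / (b $ j - a $ j) + 1 / real (Suc n)) * (LINT x|lebesgue_on (box a b). \<bar>v n x\<bar>)"
      unfolding W_def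
    proof (rule integral_dilate_periodic_nonneg(2)[where f = "\<lambda>x. \<bar>v n x\<bar>", OF _ _ _ ab cd])
      show "AE x in lebesgue. \<bar>v n (x + (b - a) $ j *\<^sub>R axis j 1)\<bar> = \<bar>v n x\<bar>" for j
        using per[of n j] by eventually_elim simp
    qed (use v int in auto)
    also have "\<dots> \<le> (\<Prod>j\<in>UNIV. (d $ j - c $ j) / (b $ j - a $ j) + 1) * B"
      using ab cd by (intro mult_mono B prod_mono prod_nonneg)
        (auto intro!: integral_nonneg_AE add_nonneg_nonneg divide_nonneg_nonneg simp: less_imp_le)
    finally show ?thesis .
  qed
  have sets_O: "(\<lambda>n. LINT x|lebesgue_on \<Omega>. indicator A x * W n x) \<longlonglongrightarrow> (LINT x|lebesgue_on \<Omega>. indicator A x * m)" if A: "A \<in> sets (lebesgue_on \<Omega>)" for A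
  proof -
    have "(LINT x|lebesgue_on \<Omega>. indicator A x * W n x) = (LINT x|lebesgue_on ?R. indicator A x * W n x)" for n
      using O_sets[OF A] by (intro lebesgue_on_subset(3)[OF \<Omega>(1) RL \<Omega>(2)] WR_ind) (auto simp: indicator_def)
    moreover have AO: "A \<inter> \<Omega> = A" using O_sets[OF A] by auto
    then have "(LINT x|lebesgue_on \<Omega>. indicator A x * m) = m * measure (lebesgue_on \<Omega>) A"
      using A by simp
    ultimately show ?thesis using setsconv[of A] O_sets[OF A] AO by (simp add: mult.commute)
  qed
  show "(\<lambda>n. LINT x|lebesgue_on \<Omega>. W n x * g x) \<longlonglongrightarrow> (LINT x|lebesgue_on \<Omega>. m * g x)"
    if "g \<in> borel_measurable (lebesgue_on \<Omega>)" "\<And>x. \<bar>g x\<bar> \<le> K" for g K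
    by (rule O.tendsto_integral_bounded_test[OF W_O _ W_B sets_O that]) simp
qed

section \<open>Assembly for \<open>p = \<infinity>\<close> and for finite \<open>p\<close>\<close>

theorem theorem1:
  fixes p :: ennreal
    and \<Omega> Y :: "(real ^ 'n) set"
    and a b :: "real ^ 'n"
    and u :: "nat \<Rightarrow> real ^ 'n \<Rightarrow> real"
    and u_lim :: "real ^ 'n \<Rightarrow> real"
    and w :: "nat \<Rightarrow> real ^ 'n \<Rightarrow> real"
  assumes "1 \<le> p"
    and "open \<Omega>" and "bounded \<Omega>"
    and "\<And>j. a $ j < b $ j" and "Y = box a b"
    and "\<And>h. h \<ge> 1 \<Longrightarrow> u h \<in> Lp_loc p"
    and "\<And>h. h \<ge> 1 \<Longrightarrow> ae_periodic (b - a) (u h)"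
    and "Lp_weak_LIMSEQ p (lebesgue_on Y) u u_lim"
    and "\<And>h x. h \<ge> 1 \<Longrightarrow> w h x = u h (real h *\<^sub>R x)"
  shows "Lp_weak_LIMSEQ p (lebesgue_on \<Omega>) w
           (\<lambda>_. (LINT x|lebesgue_on Y. u_lim x) / measure lebesgue Y)"
proof -
  \<comment> \<open>Shifting the index drops the unconstrained term at 0 and makes the dilation
    factor \<open>real (Suc n)\<close> positive.\<close>
  define v where "v n = u (Suc n)" for n
  define W where "W n x = v n (real (Suc n) *\<^sub>R x)" for n x
  define m where "m = (LINT x|lebesgue_on Y. u_lim x) / measure lebesgue Y"
  have w_eq: "w (Suc n) = W n" for n
    using assms(9)[of "Suc n"] by (auto simp: W_def v_def fun_eq_iff)
  have ab: "a $ j < b $ j" for j by fact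
  have vm: "v n \<in> borel_measurable lebesgue" for n
  proof (rule borel_measurable_lebesgue_of_cballs)
    fix k :: nat
    have "u (Suc n) \<in> Lp_loc p" by (rule assms(6)) simp
    then have "u (Suc n) \<in> Lp_space p (lebesgue_on (cball 0 (real k)))"
      by (simp add: Lp_loc_def)
    then show "v n \<in> borel_measurable (lebesgue_on (cball 0 (real k)))"
      by (simp add: Lp_space_def v_def)
  qed
  have per: "AE x in lebesgue. v n (x + ((b - a) $ j) *\<^sub>R axis j 1) = v n x" for n j
    using assms(7)[of "Suc n"] by (simp add: ae_periodic_def v_def)
  obtain r0 where r0: "\<And>x. x \<in> \<Omega> \<Longrightarrow> norm x \<le> r0"
    using \<open>bounded \<Omega>\<close> by (auto simp: bounded_iff)
  \<comment> \<open>\<open>\<Omega>\<close> may be empty, which leaves the sign of \<open>r0\<close>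
    open; the \<open>+ 1\<close> makes room for strict inequalities in an open box.\<close>
  define d :: "real ^ 'n" where "d = (\<chi> j. \<bar>r0\<bar> + 1)"
  define c :: "real ^ 'n" where "c = - d"
  have cd: "c $ j \<le> d $ j" for j by (simp add: c_def d_def)
  have \<Omega>L: "\<Omega> \<in> sets lebesgue" using \<open>open \<Omega>\<close> by auto
  have \<Omega>R: "\<Omega> \<subseteq> box c d"
  proof
    fix x assume "x \<in> \<Omega>"
    then have "- \<bar>r0\<bar> - 1 < x $ j \<and> x $ j < \<bar>r0\<bar> + 1" for j
      using r0[of x] component_le_norm_cart[of x j] by linarith
    then show "x \<in> box c d" by (simp add: mem_box_cart c_def d_def)
  qed
  have RL: "box c d \<in> sets lebesgue" by simp
  interpret Y: finite_measure "lebesgue_on Y"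
    unfolding \<open>Y = box a b\<close> by (rule finite_measure_lebesgue_on) auto
  have "box c d \<in> lmeasurable" by simp
  then have "\<Omega> \<in> lmeasurable" using \<Omega>L \<Omega>R by (meson fmeasurableI2)
  then interpret O: finite_measure "lebesgue_on \<Omega>" by (rule finite_measure_lebesgue_on)
  define C where "C = (\<Prod>j\<in>UNIV. (d $ j - c $ j) / (b $ j - a $ j) + 1)"
  have C_up: "(\<Prod>j\<in>UNIV. (d $ j - c $ j) / (b $ j - a $ j) + 1 / real (Suc n)) \<le> C" for n
    unfolding C_def using ab cd by (intro prod_mono) (auto intro!: add_nonneg_nonneg divide_nonneg_nonneg simp: less_imp_le)
  have Wm: "W n \<in> borel_measurable (lebesgue_on \<Omega>)" for n
  proof -
    have "(\<lambda>x. v n (real (Suc n) *\<^sub>R x)) \<in> borel_measurable lebesgue"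
      using vm[of n] by measurable
    then show ?thesis unfolding W_def[abs_def] by (rule measurable_restrict_space1)
  qed
  have weak: "(\<forall>h\<ge>1. u h \<in> Lp_space p (lebesgue_on Y))" "u_lim \<in> Lp_space p (lebesgue_on Y)"
    using assms(8) by (auto simp: Lp_weak_LIMSEQ_def)
  have v_Lp: "v n \<in> Lp_space p (lebesgue_on Y)" for n using weak(1) by (simp add: v_def)
  show ?thesis
  proof (cases "p = \<infinity>")
    case True
    have conv: "(\<lambda>n. LINT x|lebesgue_on Y. v n x * \<phi> x) \<longlonglongrightarrow> (LINT x|lebesgue_on Y. u_lim x * \<phi> x)"
      if "integrable (lebesgue_on Y) \<phi>" for \<phi>
    proof -
      have "\<phi> \<in> Lp_space 1 (lebesgue_on Y)" using that by (auto simp: Lp_space_def)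
      then have "(\<lambda>h. LINT x|lebesgue_on Y. u h x * \<phi> x) \<longlonglongrightarrow> (LINT x|lebesgue_on Y. u_lim x * \<phi> x)"
        using assms(8) True by (simp add: Lp_weak_LIMSEQ_def)
      then show ?thesis unfolding v_def by (rule LIMSEQ_Suc)
    qed
    have "\<exists>K. \<forall>n. AE x in lebesgue_on Y. \<bar>v n x\<bar> \<le> K"
    proof (rule Y.weakly_star_bounded_imp_esssup_bounded)
      show "Bseq (\<lambda>n. LINT x|lebesgue_on Y. v n x * \<phi> x)" if "integrable (lebesgue_on Y) \<phi>" for \<phi>
        using conv[OF that] by (intro convergent_imp_Bseq convergentI)
    qed (use v_Lp True in simp)
    then obtain K where K: "\<And>n. AE x in lebesgue_on Y. \<bar>v n x\<bar> \<le> K" by blast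
    have vmY: "v n \<in> borel_measurable (lebesgue_on Y)" for n using vm by (rule measurable_restrict_space1)
    have int: "integrable (lebesgue_on Y) (v n)" for n
      using K[of n] vmY by (intro Y.integrable_const_bound[where B = K]) auto
    have u_lim_m: "u_lim \<in> borel_measurable (lebesgue_on Y)" using weak(2) by (simp add: Lp_space_def)
    have "AE x in lebesgue_on Y. \<bar>u_lim x\<bar> \<le> enn2real (esssup (lebesgue_on Y) (\<lambda>x. ennreal \<bar>u_lim x\<bar>))"
    proof -
      have "esssup (lebesgue_on Y) (\<lambda>x. ennreal \<bar>u_lim x\<bar>) < \<infinity>"
        using weak(2) True by (simp add: Lp_space_def)
      then have "ennreal (enn2real (esssup (lebesgue_on Y) (\<lambda>x. ennreal \<bar>u_lim x\<bar>))) = esssup (lebesgue_on Y) (\<lambda>x. ennreal \<bar>u_lim x\<bar>)"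
        by simp
      then have "AE x in lebesgue_on Y. ennreal \<bar>u_lim x\<bar> \<le> ennreal (enn2real (esssup (lebesgue_on Y) (\<lambda>x. ennreal \<bar>u_lim x\<bar>)))"
        using esssup_AE[of "\<lambda>x. ennreal \<bar>u_lim x\<bar>" "lebesgue_on Y"] by simp
      then show ?thesis by eventually_elim (simp add: ennreal_le_iff)
    qed
    then have int0: "integrable (lebesgue_on Y) u_lim"
      using u_lim_m by (intro Y.integrable_const_bound) auto
    have B: "(LINT x|lebesgue_on Y. \<bar>v n x\<bar>) \<le> (LINT x|lebesgue_on Y. K)" for n
      using K[of n] int by (intro integral_mono_AE) auto
    \<comment> \<open>Bounded functions are integrable on the bounded rectangle, hence admissible in
      weak-* convergence.\<close>
    have conv': "(\<lambda>n. LINT x|lebesgue_on Y. v n x * g x) \<longlonglongrightarrow> (LINT x|lebesgue_on Y. u_lim x * g x)"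
      if "g \<in> borel_measurable (lebesgue_on Y)" "\<And>x. \<bar>g x\<bar> \<le> K'" for g K'
      using that by (intro conv Y.integrable_const_bound[where B = K']) auto
    note core = dilate_weak_limit_bounded_test[OF vm per ab cd \<Omega>L \<Omega>R int[unfolded assms(5)] int0[unfolded assms(5)]
        B[unfolded assms(5)] conv'[unfolded assms(5)], folded assms(5), folded m_def W_def]
    have KW: "AE x in lebesgue_on \<Omega>. \<bar>W n x\<bar> \<le> K" for n
    proof -
      have "AE x in lebesgue_on (box c d). \<bar>v n (real (Suc n) *\<^sub>R x)\<bar> \<le> K"
        by (rule AE_dilate_periodic[OF vm per ab cd _ K[unfolded assms(5)]]) simp
      then show ?thesis using \<Omega>L \<Omega>R unfolding W_def
        by (auto simp: AE_restrict_space_iff elim!: eventually_mono)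
    qed
    have "Lp_weak_LIMSEQ \<infinity> (lebesgue_on \<Omega>) w (\<lambda>_. m)"
      unfolding Lp_weak_LIMSEQ_def
    proof (intro conjI allI impI)
      have mem: "f \<in> Lp_space \<infinity> (lebesgue_on \<Omega>)"
        if f: "f \<in> borel_measurable (lebesgue_on \<Omega>)" "AE x in lebesgue_on \<Omega>. \<bar>f x\<bar> \<le> K'" for f K'
      proof -
        have "esssup (lebesgue_on \<Omega>) (\<lambda>x. ennreal \<bar>f x\<bar>) \<le> ennreal K'"
          using f by (intro esssup_I) (auto elim!: eventually_mono intro: ennreal_leI)
        then show ?thesis using f(1) by (simp add: Lp_space_def le_less_trans)
      qed
      show "w h \<in> Lp_space \<infinity> (lebesgue_on \<Omega>)" if "1 \<le> h" for h
      proof -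
        obtain n where "h = Suc n" using \<open>1 \<le> h\<close> by (cases h) auto
        then show ?thesis using mem[OF Wm KW] by (simp add: w_eq)
      qed
      show "(\<lambda>_. m) \<in> Lp_space \<infinity> (lebesgue_on \<Omega>)" by (rule mem[where K' = "\<bar>m\<bar>"]) auto
      have "(\<lambda>h. LINT x|lebesgue_on \<Omega>. w h x * \<phi> x) \<longlonglongrightarrow> (LINT x|lebesgue_on \<Omega>. m * \<phi> x)"
        if "\<phi> \<in> Lp_space 1 (lebesgue_on \<Omega>)" for \<phi>
      proof (rule LIMSEQ_imp_Suc, unfold w_eq, rule O.integral_mult_tendsto_of_bounded[OF Wm _ KW])
        show "integrable (lebesgue_on \<Omega>) \<phi>"
          using that by (auto simp: Lp_space_def intro: integrable_abs_cancel)
        then show "integrable (lebesgue_on \<Omega>) (\<lambda>x. m * \<phi> x)" by simp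
      qed (rule core(3))
      then show "if \<infinity> = (\<infinity> :: ennreal)
         then \<forall>\<phi>\<in>Lp_space 1 (lebesgue_on \<Omega>). (\<lambda>h. LINT x|lebesgue_on \<Omega>. w h x * \<phi> x) \<longlonglongrightarrow> (LINT x|lebesgue_on \<Omega>. m * \<phi> x)
         else \<forall>F. Lp_functional \<infinity> (lebesgue_on \<Omega>) F \<longrightarrow> (\<lambda>h. F (w h)) \<longlonglongrightarrow> F (\<lambda>_. m)" by simp
    qed
    then show ?thesis using True by (simp add: m_def)
  next
    case False
    interpret YL: finite_exponent_Lp "lebesgue_on Y" p by standard (use assms(1) False in auto)
    interpret OL: finite_exponent_Lp "lebesgue_on \<Omega>" p by standard (use assms(1) False in auto)
    have conv: "(\<lambda>n. F (v n)) \<longlonglongrightarrow> F u_lim" if "Lp_functional p (lebesgue_on Y) F" for F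
    proof -
      have "(\<lambda>h. F (u h)) \<longlonglongrightarrow> F u_lim" using assms(8) False that by (simp add: Lp_weak_LIMSEQ_def)
      then show ?thesis unfolding v_def by (rule LIMSEQ_Suc)
    qed
    have int: "integrable (lebesgue_on Y) (v n)" for n by (rule YL.Lp_integrable[OF v_Lp])
    have int0: "integrable (lebesgue_on Y) u_lim" by (rule YL.Lp_integrable[OF weak(2)])
    have conv': "(\<lambda>n. LINT x|lebesgue_on Y. v n x * g x) \<longlonglongrightarrow> (LINT x|lebesgue_on Y. u_lim x * g x)"
      if "g \<in> borel_measurable (lebesgue_on Y)" "\<And>x. \<bar>g x\<bar> \<le> K'" for g K'
      by (rule conv[OF YL.Lp_functional_bounded_density[OF that]])
    have "\<exists>K. \<forall>n. Lp_norm p (lebesgue_on Y) (v n) \<le> K"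
      using v_Lp conv by (intro YL.weakly_bounded_imp_norm_bounded) (auto intro: convergent_imp_Bseq convergentI)
    then obtain K where K: "\<And>n. Lp_norm p (lebesgue_on Y) (v n) \<le> K" by blast
    have Kr: "(LINT x|lebesgue_on Y. \<bar>v n x\<bar> powr YL.r) \<le> K powr YL.r" for n
      unfolding YL.Lp_norm_powr[symmetric] using YL.r_ge_1 K[of n] YL.Lp_norm_nonneg[of "v n"]
      by (intro powr_mono2) auto
    have ir: "integrable (lebesgue_on Y) (\<lambda>x. \<bar>v n x\<bar> powr YL.r)" for n
      using v_Lp[of n] by (simp add: YL.mem_Lp)
    \<comment> \<open>The core asks for an L^1 bound; on a finite measure space it follows from the
      bound on \<open>r\<close>-th powers.\<close>
    have B: "(LINT x|lebesgue_on Y. \<bar>v n x\<bar>) \<le> measure (lebesgue_on Y) (space (lebesgue_on Y)) + K powr YL.r" for n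
    proof -
      have "(LINT x|lebesgue_on Y. \<bar>v n x\<bar>) \<le> (LINT x|lebesgue_on Y. 1 + \<bar>v n x\<bar> powr YL.r)"
        using int ir YL.r_ge_1 by (intro integral_mono powr_abs_le_one_add) auto
      also have "\<dots> = measure (lebesgue_on Y) (space (lebesgue_on Y)) + (LINT x|lebesgue_on Y. \<bar>v n x\<bar> powr YL.r)"
        using ir by simp
      finally show ?thesis using Kr[of n] by simp
    qed
    note core = dilate_weak_limit_bounded_test[OF vm per ab cd \<Omega>L \<Omega>R int[unfolded assms(5)] int0[unfolded assms(5)]
        B[unfolded assms(5)] conv'[unfolded assms(5)], folded assms(5), folded m_def W_def]
    \<comment> \<open>The function \<open>\<bar>v n x\<bar> powr YL.r\<close> is itself periodic, so
      the counting bound applied to it carries the norm bound to the dilates.\<close>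
    have W_r: "integrable (lebesgue_on \<Omega>) (\<lambda>x. \<bar>W n x\<bar> powr YL.r) \<and> (LINT x|lebesgue_on \<Omega>. \<bar>W n x\<bar> powr YL.r) \<le> C * K powr YL.r" for n
    proof -
      have m1: "(\<lambda>x. \<bar>v n x\<bar> powr YL.r) \<in> borel_measurable lebesgue" using vm[of n] by measurable
      have p1: "AE x in lebesgue. \<bar>v n (x + ((b - a) $ j) *\<^sub>R axis j 1)\<bar> powr YL.r = \<bar>v n x\<bar> powr YL.r" for j
        using per[of n j] by eventually_elim simp
      have n1: "0 \<le> \<bar>v n x\<bar> powr YL.r" for x by simp
      have h: "0 < real (Suc n)" by simp
      note b = integral_dilate_periodic_nonneg[OF m1 n1 p1 ab cd h ir[unfolded assms(5)], folded assms(5) W_def]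
      have "(LINT x|lebesgue_on \<Omega>. \<bar>W n x\<bar> powr YL.r) \<le> (LINT x|lebesgue_on (box c d). \<bar>W n x\<bar> powr YL.r)"
        by (rule lebesgue_on_subset(2)[OF \<Omega>L RL \<Omega>R b(1)]) simp
      also have "\<dots> \<le> (\<Prod>j\<in>UNIV. (d $ j - c $ j) / (b $ j - a $ j) + 1 / real (Suc n)) * (LINT x|lebesgue_on Y. \<bar>v n x\<bar> powr YL.r)"
        by (rule b(2))
      also have "\<dots> \<le> C * K powr YL.r"
        using C_up[of n] Kr[of n] ab cd by (intro mult_mono)
          (auto simp: C_def less_imp_le intro!: prod_nonneg integral_nonneg_AE add_nonneg_nonneg divide_nonneg_nonneg)
      finally show ?thesis using lebesgue_on_subset(1)[OF \<Omega>L RL \<Omega>R b(1)] by simp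
    qed
    have W_Lp: "W n \<in> Lp_space p (lebesgue_on \<Omega>)" for n
      using W_r[of n] Wm[of n] by (simp add: OL.mem_Lp)
    have m_Lp: "(\<lambda>_. m) \<in> Lp_space p (lebesgue_on \<Omega>)"
      by (rule OL.Lp_bounded[where K = "\<bar>m\<bar>"]) auto
    have lim: "(\<lambda>h. F (w h)) \<longlonglongrightarrow> F (\<lambda>_. m)" if F: "Lp_functional p (lebesgue_on \<Omega>) F" for F
    proof (rule LIMSEQ_imp_Suc, unfold w_eq)
      show "(\<lambda>n. F (W n)) \<longlonglongrightarrow> F (\<lambda>_. m)"
        using W_r by (intro OL.Lp_functional_tendsto[OF W_Lp m_Lp _ core(2,3) F]) blast+
    qed
    have "Lp_weak_LIMSEQ p (lebesgue_on \<Omega>) w (\<lambda>_. m)"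
      unfolding Lp_weak_LIMSEQ_def
    proof (intro conjI allI impI)
      show "w h \<in> Lp_space p (lebesgue_on \<Omega>)" if "1 \<le> h" for h
      proof -
        obtain n where "h = Suc n" using \<open>1 \<le> h\<close> by (cases h) auto
        then show ?thesis using W_Lp by (simp add: w_eq)
      qed
    qed (use m_Lp lim False in auto)
    then show ?thesis by (simp add: m_def)
  qed
qed

end
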